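(* Let $r = p^k$ be a prime power ($p$ prime, $k\geq 1$), let $K$ be an $r$-unavoidable simplicial complex with vertices in $[m]$, and let $G = (\mathbb{Z}_p)^k$ be a $p$-torus acting freely on the set $[r]$. Let $K^r_\Delta$ and $K^{\ast r}_\Delta$ be respectively the $r$-fold ($2$-wise) deleted product and the $r$-fold ($2$-wise) deleted join of $K$. Then $$\mathrm{Ind}_G(K^r_\Delta)\;\geq\; \mathrm{Ind}_G(K^{\ast r}_\Delta) - r + 1\;\geq\; m - 2r + 1 .$$
   Context: Notation: $[m]=\{1,\dots,m\}$. A simplicial complex $K\subseteq 2^{[m]}$ "with vertices in $[m]$" means $\mathrm{Vert}(K)\subseteq [m]$ (the inclusion may be strict); simplicial complexes contain the empty face. A complex $K$ with vertices in $[m]$ is $r$-unavoidable ($r\ge 2$ an integer) if for all pairwise disjoint non-empty sets $A_1,\dots,A_r\subseteq [m]$ (their union need not be all of $[m]$) there is an $i$ with $A_i\in K$. Deleted join: $K^{\ast r}_\Delta$ is the simplicial complex on the vertex set $[m]\times[r]$ whose simplices are the $r$-tuples $(A_1,\dots,A_r)$ (identified with $\bigcup_i A_i\times\{i\}$) with $A_i\in K$ for all $i$ and $A_i\cap A_j=\emptyset$ for $i\neq j$. Deleted product: $K^r_\Delta\subseteq |K|^r$ is the subspace of all $r$-tuples $(x_1,\dots,x_r)$ of points of the geometric realization $|K|$ whose supports (the minimal faces of $K$ containing them) are pairwise disjoint. The action of $G$ on $[r]$ induces $G$-actions on $K^{\ast r}_\Delta$ and $K^r_\Delta$ by permuting coordinates;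 complexes are identified with their geometric realizations. Index: for a finite group $G$ and a $G$-space $X$, the $G$-genus $\gamma_G(X)$ is the smallest $n\in\mathbb{N}_0$ such that there exist proper subgroups $H_1,\dots,H_n\subsetneq G$ and a continuous $G$-equivariant map $X\to G/H_1\ast\cdots\ast G/H_n$ (join of discrete orbits, with the diagonal $G$-action); $\gamma_G(\emptyset)=0$, and $\gamma_G(X)=\infty$ if no such $n$ exists. The equivariant index is $\mathrm{Ind}_G(X):=\gamma_G(X)-1$. *)

theory Defs
  imports
    "HOL-Analysis.Analysis"
    "HOL-Algebra.Product_Groups"
    "HOL-Algebra.Elementary_Groups"
    "HOL-Algebra.Left_Coset"
    "HOL-Algebra.Group_Action"
begin

section \<open>Finite simplicial complexes and their geometric realizations\<close>

text \<open>Not every point of \<open>V\<close> has to be a vertex of \<open>K\<close>; the empty face always belongs to \<open>K\<close>.\<close>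

definition complex_within :: "'v set \<Rightarrow> 'v set set \<Rightarrow> bool" where
  "complex_within V K \<longleftrightarrow> K \<subseteq> Pow V \<and> {} \<in> K \<and> (\<forall>A\<in>K. \<forall>B. B \<subseteq> A \<longrightarrow> B \<in> K)"

text \<open>The support of a point, given by its barycentric coordinates, is the minimal face
  containing it.\<close>

definition support :: "('v \<Rightarrow> real) \<Rightarrow> 'v set" where
  "support x = {v. x v \<noteq> 0}"

text \<open>The topology is that of pointwise convergence of the barycentric coordinates, which for a
  finite complex (the only case considered here) is the usual topology of the realization.
  The realization of the complex consisting of the empty face only is the empty space.\<close>

definition realization :: "'v set set \<Rightarrow> ('v \<Rightarrow> real) topology" where
  "realization K = subtopology (powertop_real UNIV)
     {x. (\<forall>v. 0 \<le> x v) \<and> finite (support x) \<and> support x \<in> K \<and> (\<Sum>v\<in>support x. x v) = 1}"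

text \<open>The simplicial action on a realization induced by an action \<open>\<psi>\<close> on the set \<open>V\<close>
  containing all vertices: in coordinates, \<open>g\<close> sends the vertex \<open>v\<close> to \<open>\<psi> g v\<close>.
  Points outside \<open>V\<close>, where \<open>\<psi>\<close> is not controlled, keep coordinate 0.\<close>

definition simplicial_action ::
    "'g monoid \<Rightarrow> 'v set \<Rightarrow> ('g \<Rightarrow> 'v \<Rightarrow> 'v) \<Rightarrow> 'g \<Rightarrow> ('v \<Rightarrow> real) \<Rightarrow> ('v \<Rightarrow> real)" where
  "simplicial_action G V \<psi> g x = (\<lambda>v. if v \<in> V then x (\<psi> (inv\<^bsub>G\<^esub> g) v) else 0)"

section \<open>Unavoidable complexes, deleted joins and deleted products\<close>

definition unavoidable :: "nat \<Rightarrow> nat \<Rightarrow> nat set set \<Rightarrow> bool" where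
  "unavoidable r m K \<longleftrightarrow>
     (\<forall>A. (\<forall>i\<in>{1..r}. A i \<noteq> {} \<and> A i \<subseteq> {1..m}) \<and> disjoint_family_on A {1..r}
        \<longrightarrow> (\<exists>i\<in>{1..r}. A i \<in> K))"

definition deleted_join :: "nat \<Rightarrow> 'v set set \<Rightarrow> ('v \<times> nat) set set" where
  "deleted_join r K =
     {\<Union>i\<in>{1..r}. A i \<times> {i} | A. (\<forall>i\<in>{1..r}. A i \<in> K) \<and> disjoint_family_on A {1..r}}"

definition deleted_join_action ::
    "'g monoid \<Rightarrow> nat \<Rightarrow> ('g \<Rightarrow> nat \<Rightarrow> nat) \<Rightarrow> 'g \<Rightarrow> ('v \<times> nat \<Rightarrow> real) \<Rightarrow> ('v \<times> nat \<Rightarrow> real)" where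
  "deleted_join_action G r \<phi> =
     simplicial_action G (UNIV \<times> {1..r}) (\<lambda>g (v, i). (v, \<phi> g i))"

definition deleted_product :: "nat \<Rightarrow> 'v set set \<Rightarrow> (nat \<Rightarrow> 'v \<Rightarrow> real) topology" where
  "deleted_product r K =
     subtopology (product_topology (\<lambda>_. realization K) {1..r})
       {x. disjoint_family_on (\<lambda>i. support (x i)) {1..r}}"

definition deleted_product_action ::
    "'g monoid \<Rightarrow> nat \<Rightarrow> ('g \<Rightarrow> nat \<Rightarrow> nat) \<Rightarrow> 'g \<Rightarrow> (nat \<Rightarrow> 'v \<Rightarrow> real) \<Rightarrow> (nat \<Rightarrow> 'v \<Rightarrow> real)" where
  "deleted_product_action G r \<phi> g x = (\<lambda>i\<in>{1..r}. x (\<phi> (inv\<^bsub>G\<^esub> g) i))"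

section \<open>p-tori and free actions\<close>

definition p_torus :: "nat \<Rightarrow> nat \<Rightarrow> 'g monoid \<Rightarrow> bool" where
  "p_torus p k G \<longleftrightarrow> group G \<and> G \<cong> product_group {..<k} (\<lambda>_. integer_mod_group p)"

definition free_action :: "'g monoid \<Rightarrow> 'a set \<Rightarrow> ('g \<Rightarrow> 'a \<Rightarrow> 'a) \<Rightarrow> bool" where
  "free_action G E \<phi> \<longleftrightarrow> group_action G E \<phi> \<and> (\<forall>x\<in>E. stabilizer G \<phi> x = {\<one>\<^bsub>G\<^esub>})"

section \<open>Genus and equivariant index\<close>

text \<open>The join of the discrete orbits \<open>G/H\<^sub>1, \<dots>, G/H\<^sub>n\<close> for a finite group \<open>G\<close> is the
  realization of the complex whose vertices are the pairs \<open>(C, j)\<close> with \<open>C \<in> G/H\<^sub>j\<close> and whose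
  simplices contain at most one point of each orbit.\<close>

definition orbit_vertices :: "'g monoid \<Rightarrow> nat \<Rightarrow> (nat \<Rightarrow> 'g set) \<Rightarrow> ('g set \<times> nat) set" where
  "orbit_vertices G n H = (\<Union>j\<in>{1..n}. (lcosets\<^bsub>G\<^esub> (H j)) \<times> {j})"

definition orbit_join :: "'g monoid \<Rightarrow> nat \<Rightarrow> (nat \<Rightarrow> 'g set) \<Rightarrow> ('g set \<times> nat) set set" where
  "orbit_join G n H = {S. S \<subseteq> orbit_vertices G n H \<and> inj_on snd S}"

definition orbit_join_action ::
    "'g monoid \<Rightarrow> nat \<Rightarrow> (nat \<Rightarrow> 'g set) \<Rightarrow> 'g \<Rightarrow> ('g set \<times> nat \<Rightarrow> real) \<Rightarrow> ('g set \<times> nat \<Rightarrow> real)" where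
  "orbit_join_action G n H =
     simplicial_action G (orbit_vertices G n H) (\<lambda>g (C, j). (g <#\<^bsub>G\<^esub> C, j))"

text \<open>\<open>X\<close> is a \<open>G\<close>-space via \<open>\<psi>\<close>; only the values of \<open>\<psi>\<close> on \<open>carrier G\<close> and \<open>topspace X\<close>
  matter.  For \<open>n = 0\<close> the join of orbits is empty, so the genus is 0 iff \<open>X\<close> is empty; the
  infimum of the empty set is \<open>\<infinity>\<close>.\<close>

definition genus :: "'g monoid \<Rightarrow> 'a topology \<Rightarrow> ('g \<Rightarrow> 'a \<Rightarrow> 'a) \<Rightarrow> enat" where
  "genus G X \<psi> = Inf {enat n | n. \<exists>H f.
     (\<forall>j\<in>{1..n}. subgroup (H j) G \<and> H j \<noteq> carrier G) \<and>
     continuous_map X (realization (orbit_join G n H)) f \<and>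
     (\<forall>g\<in>carrier G. \<forall>x\<in>topspace X. f (\<psi> g x) = orbit_join_action G n H g (f x))}"

definition equivariant_index :: "'g monoid \<Rightarrow> 'a topology \<Rightarrow> ('g \<Rightarrow> 'a \<Rightarrow> 'a) \<Rightarrow> ereal" where
  "equivariant_index G X \<psi> = ereal_of_enat (genus G X \<psi>) - 1"

end

theory Submission
  imports Defs "HOL-Homology.Homology" "HOL-Number_Theory.Cong"
begin

text \<open>Write \<open>r = p ^ k\<close>.  Both inequalities compare genera, and both come from one construction of
equivariant maps into joins of orbits; the second one also needs a Borsuk-Ulam theorem.

\<^bold>\<open>The construction.\<close>  A p-torus acting freely on \<open>r\<close> points acts simply transitively, so a vector
with \<open>r\<close> entries is a function \<open>t\<close> on \<open>F\<^sub>p ^ k\<close>.  Its sums over the parallel hyperplanes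
\<open>\<mu> = c\<close> can be independent of \<open>c\<close> for every nonzero linear form \<open>\<mu>\<close> only if \<open>t\<close> is constant
(\<open>hyperplane_sums_injective\<close>).  There are \<open>r - 1\<close> such forms, and each contributes one orbit
\<open>G / ker \<mu>\<close>; together they give an equivariant map from the nonconstant vectors to a join of
\<open>r - 1\<close> proper orbits (\<open>nonconstant_vectors_to_join\<close>).  Hence, if an equivariant map to a join of
\<open>n\<close> orbits is defined on a part of \<open>X\<close>, fades out towards the boundary of that part, and an
equivariant vector with \<open>r\<close> entries is nonconstant on the rest, then \<open>X\<close> has genus at most
\<open>n + r - 1\<close> (\<open>genus_le_join\<close>).

\<^bold>\<open>First inequality.\<close>  A point of the deleted join is a combination \<open>t\<^sub>1 x\<^sub>1 + \<dots> + t\<^sub>r x\<^sub>r\<close>.  Where all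
weights are positive, \<open>(x\<^sub>1, \<dots>, x\<^sub>r)\<close> lies in the deleted product; where some weight vanishes, the
vector of weights is nonconstant, as its sum is 1 (\<open>genus_deleted_join_le\<close>).

\<^bold>\<open>Second inequality.\<close>  Let \<open>L\<close> be the deleted join of the full simplex on \<open>m\<close> vertices, which is the
\<open>m\<close>-fold join of \<open>[r]\<close>.  For a point of \<open>L\<close> let \<open>s\<^sub>i\<close> be the least level above which the \<open>i\<close>-th part
of the point has its support in \<open>K\<close>.  Cutting off the \<open>i\<close>-th part at height \<open>s\<^sub>i\<close> maps the region where
something survives to the deleted join of \<open>K\<close>.  Since \<open>K\<close> is unavoidable, some \<open>s\<^sub>i\<close> is 0; where
nothing survives, not all of them are 0, so \<open>s\<close> is nonconstant there.  Hence the genus of \<open>L\<close> is at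
most the genus of the deleted join plus \<open>r - 1\<close>, while it is at least \<open>m\<close> by the Borsuk-Ulam theorem
(\<open>genus_deleted_join_ge\<close>).

\<^bold>\<open>The Borsuk-Ulam theorem\<close> (\<open>no_map_from_join_of_free_orbits\<close>).  Suppose an equivariant map sends the
\<open>m\<close>-fold join \<open>L\<close> to a join \<open>Y\<close> of \<open>n < m\<close> proper orbits.  The tensor product \<open>P\<close> of one periodic
resolution for each group element maps to the chains of \<open>L\<close> in all degrees up to \<open>m - 1\<close>, since every
cycle can be coned off with an apex in the next copy of \<open>[r]\<close> (\<open>resolution_in_joins\<close>).  Iterated
subdivision and a labelling of points by vertices of \<open>Y\<close> turn this into an equivariant chain map from
\<open>P\<close> to the chains of \<open>Y\<close>; it vanishes from degree \<open>n\<close> on and therefore extends by 0 to all degrees.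
Modulo \<open>p\<close>, such a bounded map can be deformed into the chains of the subcomplex fixed by a group
element, at the price of the tensor factor of that element (\<open>descend_to_fixed_part\<close>): the simplices
that move form free orbits, on which the periodic complex is exact.  This is the chain-level form of
the localization theorem, and it uses that the group is a product of groups of order \<open>p\<close>.  After all
group elements have been treated, only the empty simplex is left, and it cannot carry the
augmentation (\<open>no_bounded_resolution\<close>).\<close>

section \<open>Families of chains over a tensor product of periodic resolutions\<close>

definition signed :: "nat \<Rightarrow> 'c \<Rightarrow> 'c::ab_group_add" where
  "signed q c = (if even q then c else - c)"

text \<open>The differentials of the periodic resolution over the group ring of a cyclic group of order \<open>p\<close> with
generator \<open>t\<close>: \<open>t - 1\<close> leaves the odd degrees, and the norm leaves the positive even ones.  In degree
0 there is no differential; the norm chosen there is the coefficient that would continue the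
alternating pattern downwards, and the descent below uses it.\<close>
definition resolution_coeff :: "nat \<Rightarrow> ('c \<Rightarrow> 'c) \<Rightarrow> nat \<Rightarrow> 'c \<Rightarrow> 'c::ab_group_add" where
  "resolution_coeff p t q c = (if odd q then t c - c else (\<Sum>i<p. (t ^^ i) c))"

text \<open>A family \<open>F\<close> indexed by multidegrees \<open>\<alpha>\<close> is an equivariant graded map from the tensor product of the
periodic resolutions of the operators in the list to the complex with boundary \<open>d\<close>; \<open>F \<alpha>\<close> is the
image of the generator of multidegree \<open>\<alpha>\<close>.  The total boundary measures the failure of \<open>F\<close> to be a
chain map.  The sign \<open>(-1)^q\<close> is what makes it square to zero.\<close>
fun total_boundary :: "nat \<Rightarrow> ('c \<Rightarrow> 'c) \<Rightarrow> ('c \<Rightarrow> 'c) list \<Rightarrow> (nat list \<Rightarrow> 'c) \<Rightarrow> nat list \<Rightarrow> 'c::ab_group_add" where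
  "total_boundary p d [] F \<alpha> = d (F \<alpha>)"
| "total_boundary p d (t # ts) F [] = 0"
| "total_boundary p d (t # ts) F (q # \<alpha>) = signed q (total_boundary p d ts (\<lambda>\<beta>. F (q # \<beta>)) \<alpha>
       - (if q = 0 then 0 else resolution_coeff p t q (F ((q - 1) # \<alpha>))))"

lemma additive_diff: "Modules.additive f \<Longrightarrow> f (a - b) = f a - f b"
  by (rule Modules.additive.diff)

lemma additive_zero: "Modules.additive f \<Longrightarrow> f 0 = 0"
  by (rule Modules.additive.zero)

lemma additive_signed: "Modules.additive f \<Longrightarrow> f (signed q c) = signed q (f c)"
  by (simp add: signed_def Modules.additive.minus)

lemma signed_signed [simp]: "signed q (signed q c) = c"
  by (simp add: signed_def)

lemma signed_zero [simp]: "signed q 0 = 0"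
  by (simp add: signed_def)

lemma signed_diff: "signed q (a - b) = signed q a - signed q b"
  by (simp add: signed_def)

lemma signed_add_index: "signed (q + q') c = signed q (signed q' c)"
  by (simp add: signed_def)

lemma additive_funpow: "Modules.additive f \<Longrightarrow> Modules.additive (f ^^ i)"
  for f :: "'c \<Rightarrow> 'c::ab_group_add"
  by (induction i) (auto simp: Modules.additive_def)

lemma additive_resolution_coeff:
  assumes "Modules.additive t"
  shows "Modules.additive (resolution_coeff p t q)"
  using assms additive_funpow[OF assms]
  by (auto simp: Modules.additive_def resolution_coeff_def sum.distrib)

lemma resolution_coeff_commute:
  assumes "Modules.additive f" "\<And>c. P c \<Longrightarrow> P (t c)" "\<And>c. P c \<Longrightarrow> f (t c) = t' (f c)" "P c"
  shows "f (resolution_coeff p t q c) = resolution_coeff p t' q (f c)"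
proof -
  have *: "P ((t ^^ i) c) \<and> f ((t ^^ i) c) = (t' ^^ i) (f c)" for i
    by (induction i) (use assms in auto)
  show ?thesis
    using * assms(1,3,4) by (simp add: resolution_coeff_def additive_diff Modules.additive.sum)
qed

lemma resolution_coeff_twice:
  assumes "Modules.additive t" "\<And>c. (t ^^ p) c = c"
  shows "resolution_coeff p t (Suc q) (resolution_coeff p t q c) = 0"
proof -
  have tel: "(\<Sum>i<p. (t ^^ Suc i) c - (t ^^ i) c) = 0"
    using assms(2)[of c] by (subst sum_lessThan_telescope) simp
  have a: "t (\<Sum>i<p. (t ^^ i) c) = (\<Sum>i<p. (t ^^ Suc i) c)"
    by (simp add: Modules.additive.sum[OF assms(1)])
  have b: "(t ^^ i) (t c - c) = (t ^^ Suc i) c - (t ^^ i) c" for i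
    by (simp add: additive_diff[OF additive_funpow[OF assms(1)]] funpow_swap1)
  show ?thesis
    using tel a b by (simp add: resolution_coeff_def sum_subtractf)
qed

lemma total_boundary_diff:
  assumes "Modules.additive d" "\<forall>t\<in>set ts. Modules.additive t"
  shows "total_boundary p d ts (\<lambda>\<beta>. F \<beta> - G \<beta>) \<alpha> = total_boundary p d ts F \<alpha> - total_boundary p d ts G \<alpha>"
  using assms(2)
proof (induction ts arbitrary: F G \<alpha>)
  case Nil
  then show ?case by (simp add: additive_diff assms(1))
next
  case (Cons t ts)
  show ?case
  proof (cases \<alpha>)
    case (Cons q \<alpha>')
    have "Modules.additive (resolution_coeff p t q)"
      by (simp add: additive_resolution_coeff Cons.prems)
    then show ?thesis
      using Cons.IH[of "\<lambda>\<beta>. F (q # \<beta>)" "\<lambda>\<beta>. G (q # \<beta>)"] Cons.prems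
      by (simp add: Cons additive_diff signed_diff)
  qed simp
qed

text \<open>The value at \<open>\<alpha>\<close> only involves members of the family in the same total degree or one degree lower.\<close>
lemma total_boundary_vanish:
  assumes "Modules.additive d" "\<forall>t\<in>set ts. Modules.additive t"
    and "\<And>\<beta>. length \<beta> = length \<alpha> \<Longrightarrow> sum_list \<alpha> \<le> Suc (sum_list \<beta>) \<Longrightarrow> F \<beta> = 0"
  shows "total_boundary p d ts F \<alpha> = 0"
  using assms(2,3)
proof (induction ts arbitrary: F \<alpha>)
  case Nil
  then show ?case by (simp add: additive_zero assms(1))
next
  case (Cons t ts)
  show ?case
  proof (cases \<alpha>)
    case (Cons q \<alpha>')
    have "total_boundary p d ts (\<lambda>\<beta>. F (q # \<beta>)) \<alpha>' = 0"
      by (rule Cons.IH) (use Cons.prems Cons in auto)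
    moreover have "q \<noteq> 0 \<Longrightarrow> F ((q - 1) # \<alpha>') = 0"
      by (rule Cons.prems(2)) (use Cons in auto)
    moreover have "resolution_coeff p t q 0 = 0"
      by (simp add: additive_resolution_coeff additive_zero Cons.prems)
    ultimately show ?thesis by (simp add: Cons)
  qed simp
qed

lemma total_boundary_zero:
  assumes "Modules.additive d" "\<forall>t\<in>set ts. Modules.additive t"
  shows "total_boundary p d ts (\<lambda>_. 0) \<alpha> = 0"
  by (rule total_boundary_vanish[OF assms]) auto

lemma total_boundary_leading:
  assumes "Modules.additive d" "\<forall>t\<in>set ts. Modules.additive t" "length \<alpha> = length ts"
    and "\<And>\<beta>. length \<beta> = length \<alpha> \<Longrightarrow> sum_list \<beta> < sum_list \<alpha> \<Longrightarrow> F \<beta> = 0"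
  shows "total_boundary p d ts F \<alpha> = signed (sum_list \<alpha>) (d (F \<alpha>))"
  using assms(2-4)
proof (induction ts arbitrary: F \<alpha>)
  case Nil
  then show ?case by (simp add: signed_def)
next
  case (Cons t ts)
  then obtain q \<alpha>' where \<alpha>: "\<alpha> = q # \<alpha>'" by (cases \<alpha>) auto
  have "total_boundary p d ts (\<lambda>\<beta>. F (q # \<beta>)) \<alpha>' = signed (sum_list \<alpha>') (d (F \<alpha>))"
    unfolding \<alpha> by (rule Cons.IH) (use Cons.prems \<alpha> in auto)
  moreover have "q \<noteq> 0 \<Longrightarrow> F ((q - 1) # \<alpha>') = 0"
    by (rule Cons.prems(3)) (use \<alpha> in auto)
  moreover have "resolution_coeff p t q 0 = 0"
    by (simp add: additive_resolution_coeff additive_zero Cons.prems)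
  ultimately show ?case by (simp add: \<alpha> signed_add_index)
qed

text \<open>The predicate \<open>P\<close> singles out the chains on which \<open>f\<close> is known to be an equivariant chain map.\<close>
lemma total_boundary_chain_map:
  assumes "Modules.additive f" "\<And>\<beta>. P (F \<beta>)"
    and "\<And>c. P c \<Longrightarrow> f (d c) = d' (f c)"
    and "list_all2 (\<lambda>t t'. \<forall>c. P c \<longrightarrow> P (t c) \<and> f (t c) = t' (f c)) ts ts'"
  shows "total_boundary p d' ts' (\<lambda>\<beta>. f (F \<beta>)) \<alpha> = f (total_boundary p d ts F \<alpha>)"
  using assms(4,2)
proof (induction ts ts' arbitrary: F \<alpha> rule: list_all2_induct)
  case Nil
  then show ?case by (simp add: assms(3))
next
  case (Cons t ts t' ts')
  show ?case
  proof (cases \<alpha>)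
    case Nil
    then show ?thesis by (simp add: additive_zero assms(1))
  next
    case \<alpha>: (Cons q \<alpha>')
    have "f (resolution_coeff p t q (F ((q - 1) # \<alpha>')))
        = resolution_coeff p t' q (f (F ((q - 1) # \<alpha>')))"
      by (rule resolution_coeff_commute[where P = P]) (use assms(1) Cons in auto)
    then show ?thesis
      using Cons.IH[of "\<lambda>\<beta>. F (q # \<beta>)"] Cons.prems assms(1)
      by (simp add: \<alpha> additive_signed additive_diff additive_zero)
  qed
qed

definition commuting_ops ::
    "nat \<Rightarrow> ('c \<Rightarrow> 'c::ab_group_add) \<Rightarrow> ('c \<Rightarrow> 'c) list \<Rightarrow> bool" where
  "commuting_ops p d ts \<longleftrightarrow> Modules.additive d \<and> (\<forall>c. d (d c) = 0)
     \<and> (\<forall>t\<in>set ts. Modules.additive t \<and> (\<forall>c. (t ^^ p) c = c) \<and> (\<forall>c. d (t c) = t (d c))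
          \<and> (\<forall>s\<in>set ts. \<forall>c. s (t c) = t (s c)))"

lemma total_boundary_total_boundary:
  assumes "commuting_ops p d ts"
  shows "total_boundary p d ts (total_boundary p d ts F) \<alpha> = 0"
  using assms
proof (induction ts arbitrary: F \<alpha>)
  case Nil
  have "total_boundary p d [] F = (\<lambda>\<beta>. d (F \<beta>))" by (simp add: fun_eq_iff)
  then show ?case using Nil by (simp add: commuting_ops_def)
next
  case (Cons t ts)
  have ok: "commuting_ops p d ts" and add: "Modules.additive d" "\<forall>s\<in>set ts. Modules.additive s"
    and t: "Modules.additive t" "\<And>c. (t ^^ p) c = c" "\<And>c. d (t c) = t (d c)"
      "\<And>s c. s \<in> set ts \<Longrightarrow> s (t c) = t (s c)"
    using Cons.prems by (auto simp: commuting_ops_def)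
  show ?case
  proof (cases \<alpha>)
    case \<alpha>: (Cons q \<alpha>')
    let ?\<theta> = "resolution_coeff p t"
    have \<theta>: "total_boundary p d ts (\<lambda>\<beta>. ?\<theta> q (G \<beta>)) \<beta>' = ?\<theta> q (total_boundary p d ts G \<beta>')" for G q \<beta>'
    proof (rule total_boundary_chain_map[where P = "\<lambda>_. True"])
      show "Modules.additive (?\<theta> q)" by (rule additive_resolution_coeff[OF t(1)])
      have "s (?\<theta> q c) = ?\<theta> q (s c)" if "s \<in> set ts" for s c
        using resolution_coeff_commute[of s "\<lambda>_. True" t t c p q] that add t by auto
      then show "list_all2 (\<lambda>s s'. \<forall>c. True \<longrightarrow> True \<and> ?\<theta> q (s c) = s' (?\<theta> q c)) ts ts"
        by (auto intro!: list.rel_refl_strong)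
      show "?\<theta> q (d c) = d (?\<theta> q c)" for c
        using resolution_coeff_commute[of d "\<lambda>_. True" t t c p q] add t by auto
    qed auto
    have sgn: "total_boundary p d ts (\<lambda>\<beta>. signed q (G \<beta>)) \<beta>' = signed q (total_boundary p d ts G \<beta>')" for G q \<beta>'
      using total_boundary_diff[OF add, of p "\<lambda>_. 0" G \<beta>'] total_boundary_zero[OF add, of p \<beta>']
      by (simp add: signed_def)
    show ?thesis
    proof (cases q)
      case 0
      then show ?thesis using Cons.IH[OF ok] by (simp add: \<alpha> signed_def)
    next
      case (Suc q')
      have "total_boundary p d ts (\<lambda>\<beta>. total_boundary p d (t # ts) F (q # \<beta>)) \<alpha>'
          = signed q (total_boundary p d ts (\<lambda>\<beta>. total_boundary p d ts (\<lambda>\<beta>'. F (q # \<beta>')) \<beta> - ?\<theta> q (F (q' # \<beta>))) \<alpha>')"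
        using Suc by (simp add: sgn)
      also have "\<dots> = signed q (- ?\<theta> q (total_boundary p d ts (\<lambda>\<beta>. F (q' # \<beta>)) \<alpha>'))"
        using Cons.IH[OF ok, of "\<lambda>\<beta>'. F (q # \<beta>')" \<alpha>'] by (simp add: total_boundary_diff[OF add] \<theta>)
      finally have A: "total_boundary p d ts (\<lambda>\<beta>. total_boundary p d (t # ts) F (q # \<beta>)) \<alpha>'
          = signed q' (?\<theta> q (total_boundary p d ts (\<lambda>\<beta>. F (q' # \<beta>)) \<alpha>'))"
        by (simp add: Suc signed_def)
      have add\<theta>: "Modules.additive (?\<theta> q)" by (rule additive_resolution_coeff[OF t(1)])
      have "?\<theta> q (total_boundary p d (t # ts) F (q' # \<alpha>'))
          = signed q' (?\<theta> q (total_boundary p d ts (\<lambda>\<beta>. F (q' # \<beta>)) \<alpha>')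
              - (if q' = 0 then 0 else ?\<theta> q (?\<theta> q' (F ((q' - 1) # \<alpha>')))))"
        by (simp add: additive_signed[OF add\<theta>] additive_diff[OF add\<theta>] additive_zero[OF add\<theta>])
      also have "\<dots> = signed q' (?\<theta> q (total_boundary p d ts (\<lambda>\<beta>. F (q' # \<beta>)) \<alpha>'))"
        using resolution_coeff_twice[OF t(1,2), of q'] by (simp add: Suc)
      finally show ?thesis using A by (simp add: \<alpha> Suc)
    qed
  qed simp
qed

text \<open>The augmentation of the tensor product of resolutions, followed by the map that sends 1 to \<open>e\<close>.  For
augmented chains \<open>e\<close> is the empty simplex, and the equation \<open>total_boundary F = origin_family e\<close> says
that \<open>F\<close> is a chain map that preserves augmentations.\<close>
definition origin_family :: "'c \<Rightarrow> nat list \<Rightarrow> 'c::zero" where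
  "origin_family e \<alpha> = (if set \<alpha> \<subseteq> {0} then e else 0)"

lemma total_boundary_origin_family:
  assumes "Modules.additive d" "d e = 0" "\<And>t. t \<in> set ts \<Longrightarrow> Modules.additive t \<and> t e = e"
  shows "total_boundary p d ts (origin_family e) \<alpha> = 0"
  using assms(3)
proof (induction ts arbitrary: \<alpha>)
  case Nil
  then show ?case using assms by (simp add: origin_family_def additive_zero)
next
  case (Cons t ts)
  have add: "Modules.additive d" "\<forall>s\<in>set ts. Modules.additive s" using Cons.prems assms by auto
  show ?case
  proof (cases \<alpha>)
    case \<alpha>: (Cons q \<alpha>')
    have t: "Modules.additive t" "t e = e" using Cons.prems by auto
    consider "q = 0" | "q = 1" | q' where "q = Suc (Suc q')"
      by (metis One_nat_def not0_implies_Suc)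
    then show ?thesis
    proof cases
      case 1
      moreover have "(\<lambda>\<beta>. origin_family e (0 # \<beta>)) = origin_family e"
        by (auto simp: origin_family_def fun_eq_iff)
      ultimately show ?thesis using Cons by (simp add: \<alpha>)
    next
      case 2
      have "(\<lambda>\<beta>. origin_family e (q # \<beta>)) = (\<lambda>_. 0)"
        using 2 by (auto simp: origin_family_def)
      then show ?thesis using 2 t total_boundary_zero[OF add]
        by (simp add: \<alpha> resolution_coeff_def origin_family_def additive_zero)
    next
      case 3
      have "(\<lambda>\<beta>. origin_family e (q # \<beta>)) = (\<lambda>_. 0)"
        using 3 by (auto simp: origin_family_def)
      moreover have "origin_family e ((q - 1) # \<alpha>') = 0"
        using 3 by (auto simp: origin_family_def)
      moreover have "resolution_coeff p t q 0 = 0"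
        by (simp add: additive_resolution_coeff additive_zero t)
      ultimately show ?thesis using total_boundary_zero[OF add] by (simp add: \<alpha>)
    qed
  qed simp
qed

section \<open>Descent to the simplices fixed by one generator\<close>

definition induced :: "('x \<Rightarrow> 'y) \<Rightarrow> ('x \<Rightarrow>\<^sub>0 int) \<Rightarrow> ('y \<Rightarrow>\<^sub>0 int)" where
  "induced b = frag_extend (frag_of \<circ> b)"

definition divisible :: "nat \<Rightarrow> ('x \<Rightarrow>\<^sub>0 int) \<Rightarrow> bool" where
  "divisible p c \<longleftrightarrow> (\<exists>c'. c = frag_cmul (int p) c')"

definition moving_part :: "('x \<Rightarrow> 'x) \<Rightarrow> ('x \<Rightarrow>\<^sub>0 int) \<Rightarrow> ('x \<Rightarrow>\<^sub>0 int)" where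
  "moving_part b = frag_extend (\<lambda>x. if b x = x then 0 else frag_of x)"

definition chain_on :: "'x set \<Rightarrow> ('x \<Rightarrow>\<^sub>0 int) \<Rightarrow> bool" where
  "chain_on Y c \<longleftrightarrow> Poly_Mapping.keys c \<subseteq> Y"

lemma chain_on_zero [simp]: "chain_on Y 0"
  by (simp add: chain_on_def)

lemma chain_on_of [simp]: "chain_on Y (frag_of x) \<longleftrightarrow> x \<in> Y"
  by (simp add: chain_on_def)

lemma chain_on_diff: "chain_on Y a \<Longrightarrow> chain_on Y c \<Longrightarrow> chain_on Y (a - c)"
  using keys_diff[of a c] by (auto simp: chain_on_def)

lemma chain_on_minus [simp]: "chain_on Y (- c) \<longleftrightarrow> chain_on Y c"
  by (simp add: chain_on_def)

lemma chain_on_sum: "(\<And>i. i \<in> I \<Longrightarrow> chain_on Y (f i)) \<Longrightarrow> chain_on Y (sum f I)"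
  unfolding chain_on_def by (rule order_trans[OF keys_sum]) blast

lemma chain_on_frag_extend:
  "chain_on Y c \<Longrightarrow> (\<And>x. x \<in> Y \<Longrightarrow> chain_on Z (f x)) \<Longrightarrow> chain_on Z (frag_extend f c)"
  unfolding chain_on_def by (rule order_trans[OF keys_frag_extend]) blast

lemma additive_frag_extend [simp]: "Modules.additive (frag_extend f)"
  by (simp add: Modules.additive_def frag_extend_add)

lemma additive_induced [simp]: "Modules.additive (induced b)"
  by (simp add: induced_def)

lemma additive_moving_part [simp]: "Modules.additive (moving_part b)"
  by (simp add: moving_part_def)

lemma additive_eqI:
  assumes "Modules.additive f" "Modules.additive g"
    and "\<And>x. x \<in> Poly_Mapping.keys c \<Longrightarrow> f (frag_of x) = g (frag_of x)"
  shows "f c = g c"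
  by (rule frag_induction[of c "Poly_Mapping.keys c"])
     (use assms in \<open>auto simp: additive_zero additive_diff\<close>)

lemma additive_frag_cmul:
  assumes "Modules.additive f"
  shows "f (frag_cmul k c) = frag_cmul k (f c)"
proof -
  have nat: "f (frag_cmul (int n) c) = frag_cmul (int n) (f c)" for n
    by (induction n) (use assms in \<open>auto simp: additive_zero additive.add frag_cmul_distrib\<close>)
  obtain m n where "k = int m - int n" by (metis int_diff_cases)
  then show ?thesis using nat assms
    by (simp add: frag_cmul_diff_distrib additive_diff)
qed

lemma divisible_zero [simp]: "divisible p 0"
  unfolding divisible_def by (metis frag_cmul_zero2)

lemma divisible_add: "divisible p a \<Longrightarrow> divisible p b \<Longrightarrow> divisible p (a + b)"
  unfolding divisible_def by (metis frag_cmul_distrib2)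

lemma divisible_minus: "divisible p a \<Longrightarrow> divisible p (- a)"
  unfolding divisible_def by (metis frag_cmul_cmul frag_cmul_minus_one mult.commute)

lemma divisible_diff: "divisible p a \<Longrightarrow> divisible p b \<Longrightarrow> divisible p (a - b)"
  using divisible_add[of p a "- b"] divisible_minus[of p b] by simp

lemma divisible_additive: "Modules.additive f \<Longrightarrow> divisible p c \<Longrightarrow> divisible p (f c)"
  unfolding divisible_def by (metis additive_frag_cmul)

lemma divisible_signed: "divisible p (signed q c) \<longleftrightarrow> divisible p c"
  unfolding signed_def using divisible_minus[of p c] divisible_minus[of p "- c"] by auto

lemma funpow_funpow: "(b ^^ m) ((b ^^ n) x) = (b ^^ (m + n)) x"
  by (simp add: funpow_add)

lemma induced_of [simp]: "induced b (frag_of x) = frag_of (b x)"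
  by (simp add: induced_def)

lemma funpow_induced: "(induced b ^^ i) c = induced (b ^^ i) c"
  for b :: "'x \<Rightarrow> 'x"
proof (induction i)
  case 0
  have "induced (b ^^ 0) c = frag_extend frag_of c" by (simp add: induced_def comp_def)
  then show ?case using frag_expansion[of c] by (simp flip: id_def)
next
  case (Suc i)
  then show ?case
    using frag_extend_compose[of "frag_of \<circ> b" "b ^^ i" c] by (simp add: induced_def comp_def)
qed

lemma moving_part_fixed: "(\<And>x. x \<in> Poly_Mapping.keys c \<Longrightarrow> b x = x) \<Longrightarrow> moving_part b c = 0"
  unfolding moving_part_def by (rule frag_extend_eq_0) auto

lemma keys_fixed_part: "Poly_Mapping.keys (c - moving_part b c) \<subseteq> {x\<in>Poly_Mapping.keys c. b x = x}"
proof -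
  have "c - moving_part b c = frag_extend (\<lambda>x. if b x = x then frag_of x else 0) c"
    by (rule additive_eqI) (auto simp: Modules.additive_def moving_part_def frag_extend_add)
  then show ?thesis
    by (auto dest: subsetD[OF keys_frag_extend] split: if_split_asm)
qed

lemma moving_part_idem [simp]: "moving_part b (moving_part b c) = moving_part b c"
  by (rule additive_eqI) (auto simp: moving_part_def Modules.additive_def frag_extend_add)

context
  fixes p :: nat and b :: "'x \<Rightarrow> 'x"
  assumes prime: "prime p" and period: "\<And>x. (b ^^ p) x = x"
begin

lemma funpow_period_mod: "(b ^^ i) x = (b ^^ (i mod p)) x"
  using period by (simp add: funpow_mod_eq)

lemma funpow_inj_on_moving:
  assumes "b x \<noteq> x" "i < p" "j < p" "(b ^^ i) x = (b ^^ j) x"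
  shows "i = j"
proof (rule ccontr)
  have aux: False if "i < j" "j < p" "(b ^^ i) x = (b ^^ j) x" for i j
  proof -
    define d where "d = j - i"
    define y where "y = (b ^^ i) x"
    have d: "0 < d" "d < p" "(b ^^ d) y = y"
      using that funpow_funpow[of d b i x] by (auto simp: d_def y_def)
    have "coprime d p"
      by (metis d(1,2) coprime_commute nat_dvd_not_less prime prime_imp_coprime)
    then obtain m where m: "[d * m = 1] (mod p)"
      using cong_solve_coprime_nat[of d p] by auto
    have "(b ^^ (d * m)) y = y"
      using d(3) by (induction m) (auto simp: funpow_add)
    moreover have "(b ^^ (d * m)) y = b y"
      using m funpow_period_mod[of "d * m" y] prime_gt_1_nat[OF prime] by (simp add: cong_def)
    ultimately have bfix: "b y = y" by simp
    have "(b ^^ (p - i)) y = x"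
      using that period[of x] funpow_funpow[of "p - i" b i x] by (simp add: y_def)
    moreover have "(b ^^ n) y = y" for n by (induction n) (auto simp: bfix)
    ultimately have "b x = x" using bfix by simp
    then show False using assms(1) by simp
  qed
  assume "i \<noteq> j"
  then show False using aux[of i j] aux[of j i] assms by (cases "i < j") auto
qed

text \<open>Every simplex that \<open>b\<close> moves lies in an orbit of exactly \<open>p\<close> simplices; a representative and the
distance to it identify the chains on that orbit with the group ring.\<close>
definition orbit_rep :: "'x \<Rightarrow> 'x" where
  "orbit_rep x = (SOME y. \<exists>i. y = (b ^^ i) x)"

definition orbit_index :: "'x \<Rightarrow> nat" where
  "orbit_index x = (LEAST i. (b ^^ i) (orbit_rep x) = x)"

lemma orbit_rep_funpow: "orbit_rep ((b ^^ k) x) = orbit_rep x"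
proof -
  have "(\<exists>i. y = (b ^^ i) ((b ^^ k) x)) = (\<exists>i. y = (b ^^ i) x)" for y
  proof
    assume "\<exists>i. y = (b ^^ i) x"
    then obtain i where y: "y = (b ^^ i) x" by blast
    have kp: "(p - 1) * k + k = p * k"
      using prime_gt_0_nat[OF prime] by (cases p) auto
    have "(b ^^ (i + (p - 1) * k)) ((b ^^ k) x) = (b ^^ (i + p * k)) x"
      by (simp only: kp add.assoc funpow_funpow)
    also have "\<dots> = y"
      using y funpow_period_mod[of "i + p * k" x] funpow_period_mod[of i x] by simp
    finally show "\<exists>i. y = (b ^^ i) ((b ^^ k) x)" by metis
  qed (metis comp_apply funpow_add)
  then show ?thesis by (simp add: orbit_rep_def)
qed

lemma orbit_rep_in: "\<exists>i. orbit_rep x = (b ^^ i) x"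
  unfolding orbit_rep_def by (rule someI_ex) (metis funpow_0)

lemma funpow_orbit_index: "(b ^^ orbit_index x) (orbit_rep x) = x"
  and orbit_index_less: "orbit_index x < p"
proof -
  obtain i where i: "orbit_rep x = (b ^^ i) x" using orbit_rep_in by blast
  have "(b ^^ (p - i mod p)) (orbit_rep x) = (b ^^ (p - i mod p)) ((b ^^ (i mod p)) x)"
    using i funpow_period_mod by metis
  also have "\<dots> = x"
    using prime_gt_0_nat[OF prime] period by (simp add: funpow_funpow)
  finally have ex: "(b ^^ ((p - i mod p) mod p)) (orbit_rep x) = x"
    using funpow_period_mod by metis
  show "(b ^^ orbit_index x) (orbit_rep x) = x"
    unfolding orbit_index_def using ex by (rule LeastI)
  have "orbit_index x \<le> (p - i mod p) mod p"
    unfolding orbit_index_def using ex by (rule Least_le)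
  then show "orbit_index x < p"
    using prime_gt_0_nat[OF prime] by (meson le_less_trans mod_less_divisor)
qed

lemma moving_orbit_rep:
  assumes "b x \<noteq> x"
  shows "b (orbit_rep x) \<noteq> orbit_rep x"
proof
  assume "b (orbit_rep x) = orbit_rep x"
  then have "(b ^^ n) (orbit_rep x) = orbit_rep x" for n by (induction n) auto
  then have "x = orbit_rep x" using funpow_orbit_index by metis
  then show False using assms \<open>b (orbit_rep x) = orbit_rep x\<close> by metis
qed

lemma orbit_index_funpow:
  assumes "b x \<noteq> x" "i < p"
  shows "orbit_index ((b ^^ i) (orbit_rep x)) = i"
proof (rule funpow_inj_on_moving)
  show "b (orbit_rep x) \<noteq> orbit_rep x" using moving_orbit_rep assms by simp
  have "orbit_rep ((b ^^ i) (orbit_rep x)) = orbit_rep x"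
    using orbit_rep_funpow orbit_rep_in by metis
  then show "(b ^^ orbit_index ((b ^^ i) (orbit_rep x))) (orbit_rep x) = (b ^^ i) (orbit_rep x)"
    using funpow_orbit_index by metis
qed (use orbit_index_less assms in auto)

lemma moving_funpow:
  assumes "b x \<noteq> x"
  shows "b ((b ^^ i) x) \<noteq> (b ^^ i) x"
proof
  assume *: "b ((b ^^ i) x) = (b ^^ i) x"
  have "(b ^^ n) ((b ^^ i) x) = (b ^^ i) x" for n by (induction n) (auto simp: *)
  moreover have "(b ^^ (p * i - i)) ((b ^^ i) x) = x"
    using funpow_period_mod[of "p * i" x] prime_gt_0_nat[OF prime]
    by (simp add: funpow_funpow)
  ultimately show False using * assms by metis
qed

lemma norm_orbit_rep:
  "resolution_coeff p (induced b) 0 (frag_of x) = (\<Sum>i<p. frag_of ((b ^^ i) (orbit_rep x)))"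
proof -
  let ?N = "\<lambda>y. \<Sum>i<p. frag_of ((b ^^ i) y)"
  have step: "?N (b y) = ?N y" for y
  proof -
    have "?N (b y) - ?N y = (\<Sum>i<p. frag_of ((b ^^ Suc i) y) - frag_of ((b ^^ i) y))"
      by (simp add: sum_subtractf funpow_swap1)
    also have "\<dots> = 0" by (subst sum_lessThan_telescope) (simp add: period)
    finally show ?thesis by simp
  qed
  have "?N ((b ^^ i) y) = ?N y" for i y
    by (induction i) (auto simp: step)
  then have "?N x = ?N (orbit_rep x)" using orbit_rep_in by metis
  then show ?thesis by (simp add: resolution_coeff_def funpow_induced)
qed

text \<open>Moving simplices span a free module over the group ring of the cyclic group generated by \<open>b\<close>, and over
a free module the periodic complex is exact.  The operators \<open>S\<close> and \<open>R\<close> are a contracting homotopy, so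
that the moving part of a chain \<open>c\<close> killed by the next coefficient is the present one applied to \<open>S c\<close>.\<close>
lemma free_orbit_exactness:
  obtains S R :: "('x \<Rightarrow>\<^sub>0 int) \<Rightarrow> ('x \<Rightarrow>\<^sub>0 int)"
  where "Modules.additive S" "Modules.additive R"
    and "\<And>c. moving_part b c = resolution_coeff p (induced b) q (S c)
                + R (resolution_coeff p (induced b) (Suc q) c)"
    and "\<And>Y c. (\<And>x. x \<in> Y \<Longrightarrow> b x \<in> Y) \<Longrightarrow> chain_on Y c \<Longrightarrow> chain_on Y (S c)"
proof -
  let ?\<theta> = "resolution_coeff p (induced b)"
  define Z where "Z = frag_extend (\<lambda>x. if b x = x then 0 else
    (\<Sum>j\<in>{..<orbit_index x}. frag_of ((b ^^ j) (orbit_rep x))))"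
  define K where "K = frag_extend (\<lambda>x. if b x \<noteq> x \<and> orbit_index x = 0 then frag_of x else 0)"
  \<comment> \<open>Writing a simplex as \<open>b ^^ i\<close> of its representative \<open>y\<close>, the operator \<open>Z\<close> sums the orbit from \<open>y\<close>
    up to it, \<open>K\<close> restricts to representatives, and \<open>Z'\<close> is minus the sum from the simplex to the end
    of the orbit, except that it is 0 at \<open>y\<close>.\<close>
  define Z' where "Z' = frag_extend (\<lambda>x. if b x = x \<or> orbit_index x = 0 then 0 else
    - (\<Sum>j\<in>{orbit_index x..<p}. frag_of ((b ^^ j) (orbit_rep x))))"
  have add [simp]: "Modules.additive Z" "Modules.additive K" "Modules.additive Z'"
    "Modules.additive (?\<theta> q)" for q
    by (simp_all add: Z_def K_def Z'_def additive_resolution_coeff)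
  have u: "?\<theta> (Suc 0) c = induced b c - c" for c by (simp add: resolution_coeff_def)
  have par: "?\<theta> q = (if odd q then ?\<theta> 1 else ?\<theta> 0)" for q
    by (auto simp: resolution_coeff_def fun_eq_iff)
  have p0: "0 < p" using prime prime_gt_0_nat by blast
  have rep: "(b ^^ i) (orbit_rep x) = orbit_rep x \<longleftrightarrow> i = 0" if "b x \<noteq> x" "i < p" for i x
    using orbit_index_funpow[OF that] orbit_index_funpow[OF that(1) p0] by (metis funpow_0)
  have rep_of: "x = (b ^^ orbit_index x) (orbit_rep x)" for x by (simp add: funpow_orbit_index)
  have mov: "b ((b ^^ i) (orbit_rep x)) \<noteq> (b ^^ i) (orbit_rep x)" if "b x \<noteq> x" for i x
    using moving_funpow moving_orbit_rep that by blast
  have E1: "moving_part b c = ?\<theta> 1 (Z c) + K (?\<theta> 0 c)" for c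
  proof (rule additive_eqI[of "moving_part b" "\<lambda>c. ?\<theta> 1 (Z c) + K (?\<theta> 0 c)"])
    show "Modules.additive (\<lambda>c. ?\<theta> 1 (Z c) + K (?\<theta> 0 c))"
      using add by (simp add: Modules.additive_def)
    fix x assume "x \<in> Poly_Mapping.keys c"
    show "moving_part b (frag_of x) = ?\<theta> 1 (Z (frag_of x)) + K (?\<theta> 0 (frag_of x))"
    proof (cases "b x = x")
      case True
      then have "(b ^^ i) x = x" for i by (induction i) auto
      then have "K (?\<theta> 0 (frag_of x)) = 0"
        by (simp add: resolution_coeff_def funpow_induced additive.sum[OF add(2)])
           (simp add: K_def True)
      then show ?thesis using True by (simp add: moving_part_def Z_def additive_zero)
    next
      case False
      have "?\<theta> 1 (Z (frag_of x))
          = (\<Sum>j\<in>{..<orbit_index x}. frag_of ((b ^^ Suc j) (orbit_rep x)) - frag_of ((b ^^ j) (orbit_rep x)))"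
        using False by (simp add: u Z_def additive.sum[OF additive_induced] sum_subtractf)
      also have "\<dots> = frag_of x - frag_of (orbit_rep x)"
        by (subst sum_lessThan_telescope) (simp add: funpow_orbit_index)
      finally have 1: "?\<theta> 1 (Z (frag_of x)) = frag_of x - frag_of (orbit_rep x)" .
      have "K (?\<theta> 0 (frag_of x)) = (\<Sum>i<p. K (frag_of ((b ^^ i) (orbit_rep x))))"
        by (simp add: norm_orbit_rep additive.sum[OF add(2)])
      also have "\<dots> = (\<Sum>i<p. if i = 0 then frag_of (orbit_rep x) else 0)"
        by (rule sum.cong) (use False mov orbit_index_funpow in \<open>auto simp: K_def\<close>)
      also have "\<dots> = frag_of (orbit_rep x)" using p0 by simp
      finally show ?thesis using 1 False by (simp add: moving_part_def)
    qed
  qed simp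
  have E0: "moving_part b c = ?\<theta> 0 (K c) + Z' (?\<theta> 1 c)" for c
  proof (rule additive_eqI[of "moving_part b" "\<lambda>c. ?\<theta> 0 (K c) + Z' (?\<theta> 1 c)"])
    show "Modules.additive (\<lambda>c. ?\<theta> 0 (K c) + Z' (?\<theta> 1 c))"
      using add by (simp add: Modules.additive_def)
    fix x assume "x \<in> Poly_Mapping.keys c"
    show "moving_part b (frag_of x) = ?\<theta> 0 (K (frag_of x)) + Z' (?\<theta> 1 (frag_of x))"
    proof (cases "b x = x")
      case True
      then show ?thesis by (simp add: moving_part_def K_def u additive_zero)
    next
      case False
      define i where "i = orbit_index x"
      define y where "y = orbit_rep x"
      have x: "x = (b ^^ i) y" unfolding i_def y_def by (rule rep_of)
      have bx: "b x = (b ^^ Suc i) y" by (simp add: x)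
      have i: "i < p" by (simp add: i_def orbit_index_less)
      have Z'i: "Z' (frag_of ((b ^^ j) y))
          = (if j = 0 then 0 else - (\<Sum>j\<in>{j..<p}. frag_of ((b ^^ j) y)))" if "j < p" for j
      proof -
        have "orbit_rep ((b ^^ j) y) = y"
          unfolding y_def using orbit_rep_funpow orbit_rep_in by metis
        then show ?thesis
          using orbit_index_funpow[OF False that] mov[OF False] by (simp add: Z'_def y_def)
      qed
      have Nx: "?\<theta> 0 (frag_of x) = (\<Sum>i<p. frag_of ((b ^^ i) y))"
        unfolding y_def by (rule norm_orbit_rep)
      have K: "K (frag_of x) = (if i = 0 then frag_of x else 0)"
        using False by (simp add: K_def i_def)
      have Z'u: "Z' (?\<theta> 1 (frag_of x)) = Z' (frag_of ((b ^^ Suc i) y)) - Z' (frag_of ((b ^^ i) y))"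
        using bx x by (simp add: u additive_diff[OF add(3)])
      have split: "(\<Sum>j\<in>{i..<p}. frag_of ((b ^^ j) y)) = frag_of x + (\<Sum>j\<in>{Suc i..<p}. frag_of ((b ^^ j) y))"
        using i x by (simp add: sum.atLeast_Suc_lessThan)
      show ?thesis
      proof (cases "Suc i < p")
        case True
        then show ?thesis
          using Z'i[OF True] Z'i[OF i] Z'u K Nx False split
          by (cases "i = 0") (auto simp: moving_part_def additive_zero lessThan_atLeast0)
      next
        case False': False
        then have "i = p - 1" using i by simp
        then have "i \<noteq> 0" using prime_gt_1_nat[OF prime] by simp
        have "(b ^^ Suc i) y = (b ^^ 0) y"
          using False' i period by (metis Suc_lessI funpow_0)
        then have "Z' (frag_of ((b ^^ Suc i) y)) = 0" using Z'i[OF p0] by simp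
        then show ?thesis
          using Z'i[OF i] Z'u K Nx False split \<open>i \<noteq> 0\<close> False'
          by (auto simp: moving_part_def additive_zero)
      qed
    qed
  qed simp
  have keysK: "chain_on Y (K c)" if "chain_on Y c" for Y c
    unfolding K_def by (rule chain_on_frag_extend[OF that]) simp
  have keysZ: "chain_on Y (Z c)"
    if Y: "\<And>x. x \<in> Y \<Longrightarrow> b x \<in> Y" and c: "chain_on Y c" for Y c
  proof -
    have pow: "(b ^^ i) x \<in> Y" if "x \<in> Y" for i x by (induction i) (use that Y in auto)
    have "(b ^^ i) (orbit_rep x) \<in> Y" if "x \<in> Y" for i x
      using pow[OF that] pow orbit_rep_in by metis
    then show ?thesis
      unfolding Z_def by (intro chain_on_frag_extend[OF c]) (auto intro!: chain_on_sum)
  qed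
  show thesis
  proof (cases "odd q")
    case True
    show ?thesis
      by (rule that[of Z K]) (use True E1 keysZ par[of q] par[of "Suc q"] in auto)
  next
    case False
    show ?thesis
      by (rule that[of K Z']) (use False E0 keysK par[of q] par[of "Suc q"] in auto)
  qed
qed

end

text \<open>Bookkeeping principle: supports, divisibility and the like pass from a family to its total boundary.\<close>
lemma total_boundary_closed:
  assumes "P 0" "\<And>a b. P a \<Longrightarrow> P b \<Longrightarrow> P (a - b)" "\<And>t c. t \<in> set ts \<Longrightarrow> P c \<Longrightarrow> P (t c)"
    and "P (d (F \<alpha>))" "\<And>\<beta>. length \<beta> = length \<alpha> \<Longrightarrow> Suc (sum_list \<beta>) = sum_list \<alpha> \<Longrightarrow> P (F \<beta>)"
  shows "P (total_boundary p d ts F \<alpha>)"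
  using assms(3-5)
proof (induction ts arbitrary: F \<alpha>)
  case Nil
  then show ?case by simp
next
  case (Cons t ts)
  have neg: "P (- a)" if "P a" for a using assms(2)[OF assms(1) that] by simp
  have add: "P (a + b)" if "P a" "P b" for a b using assms(2)[OF that(1) neg[OF that(2)]] by simp
  have sum: "P (\<Sum>i<n. f i)" if "\<And>i. P (f i)" for f and n :: nat
    by (induction n) (auto simp: assms(1) add that)
  have t: "P (t c)" if "P c" for c by (rule Cons.prems(1)) (use that in auto)
  have pow: "P ((t ^^ i) c)" if "P c" for i c
    by (induction i) (auto simp: that t)
  have \<theta>: "P (resolution_coeff p t q c)" if "P c" for q c
    using assms(2)[OF t[OF that] that] sum[of "\<lambda>i. (t ^^ i) c"] pow[OF that]
    by (simp add: resolution_coeff_def)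
  show ?case
  proof (cases \<alpha>)
    case \<alpha>: (Cons q \<alpha>')
    have "P (total_boundary p d ts (\<lambda>\<beta>. F (q # \<beta>)) \<alpha>')"
      by (rule Cons.IH) (use Cons.prems \<alpha> in auto)
    then show ?thesis
      using \<theta>[of "F ((q - 1) # \<alpha>')" q] Cons.prems(3)[of "(q - 1) # \<alpha>'"]
        assms(2)[of "total_boundary p d ts (\<lambda>\<beta>. F (q # \<beta>)) \<alpha>'" "resolution_coeff p t q (F ((q - 1) # \<alpha>'))"]
      by (auto simp: \<alpha> signed_def neg simp del: minus_diff_eq)
  qed (simp add: assms(1))
qed

text \<open>On a fixed simplex the norm is multiplication by \<open>p\<close>.\<close>
lemma resolution_coeff_fixed:
  assumes "\<And>x. x \<in> Poly_Mapping.keys c \<Longrightarrow> b x = x" "even q"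
  shows "divisible p (resolution_coeff p (induced b) q c)"
proof -
  have "induced b c = c"
    by (rule additive_eqI[of "induced b" "\<lambda>c. c"])
       (use assms in \<open>auto simp: Modules.additive_def additive.add[OF additive_induced]\<close>)
  then have "(induced b ^^ i) c = c" for i by (induction i) auto
  moreover have "(\<Sum>i<p. c) = frag_cmul (int p) c"
    by (induction p) (auto simp: frag_cmul_distrib)
  ultimately show ?thesis using assms(2) by (auto simp: resolution_coeff_def divisible_def)
qed

text \<open>The localization step.  Read \<open>F\<close> as a sequence of families \<open>y q\<close>, graded by the degree \<open>q\<close> in the
resolution of \<open>b\<close>, with \<open>D (y (q + 1)) = \<theta> (y q)\<close> modulo \<open>p\<close>.  Since \<open>y n = 0\<close>, exactness on the
moving part yields, for \<open>q = n, n - 1, \<dots>, 0\<close>, families \<open>z\<close> and \<open>z'\<close> such that the moving part of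
\<open>y q - D z'\<close> is \<open>\<theta> z\<close> modulo \<open>p\<close>; the next pair has \<open>z\<close> in the place of \<open>z'\<close>.
At \<open>q = 0\<close> the fixed part \<open>v\<close> of \<open>y 0 - D z'\<close> differs from it by a norm modulo \<open>p\<close>, and norms have
fixed parts divisible by \<open>p\<close>; so \<open>v\<close> still lifts the augmentation, but lives on the fixed simplices.\<close>
lemma descend_to_fixed_part:
  fixes b :: "'x \<Rightarrow> 'x"
  assumes prime: "prime p" and period: "\<And>x. (b ^^ p) x = x"
    and ops: "commuting_ops p d (induced b # ts)"
    and Y: "\<And>x. x \<in> Y \<Longrightarrow> b x \<in> Y"
    and dY: "\<And>c. chain_on Y c \<Longrightarrow> chain_on Y (d c)"
    and tY: "\<And>t c. t \<in> set ts \<Longrightarrow> chain_on Y c \<Longrightarrow> chain_on Y (t c)"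
    and dYb: "\<And>c. chain_on {x\<in>Y. b x = x} c \<Longrightarrow> chain_on {x\<in>Y. b x = x} (d c)"
    and tYb: "\<And>t c. t \<in> set ts \<Longrightarrow> chain_on {x\<in>Y. b x = x} c \<Longrightarrow>
               chain_on {x\<in>Y. b x = x} (t c)"
    and e: "chain_on {x\<in>Y. b x = x} e"
    and FY: "\<And>\<alpha>. chain_on Y (F \<alpha>)"
    and Fn: "\<And>\<alpha>. n \<le> sum_list \<alpha> \<Longrightarrow> F \<alpha> = 0"
    and F: "\<And>\<alpha>. length \<alpha> = Suc (length ts) \<Longrightarrow>
              divisible p (total_boundary p d (induced b # ts) F \<alpha> - origin_family e \<alpha>)"
  obtains v where "\<And>\<alpha>. chain_on {x\<in>Y. b x = x} (v \<alpha>)"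
    and "\<And>\<alpha>. n \<le> sum_list \<alpha> \<Longrightarrow> v \<alpha> = 0"
    and "\<And>\<alpha>. length \<alpha> = length ts \<Longrightarrow> divisible p (total_boundary p d ts v \<alpha> - origin_family e \<alpha>)"
proof -
  let ?E = "moving_part b" and ?\<theta> = "resolution_coeff p (induced b)" and ?D = "total_boundary p d ts"
  let ?Yb = "{x\<in>Y. b x = x}"
  have add: "Modules.additive d" "\<forall>t\<in>set ts. Modules.additive t"
    and ok: "commuting_ops p d ts"
    and comm: "d (induced b c) = induced b (d c)"
      "t \<in> set ts \<Longrightarrow> t (induced b c) = induced b (t c)" for c t
    using ops by (auto simp: commuting_ops_def)
  have add\<theta>: "Modules.additive (?\<theta> q)" for q by (simp add: additive_resolution_coeff)
  have D\<theta>: "?D (\<lambda>\<beta>. ?\<theta> q (G \<beta>)) \<alpha> = ?\<theta> q (?D G \<alpha>)" for q G \<alpha>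
  proof (rule total_boundary_chain_map[where P = "\<lambda>_. True"])
    show "list_all2 (\<lambda>t t'. \<forall>c. True \<longrightarrow> True \<and> ?\<theta> q (t c) = t' (?\<theta> q c)) ts ts"
    proof (rule list.rel_refl_strong, intro allI impI conjI TrueI)
      show "?\<theta> q (t c) = t (?\<theta> q c)" if "t \<in> set ts" for t c
        by (rule resolution_coeff_commute[where P = "\<lambda>_. True", symmetric])
           (use that comm add in auto)
    qed
    show "?\<theta> q (d c) = d (?\<theta> q c)" for c
      by (rule resolution_coeff_commute[where P = "\<lambda>_. True", symmetric])
         (use comm add in auto)
  qed (auto simp: add\<theta>)
  have bb: "b (b x) = b x \<longleftrightarrow> b x = x" for x
  proof
    assume "b (b x) = b x"
    then have "(b ^^ i) (b x) = b x" for i by (induction i) auto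
    moreover have "(b ^^ (p - 1)) (b x) = x"
      using period[of x] prime_gt_0_nat[OF prime] by (cases p) (auto simp: funpow_swap1)
    ultimately show "b x = x" by metis
  qed simp
  have Eb: "?E (induced b c) = induced b (?E c)" for c
    by (rule additive_eqI[of "\<lambda>c. ?E (induced b c)" "\<lambda>c. induced b (?E c)"])
       (auto simp: Modules.additive_def additive.add additive_zero moving_part_def
          additive.add[OF additive_frag_extend] additive.add[OF additive_induced] bb)
  have E\<theta>: "?E (?\<theta> q c) = ?\<theta> q (?E c)" for q c
    by (rule resolution_coeff_commute[where P = "\<lambda>_. True"]) (auto simp: Eb)
  have EY: "chain_on Y (?E c)" if "chain_on Y c" for c
    unfolding moving_part_def by (rule chain_on_frag_extend[OF that]) simp
  have FixY: "chain_on ?Yb (c - ?E c)" if "chain_on Y c" for c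
    using keys_fixed_part[of c b] that by (auto simp: chain_on_def)
  have DY: "chain_on Y (?D G \<alpha>)" if "\<And>\<beta>. chain_on Y (G \<beta>)" for G \<alpha>
    by (rule total_boundary_closed[where P = "\<lambda>c. chain_on Y c"]) (use that in \<open>auto intro: chain_on_diff dY tY\<close>)
  have DYb: "chain_on ?Yb (?D G \<alpha>)" if "\<And>\<beta>. chain_on ?Yb (G \<beta>)" for G \<alpha>
    by (rule total_boundary_closed[where P = "\<lambda>c. chain_on ?Yb c"])
       (use that in \<open>auto intro: chain_on_diff dYb tYb\<close>)
  have Ddiv: "divisible p (?D G \<alpha>)" if "\<And>\<beta>. length \<beta> = length \<alpha> \<Longrightarrow> divisible p (G \<beta>)" for G \<alpha>
    by (rule total_boundary_closed[where P = "divisible p"]) (use that add in \<open>auto intro: divisible_diff divisible_additive[of d] divisible_additive\<close>)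
  have EDE: "?E (?D (\<lambda>\<beta>. ?E (G \<beta>)) \<alpha>) = ?E (?D G \<alpha>)" if "\<And>\<beta>. chain_on Y (G \<beta>)" for G \<alpha>
  proof -
    have "chain_on ?Yb (?D (\<lambda>\<beta>. G \<beta> - ?E (G \<beta>)) \<alpha>)"
      by (rule DYb) (rule FixY[OF that])
    then have "?E (?D (\<lambda>\<beta>. G \<beta> - ?E (G \<beta>)) \<alpha>) = 0"
      by (intro moving_part_fixed) (auto simp: chain_on_def)
    then show ?thesis by (simp add: total_boundary_diff[OF add] additive_diff)
  qed
  have slice: "divisible p (?D (\<lambda>\<beta>. F (Suc q # \<beta>)) \<alpha> - ?\<theta> (Suc q) (F (q # \<alpha>)))"
    if "length \<alpha> = length ts" for q \<alpha>
    using F[of "Suc q # \<alpha>"] that by (simp add: origin_family_def divisible_signed)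
  \<comment> \<open>\<open>z\<close> and \<open>z'\<close> are bounded by the same \<open>n\<close> as \<open>F\<close>, shifted by their degrees \<open>q\<close> and \<open>q + 1\<close>;
    this starts the downward induction with zero families and bounds \<open>v\<close> at its end.\<close>
  define good where "good q z z' \<longleftrightarrow>
      (\<forall>\<alpha>. chain_on Y (z \<alpha>) \<and> chain_on Y (z' \<alpha>))
    \<and> (\<forall>\<alpha>. n \<le> sum_list \<alpha> + q \<longrightarrow> z \<alpha> = 0) \<and> (\<forall>\<alpha>. n \<le> sum_list \<alpha> + Suc q \<longrightarrow> z' \<alpha> = 0)
    \<and> (\<forall>\<alpha>. length \<alpha> = length ts \<longrightarrow> divisible p (?E (F (q # \<alpha>) - ?D z' \<alpha>) - ?\<theta> q (z \<alpha>)))" for q z z'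
  have "\<exists>z z'. good q z z'" if "q \<le> n" for q
    using that
  proof (induction rule: inc_induct)
    case base
    have "good n (\<lambda>_. 0) (\<lambda>_. 0)"
      using Fn by (simp add: good_def total_boundary_zero[OF add] additive_zero[OF add\<theta>] additive_zero)
    then show ?case by blast
  next
    case (step q)
    then obtain z z' where g: "good (Suc q) z z'" by blast
    then have zY: "\<And>\<alpha>. chain_on Y (z \<alpha>)" "\<And>\<alpha>. chain_on Y (z' \<alpha>)"
      and zn: "\<And>\<alpha>. n \<le> sum_list \<alpha> + Suc q \<Longrightarrow> z \<alpha> = 0"
      and z: "\<And>\<alpha>. length \<alpha> = length ts \<Longrightarrow>
          divisible p (?E (F (Suc q # \<alpha>) - ?D z' \<alpha>) - ?\<theta> (Suc q) (z \<alpha>))"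
      by (auto simp: good_def)
    define c where "c \<alpha> = F (q # \<alpha>) - ?D z \<alpha>" for \<alpha>
    obtain S R where SR: "Modules.additive S" "Modules.additive R"
      "\<And>c. ?E c = ?\<theta> q (S c) + R (?\<theta> (Suc q) c)"
      "\<And>Y c. (\<And>x. x \<in> Y \<Longrightarrow> b x \<in> Y) \<Longrightarrow> chain_on Y c \<Longrightarrow> chain_on Y (S c)"
      using free_orbit_exactness[where p = p and b = b and q = q] prime period by metis
    have cY: "chain_on Y (c \<alpha>)" for \<alpha>
      unfolding c_def by (intro chain_on_diff FY DY zY)
    have cn: "c \<alpha> = 0" if "n \<le> sum_list \<alpha> + q" for \<alpha>
    proof -
      have "?D z \<alpha> = 0" by (rule total_boundary_vanish[OF add]) (use that zn in auto)
      then show ?thesis using that Fn[of "q # \<alpha>"] by (simp add: c_def add.commute)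
    qed
    have \<theta>c: "divisible p (?\<theta> (Suc q) (?E (c \<alpha>)))" if len: "length \<alpha> = length ts" for \<alpha>
    proof -
      let ?F = "\<lambda>\<beta>. F (Suc q # \<beta>)"
      have "divisible p (?D (\<lambda>\<beta>. ?E (?F \<beta> - ?D z' \<beta>) - ?\<theta> (Suc q) (z \<beta>)) \<alpha>)"
        by (rule Ddiv) (use z len in auto)
      then have "divisible p (?E (?D (\<lambda>\<beta>. ?E (?F \<beta> - ?D z' \<beta>) - ?\<theta> (Suc q) (z \<beta>)) \<alpha>))"
        by (rule divisible_additive[OF additive_moving_part])
      also have "?E (?D (\<lambda>\<beta>. ?E (?F \<beta> - ?D z' \<beta>) - ?\<theta> (Suc q) (z \<beta>)) \<alpha>)
          = ?E (?D (\<lambda>\<beta>. ?F \<beta> - ?D z' \<beta>) \<alpha>) - ?E (?\<theta> (Suc q) (?D z \<alpha>))"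
        using EDE[of "\<lambda>\<beta>. ?F \<beta> - ?D z' \<beta>" \<alpha>] chain_on_diff[OF FY DY[OF zY(2)]]
        by (simp add: total_boundary_diff[OF add] D\<theta> additive_diff)
      also have "?D (\<lambda>\<beta>. ?F \<beta> - ?D z' \<beta>) \<alpha> = ?D ?F \<alpha>"
        by (simp add: total_boundary_diff[OF add] total_boundary_total_boundary[OF ok])
      finally have 1: "divisible p (?E (?D ?F \<alpha>) - ?E (?\<theta> (Suc q) (?D z \<alpha>)))" .
      have 2: "divisible p (?E (?D ?F \<alpha> - ?\<theta> (Suc q) (F (q # \<alpha>))))"
        by (rule divisible_additive[OF additive_moving_part slice[OF len]])
      have "divisible p (?E (?\<theta> (Suc q) (c \<alpha>)))"
        using divisible_diff[OF 1 2] by (simp add: c_def additive_diff additive_diff[OF add\<theta>])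
      then show ?thesis by (simp add: E\<theta>)
    qed
    have "good q (\<lambda>\<alpha>. S (?E (c \<alpha>))) z"
      unfolding good_def
    proof (intro conjI allI impI)
      show "chain_on Y (S (?E (c \<alpha>)))" for \<alpha>
        by (rule SR(4)[OF Y EY[OF cY]])
      show "S (?E (c \<alpha>)) = 0" if "n \<le> sum_list \<alpha> + q" for \<alpha>
        using cn[OF that] by (simp add: additive_zero SR(1))
      show "divisible p (?E (F (q # \<alpha>) - ?D z \<alpha>) - ?\<theta> q (S (?E (c \<alpha>))))"
        if "length \<alpha> = length ts" for \<alpha>
      proof -
        have "?E (c \<alpha>) - ?\<theta> q (S (?E (c \<alpha>))) = R (?\<theta> (Suc q) (?E (c \<alpha>)))"
          using SR(3)[of "?E (c \<alpha>)"] by (metis add_diff_cancel_left' moving_part_idem)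
        then show ?thesis
          using divisible_additive[OF SR(2) \<theta>c[OF that]] unfolding c_def by metis
      qed
    qed (rule zY(1), rule zn)
    then show ?case by blast
  qed
  then obtain z z' where g: "good 0 z z'" by blast
  define x where "x \<alpha> = F (0 # \<alpha>) - ?D z' \<alpha>" for \<alpha>
  define v where "v \<alpha> = x \<alpha> - ?E (x \<alpha>)" for \<alpha>
  have zY: "\<And>\<alpha>. chain_on Y (z \<alpha>)" "\<And>\<alpha>. chain_on Y (z' \<alpha>)"
    and z'n: "\<And>\<alpha>. n \<le> sum_list \<alpha> + 1 \<Longrightarrow> z' \<alpha> = 0"
    and z: "\<And>\<alpha>. length \<alpha> = length ts \<Longrightarrow> divisible p (?E (x \<alpha>) - ?\<theta> 0 (z \<alpha>))"
    using g by (auto simp: good_def x_def)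
  have vY: "chain_on ?Yb (v \<alpha>)" for \<alpha>
    unfolding v_def x_def by (intro FixY chain_on_diff FY DY zY)
  show thesis
  proof (rule that[of v])
    show "v \<alpha> = 0" if "n \<le> sum_list \<alpha>" for \<alpha>
    proof -
      have "?D z' \<alpha> = 0" by (rule total_boundary_vanish[OF add]) (use that z'n in auto)
      then show ?thesis using that Fn[of "0 # \<alpha>"] by (simp add: v_def x_def additive_zero)
    qed
    show "divisible p (?D v \<alpha> - origin_family e \<alpha>)" if len: "length \<alpha> = length ts" for \<alpha>
    proof -
      let ?w = "?D z \<alpha>"
      define fixpart where "fixpart c = c - ?E c" for c
      have add\<pi>: "Modules.additive fixpart"
        by (simp add: fixpart_def Modules.additive_def additive.add[OF additive_moving_part])
      have 1: "divisible p (?D (\<lambda>\<beta>. ?E (x \<beta>) - ?\<theta> 0 (z \<beta>)) \<alpha>)"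
        by (rule Ddiv) (use z len in auto)
      have 2: "divisible p (?D x \<alpha> - origin_family e \<alpha>)"
      proof -
        have "?D x \<alpha> = ?D (\<lambda>\<beta>. F (0 # \<beta>)) \<alpha>"
          unfolding x_def by (simp add: total_boundary_diff[OF add] total_boundary_total_boundary[OF ok])
        then show ?thesis using F[of "0 # \<alpha>"] len by (simp add: origin_family_def signed_def)
      qed
      have 3: "?D v \<alpha> - origin_family e \<alpha> + ?\<theta> 0 ?w
          = (?D x \<alpha> - origin_family e \<alpha>) - ?D (\<lambda>\<beta>. ?E (x \<beta>) - ?\<theta> 0 (z \<beta>)) \<alpha> "
        unfolding v_def by (simp add: total_boundary_diff[OF add] D\<theta>)
      have "divisible p (fixpart (?D v \<alpha> - origin_family e \<alpha> + ?\<theta> 0 ?w))"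
        unfolding 3 by (intro divisible_additive[OF add\<pi>] divisible_diff 1 2)
      then have "divisible p (fixpart (?D v \<alpha>) - fixpart (origin_family e \<alpha>) + fixpart (?\<theta> 0 ?w))"
        by (simp add: additive.add[OF add\<pi>] additive.diff[OF add\<pi>])
      moreover have "fixpart (?D v \<alpha>) = ?D v \<alpha>" "fixpart (origin_family e \<alpha>) = origin_family e \<alpha>"
        unfolding fixpart_def using DYb[of v \<alpha>, OF vY] e by (auto intro!: moving_part_fixed simp: origin_family_def chain_on_def)
      moreover have "fixpart (?\<theta> 0 ?w) = ?\<theta> 0 (fixpart ?w)"
        by (simp add: fixpart_def E\<theta> additive_diff[OF add\<theta>])
      moreover have "divisible p (?\<theta> 0 (fixpart ?w))"
        by (rule resolution_coeff_fixed) (use keys_fixed_part[of ?w b] in \<open>auto simp: fixpart_def\<close>)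
      ultimately show ?thesis
        using divisible_diff[of p "?D v \<alpha> - origin_family e \<alpha> + ?\<theta> 0 (fixpart ?w)" "?\<theta> 0 (fixpart ?w)"] by simp
    qed
  qed (rule vY)
qed

section \<open>Ordered chains and iterated cones\<close>

lemma signed_add: "signed q (a + b) = signed q a + signed q b"
  by (simp add: signed_def)

lemma signed_minus: "signed q (- a) = - signed q a"
  by (simp add: signed_def)

lemma signed_sum: "signed q (sum f I) = (\<Sum>i\<in>I. signed q (f i))"
  by (simp add: signed_def sum_negf)

lemma chain_on_mono: "chain_on Y c \<Longrightarrow> Y \<subseteq> Z \<Longrightarrow> chain_on Z c"
  by (auto simp: chain_on_def)

text \<open>Ordered simplices, with the empty list as the augmentation in degree -1.\<close>
primrec list_boundary :: "'v list \<Rightarrow> 'v list \<Rightarrow>\<^sub>0 int" where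
  "list_boundary [] = 0"
| "list_boundary (a # l) = frag_of l - induced ((#) a) (list_boundary l)"

abbreviation boundary\<^sub>L :: "('v list \<Rightarrow>\<^sub>0 int) \<Rightarrow> 'v list \<Rightarrow>\<^sub>0 int" where
  "boundary\<^sub>L \<equiv> frag_extend list_boundary"

lemma boundary_cone: "boundary\<^sub>L (induced ((#) a) c) = c - induced ((#) a) (boundary\<^sub>L c)"
  by (rule additive_eqI[of "\<lambda>c. boundary\<^sub>L (induced ((#) a) c)" "\<lambda>c. c - induced ((#) a) (boundary\<^sub>L c)"])
     (auto simp: Modules.additive_def additive.add[OF additive_frag_extend] additive.add[OF additive_induced])

lemma boundary_boundary_list: "boundary\<^sub>L (boundary\<^sub>L c) = 0"
proof (rule additive_eqI[of "\<lambda>c. boundary\<^sub>L (boundary\<^sub>L c)" "\<lambda>_. 0"])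
  show "boundary\<^sub>L (boundary\<^sub>L (frag_of l)) = 0" for l :: "'a list"
    by (induction l) (auto simp: frag_extend_diff boundary_cone additive_zero)
qed (auto simp: Modules.additive_def frag_extend_add)

lemma boundary_map: "boundary\<^sub>L (induced (map b) c) = induced (map b) (boundary\<^sub>L c)"
proof (rule additive_eqI[of "\<lambda>c. boundary\<^sub>L (induced (map b) c)" "\<lambda>c. induced (map b) (boundary\<^sub>L c)"])
  have comp: "induced (map b) (induced ((#) a) c) = induced ((#) (b a)) (induced (map b) c)" for a c
    by (rule additive_eqI[of "\<lambda>c. induced (map b) (induced ((#) a) c)" "\<lambda>c. induced ((#) (b a)) (induced (map b) c)"])
       (auto simp: Modules.additive_def additive.add[OF additive_induced])
  show "boundary\<^sub>L (induced (map b) (frag_of l)) = induced (map b) (boundary\<^sub>L (frag_of l))" for l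
    by (induction l) (auto simp: additive_diff comp additive_zero)
qed (auto simp: Modules.additive_def frag_extend_add additive.add[OF additive_induced])

lemma induced_commute:
  assumes "\<And>x. f (g x) = g' (f' x)"
  shows "induced f (induced g c) = induced g' (induced f' c)"
  by (rule additive_eqI[of "\<lambda>c. induced f (induced g c)" "\<lambda>c. induced g' (induced f' c)"])
     (auto simp: Modules.additive_def additive.add[OF additive_induced] assms)

lemma induced_period: "(\<And>x. (b ^^ p) x = x) \<Longrightarrow> (induced b ^^ p) c = c"
  unfolding funpow_induced
  by (rule additive_eqI[of "induced (b ^^ p)" "\<lambda>c. c"])
     (auto simp: Modules.additive_def additive.add[OF additive_induced])

lemma funpow_map: "(map b ^^ i) l = map (b ^^ i) l"
  for b :: "'v \<Rightarrow> 'v"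
  by (induction i) auto

lemma commuting_ops_lists:
  assumes "\<forall>b\<in>set bs. (\<forall>x. (b ^^ p) x = x) \<and> (\<forall>b'\<in>set bs. \<forall>x. b' (b x) = b (b' x))"
  shows "commuting_ops p boundary\<^sub>L (map (\<lambda>b. induced (map b)) bs)"
proof -
  have 1: "(induced (map b) ^^ p) c = c" if "b \<in> set bs" for b c
    by (rule induced_period) (use that assms in \<open>simp add: funpow_map list.map_ident_strong\<close>)
  have 2: "induced (map b') (induced (map b) c) = induced (map b) (induced (map b') c)"
    if "b \<in> set bs" "b' \<in> set bs" for b b' c
    by (rule induced_commute) (use that assms in \<open>auto simp: comp_def\<close>)
  show ?thesis
    using 1 2 by (simp add: commuting_ops_def boundary_map boundary_boundary_list)
qed

text \<open>Coning with the new apex \<open>a k\<close> bounds every cycle found so far, so the family can be built degree by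
degree; that the next obstruction is a cycle is the statement that the total boundary squares to zero.
The set \<open>L k\<close> collects the admissible ordered simplices with \<open>k\<close> vertices.\<close>
lemma resolution_in_joins:
  fixes L :: "nat \<Rightarrow> 'v list set"
  assumes bs: "\<forall>b\<in>set bs. (\<forall>x. (b ^^ p) x = x) \<and> (\<forall>b'\<in>set bs. \<forall>x. b' (b x) = b (b' x))"
    and L0: "[] \<in> L 0"
    and La: "\<And>k l. k < n \<Longrightarrow> l \<in> L k \<Longrightarrow> a k # l \<in> L (Suc k)"
    and Lb: "\<And>k l b. b \<in> set bs \<Longrightarrow> l \<in> L k \<Longrightarrow> map b l \<in> L k"
  obtains F where "\<And>\<alpha>. chain_on (L (Suc (sum_list \<alpha>))) (F \<alpha>)"
    and "\<And>\<alpha>. n \<le> sum_list \<alpha> \<Longrightarrow> F \<alpha> = 0"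
    and "\<And>\<alpha>. length \<alpha> = length bs \<Longrightarrow> sum_list \<alpha> < n \<Longrightarrow>
           total_boundary p boundary\<^sub>L (map (\<lambda>b. induced (map b)) bs) F \<alpha> = origin_family (frag_of []) \<alpha>"
proof -
  let ?ts = "map (\<lambda>b. induced (map b)) bs"
  let ?D = "total_boundary p boundary\<^sub>L ?ts" and ?\<epsilon> = "origin_family (frag_of [])"
  have ok: "commuting_ops p boundary\<^sub>L ?ts" by (rule commuting_ops_lists[OF bs])
  have add: "Modules.additive boundary\<^sub>L" "\<forall>t\<in>set ?ts. Modules.additive t" by auto
  have D\<epsilon>: "?D ?\<epsilon> \<alpha> = 0" for \<alpha>
    by (rule total_boundary_origin_family) auto
  define good where "good N F \<longleftrightarrow> (\<forall>\<alpha>. N \<le> sum_list \<alpha> \<longrightarrow> F \<alpha> = 0)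
      \<and> (\<forall>\<alpha>. chain_on (L (Suc (sum_list \<alpha>))) (F \<alpha>))
      \<and> (\<forall>\<alpha>. length \<alpha> = length bs \<longrightarrow> sum_list \<alpha> < N \<longrightarrow> ?D F \<alpha> = ?\<epsilon> \<alpha>)" for N F
  have "\<exists>F. good N F" if "N \<le> n" for N
    using that
  proof (induction N)
    case 0
    have "good 0 (\<lambda>_. 0)" by (simp add: good_def)
    then show ?case by blast
  next
    case (Suc N)
    then obtain F where "good N F" by auto
    then have FN: "\<And>\<alpha>. N \<le> sum_list \<alpha> \<Longrightarrow> F \<alpha> = 0"
      and FL: "\<And>\<alpha>. chain_on (L (Suc (sum_list \<alpha>))) (F \<alpha>)"
      and F: "\<And>\<alpha>. length \<alpha> = length bs \<Longrightarrow> sum_list \<alpha> < N \<Longrightarrow> ?D F \<alpha> = ?\<epsilon> \<alpha>"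
      by (auto simp: good_def)
    define Q where "Q \<alpha> = ?\<epsilon> \<alpha> - ?D F \<alpha>" for \<alpha>
    define G where "G \<alpha> = (if length \<alpha> = length bs \<and> sum_list \<alpha> = N
        then - signed N (induced ((#) (a N)) (Q \<alpha>)) else 0)" for \<alpha>
    have QL: "chain_on (L N) (Q \<alpha>)" if "length \<alpha> = length bs" "sum_list \<alpha> = N" for \<alpha>
      unfolding Q_def
    proof (intro chain_on_diff total_boundary_closed[where P = "chain_on (L N)"])
      show "chain_on (L N) (?\<epsilon> \<alpha>)"
      proof (cases "set \<alpha> \<subseteq> {0}")
        case True
        then have "sum_list \<alpha> = 0" by (auto simp: sum_list_eq_0_iff)
        then show ?thesis using that L0 by (auto simp: origin_family_def)
      qed (simp add: origin_family_def)
      show "chain_on (L N) (t c)" if "t \<in> set ?ts" "chain_on (L N) c" for t c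
        using that Lb unfolding induced_def by (auto intro!: chain_on_frag_extend)
      show "chain_on (L N) (boundary\<^sub>L (F \<alpha>))" using FN that by simp
      show "chain_on (L N) (F \<beta>)" if "Suc (sum_list \<beta>) = sum_list \<alpha>" for \<beta>
        using FL[of \<beta>] that \<open>sum_list \<alpha> = N\<close> by simp
    qed auto
    have dQ: "boundary\<^sub>L (Q \<alpha>) = 0" if "length \<alpha> = length bs" "sum_list \<alpha> = N" for \<alpha>
    proof -
      have "?D Q \<alpha> = signed N (boundary\<^sub>L (Q \<alpha>))"
        unfolding that(2)[symmetric] by (rule total_boundary_leading[OF add]) (use that F in \<open>auto simp: Q_def\<close>)
      moreover have "?D Q \<alpha> = 0"
        unfolding Q_def by (simp add: total_boundary_diff[OF add] total_boundary_total_boundary[OF ok] D\<epsilon>)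
      ultimately show ?thesis by (metis signed_signed signed_zero)
    qed
    have DG: "?D G \<alpha> = signed (sum_list \<alpha>) (boundary\<^sub>L (G \<alpha>))"
      if "length \<alpha> = length bs" "sum_list \<alpha> \<le> N" for \<alpha>
      by (rule total_boundary_leading[OF add]) (use that in \<open>auto simp: G_def\<close>)
    have "good (Suc N) (\<lambda>\<alpha>. F \<alpha> - G \<alpha>)"
      unfolding good_def
    proof (intro conjI allI impI)
      show "F \<alpha> - G \<alpha> = 0" if "Suc N \<le> sum_list \<alpha>" for \<alpha>
        using FN that by (auto simp: G_def)
      have "chain_on (L (Suc (sum_list \<alpha>))) (G \<alpha>)" for \<alpha>
        using QL[of \<alpha>] La[of N] Suc.prems unfolding induced_def
        by (auto simp: G_def signed_def induced_def intro!: chain_on_frag_extend)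
      then show "chain_on (L (Suc (sum_list \<alpha>))) (F \<alpha> - G \<alpha>)" for \<alpha>
        using FL by (intro chain_on_diff)
      show "?D (\<lambda>\<alpha>. F \<alpha> - G \<alpha>) \<alpha> = ?\<epsilon> \<alpha>" if "length \<alpha> = length bs" "sum_list \<alpha> < Suc N" for \<alpha>
      proof (cases "sum_list \<alpha> = N")
        case True
        have "?D G \<alpha> = - Q \<alpha>"
          using dQ[OF that(1) True] DG that True
          by (simp add: G_def additive_signed signed_minus boundary_cone frag_extend_minus additive_zero)
        then show ?thesis by (simp add: total_boundary_diff[OF add] Q_def)
      next
        case False
        then have "?D G \<alpha> = 0" using DG that by (simp add: G_def)
        then show ?thesis using F that False by (simp add: total_boundary_diff[OF add])
      qed
    qed
    then show ?case by blast
  qed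
  then obtain F where "good n F" by blast
  then show thesis by (intro that[of F]) (auto simp: good_def)
qed

section \<open>Oriented chains of complexes with blocks\<close>

definition block_rank :: "('a \<times> nat) set \<Rightarrow> 'a \<times> nat \<Rightarrow> nat" where
  "block_rank S v = card {w\<in>S. snd w < snd v}"

text \<open>The second component of a vertex is its block.  A simplex meets each block at most once, and the blocks
order its vertices; on other sets the boundary is 0, which keeps \<open>d d = 0\<close> free of side conditions.\<close>
definition set_boundary :: "('a \<times> nat) set \<Rightarrow> ('a \<times> nat) set \<Rightarrow>\<^sub>0 int" where
  "set_boundary S = (if finite S \<and> inj_on snd S
     then \<Sum>v\<in>S. signed (block_rank S v) (frag_of (S - {v})) else 0)"

text \<open>Multiplication by the vertex \<open>a\<close> in the exterior algebra, in the basis of sets sorted by blocks.\<close>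
definition wedge :: "'a \<times> nat \<Rightarrow> ('a \<times> nat) set \<Rightarrow> ('a \<times> nat) set \<Rightarrow>\<^sub>0 int" where
  "wedge a S = (if a \<in> S then 0 else signed (block_rank S a) (frag_of (insert a S)))"

abbreviation boundary\<^sub>S :: "(('a \<times> nat) set \<Rightarrow>\<^sub>0 int) \<Rightarrow> ('a \<times> nat) set \<Rightarrow>\<^sub>0 int" where
  "boundary\<^sub>S \<equiv> frag_extend set_boundary"

lemma frag_extend_signed: "frag_extend f (signed q c) = signed q (frag_extend f c)"
  by (simp add: additive_signed)

text \<open>The Koszul identity \<open>d (a \<and> c) = c - a \<and> d c\<close>.  If \<open>a\<close> is already a vertex, the left-hand side
vanishes, and on the right only the face that omits \<open>a\<close> survives.\<close>
lemma boundary_wedge_of: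
  assumes "finite S" "inj_on snd (insert a S)"
  shows "boundary\<^sub>S (wedge a S) = frag_of S - frag_extend (wedge a) (set_boundary S)"
proof (cases "a \<in> S")
  case True
  have inj: "inj_on snd S" using assms(2) by (auto intro: inj_on_subset)
  have "frag_extend (wedge a) (set_boundary S)
      = (\<Sum>v\<in>S. signed (block_rank S v) (wedge a (S - {v})))"
    using assms inj by (simp add: set_boundary_def frag_extend_sum frag_extend_signed comp_def)
  also have "\<dots> = (\<Sum>v\<in>S. if v = a then frag_of S else 0)"
  proof (rule sum.cong)
    fix v assume "v \<in> S"
    have "{w \<in> S - {a}. snd w < snd a} = {w \<in> S. snd w < snd a}" by auto
    then show "signed (block_rank S v) (wedge a (S - {v})) = (if v = a then frag_of S else 0)"
      using True by (auto simp: wedge_def block_rank_def insert_absorb)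
  qed simp
  also have "\<dots> = frag_of S" using True assms by simp
  finally show ?thesis using True by (simp add: wedge_def)
next
  case False
  have inj: "inj_on snd S" using assms(2) by (auto intro: inj_on_subset)
  have neq: "snd v \<noteq> snd a" if "v \<in> S" for v
    using inj_onD[OF assms(2), of v a] that False by auto
  have "boundary\<^sub>S (wedge a S) = signed (block_rank S a) (set_boundary (insert a S))"
    using False by (simp add: wedge_def frag_extend_signed)
  also have "set_boundary (insert a S)
      = signed (block_rank (insert a S) a) (frag_of S)
        + (\<Sum>v\<in>S. signed (block_rank (insert a S) v) (frag_of (insert a S - {v})))"
    using False assms by (simp add: set_boundary_def)
  also have "block_rank (insert a S) a = block_rank S a"
    by (simp add: block_rank_def) (metis less_irrefl)
  also have "signed (block_rank S a) (signed (block_rank S a) (frag_of S)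
        + (\<Sum>v\<in>S. signed (block_rank (insert a S) v) (frag_of (insert a S - {v}))))
      = frag_of S + (\<Sum>v\<in>S. signed (block_rank S a + block_rank (insert a S) v) (frag_of (insert a S - {v})))"
    by (simp add: signed_add signed_sum signed_add_index)
  also have "(\<Sum>v\<in>S. signed (block_rank S a + block_rank (insert a S) v) (frag_of (insert a S - {v})))
      = (\<Sum>v\<in>S. - signed (block_rank S v) (wedge a (S - {v})))"
  proof (rule sum.cong)
    fix v assume v: "v \<in> S"
    then have va: "v \<noteq> a" using False by auto
    have ins: "insert a S - {v} = insert a (S - {v})" using va by auto
    have r1: "block_rank (insert a S) v = block_rank S v + (if snd a < snd v then 1 else 0)"
    proof -
      have "{w \<in> insert a S. snd w < snd v}
          = (if snd a < snd v then insert a {w \<in> S. snd w < snd v} else {w \<in> S. snd w < snd v})"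
        by auto
      then show ?thesis using False assms(1) by (simp add: block_rank_def)
    qed
    have r2: "block_rank S a = block_rank (S - {v}) a + (if snd v < snd a then 1 else 0)"
    proof -
      have "{w \<in> S. snd w < snd a}
          = (if snd v < snd a then insert v {w \<in> S - {v}. snd w < snd a} else {w \<in> S - {v}. snd w < snd a})"
        using v by auto
      then show ?thesis using assms(1) by (simp add: block_rank_def)
    qed
    show "signed (block_rank S a + block_rank (insert a S) v) (frag_of (insert a S - {v}))
        = - signed (block_rank S v) (wedge a (S - {v}))"
      using neq[OF v] False unfolding ins
      by (auto simp: wedge_def signed_def r1 r2)
  qed simp
  also have "frag_of S + (\<Sum>v\<in>S. - signed (block_rank S v) (wedge a (S - {v})))
      = frag_of S - frag_extend (wedge a) (set_boundary S)"
    using assms inj by (simp add: set_boundary_def frag_extend_sum frag_extend_signed comp_def sum_negf)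
  finally show ?thesis .
qed

lemma boundary_wedge:
  assumes "chain_on {S. finite S \<and> inj_on snd (insert a S)} c"
  shows "boundary\<^sub>S (frag_extend (wedge a) c) = c - frag_extend (wedge a) (boundary\<^sub>S c)"
  by (rule additive_eqI[of "\<lambda>c. boundary\<^sub>S (frag_extend (wedge a) c)"])
     (use assms in \<open>auto simp: Modules.additive_def frag_extend_add boundary_wedge_of chain_on_def\<close>)

lemma chain_on_boundary:
  assumes "chain_on Y c" "\<And>S T. S \<in> Y \<Longrightarrow> T \<subseteq> S \<Longrightarrow> T \<in> Y"
  shows "chain_on Y (boundary\<^sub>S c)"
proof (rule chain_on_frag_extend[OF assms(1)])
  fix S assume "S \<in> Y"
  then show "chain_on Y (set_boundary S)"
    using assms(2)[of S] by (auto simp: set_boundary_def signed_def intro!: chain_on_sum)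
qed

text \<open>Induction on the simplex with the Koszul identity, which replaces the usual cancellation of pairs.\<close>
lemma boundary_boundary_set: "boundary\<^sub>S (boundary\<^sub>S c) = 0"
proof (rule additive_eqI[of "\<lambda>c. boundary\<^sub>S (boundary\<^sub>S c)" "\<lambda>_. 0"])
  fix S :: "('a \<times> nat) set"
  show "boundary\<^sub>S (boundary\<^sub>S (frag_of S)) = 0"
  proof (cases "finite S \<and> inj_on snd S")
    case True
    then have "finite S" "inj_on snd S" by auto
    then show ?thesis
    proof (induction S rule: finite_induct)
      case empty
      then show ?case by (simp add: set_boundary_def)
    next
      case (insert a S)
      have Y: "chain_on {T. T \<subseteq> S} (set_boundary S)"
        using chain_on_boundary[of "{T. T \<subseteq> S}" "frag_of S"] by auto
      have "chain_on {T. finite T \<and> inj_on snd (insert a T)} (set_boundary S)"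
      proof (rule chain_on_mono[OF Y], clarify, intro conjI)
        show "finite T" if "T \<subseteq> S" for T using that insert by (auto intro: finite_subset)
        show "inj_on snd (insert a T)" if "T \<subseteq> S" for T
          by (rule inj_on_subset[OF insert.prems]) (use that in auto)
      qed
      then have 1: "boundary\<^sub>S (frag_extend (wedge a) (set_boundary S)) = set_boundary S - frag_extend (wedge a) (boundary\<^sub>S (set_boundary S))"
        by (rule boundary_wedge)
      have IH: "boundary\<^sub>S (set_boundary S) = 0"
        using insert by (simp add: inj_on_subset[OF insert.prems])
      have "frag_of (insert a S) = signed (block_rank S a) (wedge a S)"
        using insert by (simp add: wedge_def)
      then have "boundary\<^sub>S (boundary\<^sub>S (frag_of (insert a S)))
          = signed (block_rank S a) (boundary\<^sub>S (boundary\<^sub>S (wedge a S)))"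
        by (simp add: frag_extend_signed)
      also have "boundary\<^sub>S (boundary\<^sub>S (wedge a S)) = 0"
        using 1 IH insert by (simp add: boundary_wedge_of frag_extend_diff)
      finally show ?case by simp
    qed
  qed (auto simp: set_boundary_def)
qed (auto simp: Modules.additive_def frag_extend_add)

lemma block_rank_image:
  assumes "inj b" "\<And>x. snd (b x) = snd x"
  shows "block_rank (b ` S) (b v) = block_rank S v"
proof -
  have "{w \<in> b ` S. snd w < snd (b v)} = b ` {w\<in>S. snd w < snd v}" using assms(2) by auto
  then show ?thesis
    using card_image[of b "{w\<in>S. snd w < snd v}"] assms(1)
    by (auto simp: block_rank_def intro: inj_on_subset)
qed

lemma inj_on_snd_image:
  assumes "\<And>x. snd (b x) = snd x" "inj b"
  shows "inj_on snd (b ` S) \<longleftrightarrow> inj_on snd S"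
proof -
  have "snd \<circ> b = snd" using assms(1) by auto
  then show ?thesis
    using comp_inj_on_iff[of b S snd] assms(2) by (simp add: inj_on_subset)
qed

lemma boundary_image:
  assumes "inj b" "\<And>x. snd (b x) = snd x"
  shows "boundary\<^sub>S (induced (image b) c) = induced (image b) (boundary\<^sub>S c)"
proof (rule additive_eqI[of "\<lambda>c. boundary\<^sub>S (induced (image b) c)" "\<lambda>c. induced (image b) (boundary\<^sub>S c)"])
  fix S
  have inj: "inj_on b S" for S using assms(1) by (rule inj_on_subset) simp
  have "set_boundary (b ` S) = induced (image b) (set_boundary S)"
    using inj[of S] assms
    by (auto simp: set_boundary_def finite_image_iff inj_on_snd_image[OF assms(2,1)] sum.reindex
        block_rank_image additive.sum[OF additive_induced] additive_signed additive_zero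
        image_set_diff intro!: sum.cong)
  then show "boundary\<^sub>S (induced (image b) (frag_of S)) = induced (image b) (boundary\<^sub>S (frag_of S))"
    by simp
qed (auto simp: Modules.additive_def frag_extend_add additive.add[OF additive_induced])

text \<open>An ordered simplex is sent to the exterior product of its vertices: up to sign the underlying set, or
0 if a vertex is repeated.  This makes chains vanish above the dimension of the complex.\<close>
primrec orient :: "('a \<times> nat) list \<Rightarrow> ('a \<times> nat) set \<Rightarrow>\<^sub>0 int" where
  "orient [] = frag_of {}"
| "orient (a # l) = frag_extend (wedge a) (orient l)"

lemma chain_on_orient: "chain_on {set l} (orient l)"
proof (induction l)
  case (Cons a l)
  then show ?case
    by (auto intro!: chain_on_frag_extend[where Y = "{set l}"] simp: wedge_def signed_def)
qed simp

lemma orient_not_distinct: "\<not> distinct l \<Longrightarrow> orient l = 0"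
proof (induction l)
  case (Cons a l)
  show ?case
  proof (cases "a \<in> set l")
    case True
    then show ?thesis
      using chain_on_orient[of l] by (auto simp: chain_on_def wedge_def intro!: frag_extend_eq_0)
  qed (use Cons in auto)
qed simp

lemma boundary_orient:
  assumes "inj_on snd (set l)"
  shows "boundary\<^sub>S (orient l) = frag_extend orient (list_boundary l)"
  using assms
proof (induction l)
  case (Cons a l)
  have "chain_on {S. finite S \<and> inj_on snd (insert a S)} (orient l)"
    using chain_on_orient[of l] Cons.prems by (auto simp: chain_on_def)
  then have "boundary\<^sub>S (orient (a # l)) = orient l - frag_extend (wedge a) (frag_extend orient (list_boundary l))"
    using Cons by (simp add: boundary_wedge inj_on_subset[OF Cons.prems] subset_insertI)
  also have "frag_extend (wedge a) (frag_extend orient (list_boundary l))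
      = frag_extend orient (induced ((#) a) (list_boundary l))"
    by (rule additive_eqI[of "\<lambda>c. frag_extend (wedge a) (frag_extend orient c)"])
       (auto simp: Modules.additive_def frag_extend_add additive.add[OF additive_induced])
  finally show ?case by (simp add: frag_extend_diff)
qed (simp add: set_boundary_def)

lemma orient_map:
  assumes "inj b" "\<And>x. snd (b x) = snd x"
  shows "orient (map b l) = induced (image b) (orient l)"
proof (induction l)
  case (Cons a l)
  have "frag_extend (wedge (b a)) (induced (image b) c) = induced (image b) (frag_extend (wedge a) c)" for c
    by (rule additive_eqI[of "\<lambda>c. frag_extend (wedge (b a)) (induced (image b) c)"])
       (use assms in \<open>auto simp: Modules.additive_def frag_extend_add additive.add[OF additive_induced]
          wedge_def block_rank_image additive_signed additive_zero inj_image_mem_iff\<close>)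
  then show ?case using Cons by simp
qed simp

text \<open>Descending once for each generator leaves a chain on the simplices fixed by all of them, a multiple of
the empty simplex.  Its boundary is 0, but it would have to be the empty simplex modulo \<open>p\<close>.\<close>
lemma no_bounded_resolution:
  fixes bs :: "('a \<times> nat \<Rightarrow> 'a \<times> nat) list"
  assumes prime: "prime p"
    and bs: "\<forall>b\<in>set bs. (\<forall>x. (b ^^ p) x = x) \<and> (\<forall>x. snd (b x) = snd x)
               \<and> (\<forall>b'\<in>set bs. \<forall>x. b' (b x) = b (b' x))"
    and YT: "\<And>S T. S \<in> Y \<Longrightarrow> T \<subseteq> S \<Longrightarrow> T \<in> Y"
    and Yinj: "\<And>S. S \<in> Y \<Longrightarrow> inj_on snd S"
    and Yb: "\<And>b S. b \<in> set bs \<Longrightarrow> S \<in> Y \<Longrightarrow> b ` S \<in> Y"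
    and Y0: "{} \<in> Y" "\<And>S. S \<in> Y \<Longrightarrow> (\<And>b. b \<in> set bs \<Longrightarrow> b ` S = S) \<Longrightarrow> S = {}"
    and FY: "\<And>\<alpha>. chain_on Y (F \<alpha>)"
    and Fn: "\<And>\<alpha>. n \<le> sum_list \<alpha> \<Longrightarrow> F \<alpha> = 0"
  shows "\<exists>\<alpha>. length \<alpha> = length bs \<and>
    \<not> divisible p (total_boundary p boundary\<^sub>S (map (\<lambda>b. induced (image b)) bs) F \<alpha> - origin_family (frag_of {}) \<alpha>)"
proof (rule ccontr)
  assume "\<not> ?thesis"
  then have "\<And>\<alpha>. length \<alpha> = length bs \<Longrightarrow>
    divisible p (total_boundary p boundary\<^sub>S (map (\<lambda>b. induced (image b)) bs) F \<alpha> - origin_family (frag_of {}) \<alpha>)"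
    by blast
  then show False
    using bs YT Yinj Yb Y0 FY Fn
  proof (induction bs arbitrary: Y F)
    case Nil
    have "chain_on {{}} (F [])"
      using Nil.prems(7) by (intro chain_on_mono[OF Nil.prems(8)]) auto
    then have "boundary\<^sub>S (F []) = 0"
      by (intro frag_extend_eq_0) (auto simp: chain_on_def set_boundary_def)
    then have "divisible p (frag_of ({} :: ('a \<times> nat) set))"
      using Nil.prems(1)[of "[]"] divisible_minus by (fastforce simp: origin_family_def)
    then obtain c where "frag_of ({} :: ('a \<times> nat) set) = frag_cmul (int p) c"
      by (auto simp: divisible_def)
    then have "1 = int p * poly_mapping.lookup c {}"
      by (metis lookup_frag_cmul lookup_single_eq)
    then have "int p dvd 1" by (metis dvd_triv_left)
    then show False using prime_gt_1_nat[OF prime] by simp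
  next
    case (Cons b bs)
    let ?Y = "{S\<in>Y. b ` S = S}" and ?ts = "map (\<lambda>b. induced (image b)) bs"
    have act: "(c ^^ p) x = x" "snd (c x) = snd x" if "c \<in> set (b # bs)" for c x
      using Cons.prems(2) that by blast+
    have comm: "c' (c x) = c (c' x)" if "c \<in> set (b # bs)" "c' \<in> set (b # bs)" for c c' x
      using Cons.prems(2) that by blast
    have per: "(image c ^^ p) S = S" if "c \<in> set (b # bs)" for c S
    proof -
      have "(image c ^^ i) S = (c ^^ i) ` S" for i by (induction i) (auto simp: image_comp)
      then show ?thesis using act(1)[OF that] by simp
    qed
    have injb: "inj c" if "c \<in> set (b # bs)" for c
    proof (rule injI)
      fix x y assume "c x = c y"
      moreover have "p = Suc (p - 1)" using prime_gt_0_nat[OF prime] by simp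
      ultimately have "(c ^^ p) x = (c ^^ p) y" by (metis comp_apply funpow_Suc_right)
      then show "x = y" by (simp only: act(1)[OF that])
    qed
    have fixpt: "b x = x" if "S \<in> Y" "b ` S = S" "x \<in> S" for S x
      using Cons.prems(4)[OF that(1)] act(2)[of b x] that(2,3) by (auto dest: inj_onD)
    have YT': "T \<in> ?Y" if "S \<in> ?Y" "T \<subseteq> S" for S T
    proof -
      have "b x = x" if "x \<in> T" for x using fixpt \<open>S \<in> ?Y\<close> \<open>T \<subseteq> S\<close> that by blast
      then have "b ` T = T" by force
      then show ?thesis using that Cons.prems(3)[of S T] by auto
    qed
    have Yb': "c ` S \<in> ?Y" if "c \<in> set bs" "S \<in> ?Y" for c S
    proof -
      have "b ` c ` S = c ` b ` S" using comm[of b c] that(1) by (simp add: image_image)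
      then show ?thesis using that Cons.prems(5)[of c S] by auto
    qed
    show False
    proof (rule descend_to_fixed_part[OF prime, of "image b" "boundary\<^sub>S" ?ts Y "frag_of {}" F n])
      fix v
      assume v: "\<And>\<alpha>. chain_on ?Y (v \<alpha>)" "\<And>\<alpha>. n \<le> sum_list \<alpha> \<Longrightarrow> v \<alpha> = 0"
        "\<And>\<alpha>. length \<alpha> = length ?ts \<Longrightarrow>
           divisible p (total_boundary p boundary\<^sub>S ?ts v \<alpha> - origin_family (frag_of {}) \<alpha>)"
      show False
      proof (rule Cons.IH[of v ?Y])
        show "\<forall>c\<in>set bs. (\<forall>x. (c ^^ p) x = x) \<and> (\<forall>x. snd (c x) = snd x)
                 \<and> (\<forall>c'\<in>set bs. \<forall>x. c' (c x) = c (c' x))"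
          using act comm by (metis list.set_intros(2))
        show "divisible p (total_boundary p boundary\<^sub>S ?ts v \<alpha> - origin_family (frag_of {}) \<alpha>)"
          if "length \<alpha> = length bs" for \<alpha>
          using v(3) that by simp
        show "inj_on snd S" if "S \<in> ?Y" for S using Cons.prems(4) that by simp
        show "{} \<in> ?Y" using Cons.prems(6) by simp
        show "S = {}" if "S \<in> ?Y" "\<And>c. c \<in> set bs \<Longrightarrow> c ` S = S" for S
          using Cons.prems(7)[of S] that by auto
        show "T \<in> ?Y" if "S \<in> ?Y" "T \<subseteq> S" for S T using YT' that .
        show "c ` S \<in> ?Y" if "c \<in> set bs" "S \<in> ?Y" for c S using Yb' that .
      qed (fact v(1) | fact v(2))+
    next
      show "(image b ^^ p) x = x" for x by (rule per) simp
      show "commuting_ops p boundary\<^sub>S (induced (image b) # ?ts)"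
      proof -
        have 1: "(induced (image c) ^^ p) d = d" if "c \<in> set (b # bs)" for c d
          by (rule induced_period) (rule per[OF that])
        have 2: "induced (image c) (induced (image c') d) = induced (image c') (induced (image c) d)"
          if "c \<in> set (b # bs)" "c' \<in> set (b # bs)" for c c' d
        proof (rule induced_commute)
          show "c ` c' ` x = c' ` c ` x" for x
            using comm[OF that(2,1)] by (simp add: image_image)
        qed
        have 3: "boundary\<^sub>S (induced (image c) d) = induced (image c) (boundary\<^sub>S d)" if "c \<in> set (b # bs)" for c d
          by (rule boundary_image[OF injb[OF that] act(2)[OF that]])
        show ?thesis
          using 1 2 3 by (simp add: commuting_ops_def boundary_boundary_set)
      qed
      show "chain_on Y (boundary\<^sub>S c)" if "chain_on Y c" for c
        by (rule chain_on_boundary[OF that Cons.prems(3)])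
      show "chain_on ?Y (boundary\<^sub>S c)" if "chain_on ?Y c" for c
        by (rule chain_on_boundary[OF that YT'])
      show "chain_on Y (t c)" if "t \<in> set ?ts" "chain_on Y c" for t c
        using that Cons.prems(5) unfolding induced_def by (auto intro!: chain_on_frag_extend)
      show "chain_on ?Y (t c)" if "t \<in> set ?ts" "chain_on ?Y c" for t c
        using that(1) Yb' unfolding induced_def by (auto intro!: chain_on_frag_extend[OF that(2)])
      show "b ` S \<in> Y" if "S \<in> Y" for S using Cons.prems(5) that by simp
      show "chain_on ?Y (frag_of {})" using Cons.prems(6) by simp
      show "divisible p (total_boundary p boundary\<^sub>S (induced (image b) # ?ts) F \<alpha> - origin_family (frag_of {}) \<alpha>)"
        if "length \<alpha> = Suc (length ?ts)" for \<alpha>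
        using Cons.prems(1)[of \<alpha>] that by simp
    qed (fact Cons.prems(8), fact Cons.prems(9))
  qed
qed

section \<open>From continuous maps to chain maps\<close>

definition drop_nth :: "nat \<Rightarrow> 'v list \<Rightarrow> 'v list" where
  "drop_nth i l = take i l @ drop (Suc i) l"

lemma length_drop_nth: "i < length l \<Longrightarrow> length (drop_nth i l) = length l - 1"
  by (auto simp: drop_nth_def)

lemma nth_drop_nth: "i < length l \<Longrightarrow> j < length l - 1 \<Longrightarrow> drop_nth i l ! j = (if j < i then l ! j else l ! Suc j)"
  by (auto simp: drop_nth_def nth_append)

lemma set_drop_nth: "set (drop_nth i l) \<subseteq> set l"
  by (auto simp: drop_nth_def dest: in_set_takeD in_set_dropD)

lemma list_boundary_sum:
  "list_boundary l = (\<Sum>i<length l. frag_cmul ((-1) ^ i) (frag_of (drop_nth i l)))"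
proof (induction l)
  case (Cons a l)
  have "induced ((#) a) (list_boundary l)
      = (\<Sum>i<length l. frag_cmul ((-1) ^ i) (frag_of (a # drop_nth i l)))"
    by (simp add: Cons additive.sum[OF additive_induced] additive_frag_cmul)
  then show ?case
    by (simp add: sum.lessThan_Suc_shift drop_nth_def sum_negf del: sum.lessThan_Suc)
       (simp add: flip: sum_negf)
qed simp

text \<open>The affine simplex spanned by a list of vertices of a complex, in barycentric coordinates.\<close>
definition affine_simplex :: "'v list \<Rightarrow> (nat \<Rightarrow> real) \<Rightarrow> 'v \<Rightarrow> real" where
  "affine_simplex l = oriented_simplex (length l - 1) (\<lambda>j v. if v = l ! j then 1 else 0)"

lemma affine_simplex_face:
  assumes "length l = Suc q" "1 \<le> q" "k \<le> q"
  shows "singular_face q k (affine_simplex l) = affine_simplex (drop_nth k l)"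
proof -
  have "length (drop_nth k l) - 1 = q - 1" using assms by (simp add: length_drop_nth)
  then show ?thesis
    using assms unfolding affine_simplex_def
    by (simp add: singular_face_oriented_simplex oriented_simplex_eq nth_drop_nth)
qed

lemma singular_simplex_affine_simplex:
  assumes "l \<noteq> []" "set l \<in> K" "\<And>A B. A \<in> K \<Longrightarrow> B \<subseteq> A \<Longrightarrow> B \<in> K"
  shows "singular_simplex (length l - 1) (realization K) (affine_simplex l)"
  unfolding realization_def affine_simplex_def
proof (intro simplicial_imp_singular_simplex simplicial_simplex_oriented_simplex[THEN iffD2] image_subsetI)
  let ?q = "length l - 1"
  have nth: "l ! j \<in> set l" if "j \<le> ?q" for j
    by (rule nth_mem) (use assms(1) that in \<open>cases l; simp\<close>)
  fix x assume x: "x \<in> standard_simplex ?q"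
  let ?y = "\<lambda>v. \<Sum>j\<le>?q. (if v = l ! j then 1 else 0) * x j"
  have x0: "0 \<le> x i" and x1: "(\<Sum>i\<le>?q. x i) = 1" for i
    using x by (auto simp: standard_simplex_def)
  have y0: "0 \<le> ?y v" for v by (intro sum_nonneg) (auto simp: x0)
  have sub: "support ?y \<subseteq> set l"
  proof
    fix v assume "v \<in> support ?y"
    then obtain j where "j \<le> ?q" "v = l ! j"
      by (auto simp: support_def elim!: sum.not_neutral_contains_not_neutral split: if_splits)
    then show "v \<in> set l" using nth by simp
  qed
  have "(\<Sum>v\<in>support ?y. ?y v) = (\<Sum>v\<in>set l. ?y v)"
    by (rule sum.mono_neutral_left) (use sub in \<open>auto simp: support_def\<close>)
  also have "\<dots> = (\<Sum>j\<le>?q. \<Sum>v\<in>set l. (if v = l ! j then 1 else 0) * x j)"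
    by (rule sum.swap)
  also have "\<dots> = (\<Sum>j\<le>?q. x j)"
  proof (rule sum.cong)
    fix j assume "j \<in> {..?q}"
    then have "l ! j \<in> set l" using nth by simp
    then show "(\<Sum>v\<in>set l. (if v = l ! j then 1 else 0) * x j) = x j"
      by (simp add: if_distrib[of "\<lambda>a. a * x j"] cong: if_cong)
  qed simp
  finally have "(\<Sum>v\<in>support ?y. ?y v) = 1" using x1 by simp
  then show "?y \<in> {x. (\<forall>v. 0 \<le> x v) \<and> finite (support x) \<and> support x \<in> K \<and> (\<Sum>v\<in>support x. x v) = 1}"
    using y0 sub assms(2,3) by (auto intro: finite_subset)
qed

lemma chain_boundary_affine_simplex:
  assumes "length l = Suc q" "1 \<le> q"
  shows "chain_boundary q (frag_of (affine_simplex l)) = induced affine_simplex (list_boundary l)"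
  using assms
  by (simp add: chain_boundary_of list_boundary_sum additive.sum[OF additive_induced]
      additive_frag_cmul affine_simplex_face lessThan_Suc_atMost)

definition vertex_labels :: "('x \<Rightarrow> 'w) \<Rightarrow> nat \<Rightarrow> ((nat \<Rightarrow> real) \<Rightarrow> 'x) \<Rightarrow> 'w list" where
  "vertex_labels lab q \<sigma> = map (\<lambda>i. lab (\<sigma> (\<lambda>j. if j = i then 1 else 0))) [0..<Suc q]"

lemma length_vertex_labels [simp]: "length (vertex_labels lab q \<sigma>) = Suc q"
  by (simp add: vertex_labels_def)

lemma vertex_labels_face:
  assumes "1 \<le> q" "k \<le> q"
  shows "vertex_labels lab (q - 1) (singular_face q k \<sigma>) = drop_nth k (vertex_labels lab q \<sigma>)"
proof (rule nth_equalityI)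
  fix i assume "i < length (vertex_labels lab (q - 1) (singular_face q k \<sigma>))"
  then have i: "i \<le> q - 1" by simp
  have "simplical_face k (\<lambda>j. if j = i then 1 else 0 :: real)
      = (\<lambda>j. if j = (if i < k then i else Suc i) then 1 else 0)"
    by (auto simp: simplical_face_def fun_eq_iff)
  then have "singular_face q k \<sigma> (\<lambda>j. if j = i then 1 else 0)
      = \<sigma> (\<lambda>j. if j = (if i < k then i else Suc i) then 1 else 0)"
    using i by (simp add: singular_face_def)
  then show "vertex_labels lab (q - 1) (singular_face q k \<sigma>) ! i = drop_nth k (vertex_labels lab q \<sigma>) ! i"
    using i assms by (auto simp: nth_drop_nth vertex_labels_def simp del: upt_Suc)
qed (use assms in \<open>simp add: length_drop_nth\<close>)

definition label_chain :: "('x \<Rightarrow> 'a \<times> nat) \<Rightarrow> nat \<Rightarrow> 'x chain \<Rightarrow> ('a \<times> nat) set \<Rightarrow>\<^sub>0 int" where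
  "label_chain lab q = frag_extend (\<lambda>\<sigma>. orient (vertex_labels lab q \<sigma>))"

lemma boundary_label_chain:
  assumes "1 \<le> q" "\<And>\<sigma>. \<sigma> \<in> Poly_Mapping.keys c \<Longrightarrow> inj_on snd (set (vertex_labels lab q \<sigma>))"
  shows "boundary\<^sub>S (label_chain lab q c) = label_chain lab (q - 1) (chain_boundary q c)"
proof (rule additive_eqI[of "\<lambda>c. boundary\<^sub>S (label_chain lab q c)" "\<lambda>c. label_chain lab (q - 1) (chain_boundary q c)"])
  fix \<sigma> assume "\<sigma> \<in> Poly_Mapping.keys c"
  then show "boundary\<^sub>S (label_chain lab q (frag_of \<sigma>)) = label_chain lab (q - 1) (chain_boundary q (frag_of \<sigma>))"
    using assms vertex_labels_face[of q _ lab \<sigma>]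
    by (simp add: label_chain_def boundary_orient list_boundary_sum chain_boundary_of frag_extend_sum
        frag_extend_cmul comp_def lessThan_Suc_atMost)
qed (auto simp: label_chain_def Modules.additive_def frag_extend_add chain_boundary_add)

text \<open>A labelling that intertwines two actions induces an equivariant map of chains.\<close>
lemma label_chain_map:
  assumes "singular_chain q X c" "inj b" "\<And>w. snd (b w) = snd w"
    and "\<And>x. x \<in> topspace X \<Longrightarrow> lab (T x) = b (lab x)"
  shows "label_chain lab q (chain_map q T c) = induced (image b) (label_chain lab q c)"
proof (rule additive_eqI[of "\<lambda>c. label_chain lab q (chain_map q T c)" "\<lambda>c. induced (image b) (label_chain lab q c)"])
  fix \<sigma> assume "\<sigma> \<in> Poly_Mapping.keys c"
  then have "singular_simplex q X \<sigma>" using assms(1) by (auto simp: singular_chain_def)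
  then have "\<sigma> (\<lambda>j. if j = i then 1 else 0) \<in> topspace X" if "i \<le> q" for i
    using that by (auto simp: singular_simplex_def continuous_map_def)
  then have "vertex_labels lab q (simplex_map q T \<sigma>) = map b (vertex_labels lab q \<sigma>)"
    using assms(4) by (auto simp: vertex_labels_def simplex_map_def simp del: upt_Suc)
  then show "label_chain lab q (chain_map q T (frag_of \<sigma>)) = induced (image b) (label_chain lab q (frag_of \<sigma>))"
    by (simp add: label_chain_def orient_map[OF assms(2,3)])
qed (auto simp: label_chain_def Modules.additive_def frag_extend_add chain_map_add additive.add[OF additive_induced])

abbreviation sd_power :: "nat \<Rightarrow> nat \<Rightarrow> 'x chain \<Rightarrow> 'x chain" where
  "sd_power N q \<equiv> singular_subdivision q ^^ N"

lemma additive_sd_power: "Modules.additive (sd_power N q)"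
  by (rule additive_funpow) (simp add: Modules.additive_def singular_subdivision_add)

lemma singular_chain_sd_power: "singular_chain q X c \<Longrightarrow> singular_chain q X (sd_power N q c)"
  by (induction N) (auto intro: singular_chain_singular_subdivision)

lemma sd_power_chain_map:
  "singular_chain q X c \<Longrightarrow> sd_power N q (chain_map q T c) = chain_map q T (sd_power N q c)"
proof (induction N)
  case (Suc N)
  then show ?case
    using naturality_singular_subdivision[OF singular_chain_sd_power[OF Suc.prems]] by simp
qed simp

lemma chain_boundary_sd_power:
  "singular_chain q X c \<Longrightarrow> chain_boundary q (sd_power N q c) = sd_power N (q - 1) (chain_boundary q c)"
proof (induction N)
  case (Suc N)
  then show ?case
    using chain_boundary_singular_subdivision[OF singular_chain_sd_power[OF Suc.prems]] by simp
qed simp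

lemma sd_power_zero: "singular_chain 0 X c \<Longrightarrow> sd_power N 0 c = c"
  by (induction N) (auto simp: singular_subdivision_zero)

text \<open>A simplicial approximation at the level of chains: subdivide \<open>N\<close> times, then replace each small
singular simplex by the oriented simplex of the labels of its vertices.  The empty list has to be
treated separately, since singular chains are not augmented.\<close>
definition chain_approx :: "(('v \<Rightarrow> real) \<Rightarrow> 'a \<times> nat) \<Rightarrow> nat \<Rightarrow> 'v list \<Rightarrow> ('a \<times> nat) set \<Rightarrow>\<^sub>0 int" where
  "chain_approx lab N l = (if l = [] then frag_of {}
     else label_chain lab (length l - 1) (sd_power N (length l - 1) (frag_of (affine_simplex l))))"

lemma label_chain_approx:
  assumes "\<And>l. l \<in> Poly_Mapping.keys c \<Longrightarrow> length l = Suc q"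
  shows "label_chain lab q (sd_power N q (induced affine_simplex c)) = frag_extend (chain_approx lab N) c"
proof (rule additive_eqI[of "\<lambda>c. label_chain lab q (sd_power N q (induced affine_simplex c))"])
  fix l assume "l \<in> Poly_Mapping.keys c"
  then have "length l = Suc q" by (rule assms)
  then have "l \<noteq> []" "length l - 1 = q" by auto
  then show "label_chain lab q (sd_power N q (induced affine_simplex (frag_of l)))
      = frag_extend (chain_approx lab N) (frag_of l)"
    by (simp add: chain_approx_def)
qed (auto simp: Modules.additive_def label_chain_def frag_extend_add
      additive.add[OF additive_sd_power] additive.add[OF additive_induced])

lemma keys_list_boundary: "l' \<in> Poly_Mapping.keys (list_boundary l) \<Longrightarrow> Suc (length l') = length l \<and> set l' \<subseteq> set l"
proof -
  assume "l' \<in> Poly_Mapping.keys (list_boundary l)"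
  then obtain i where "i < length l" "l' = drop_nth i l"
    unfolding list_boundary_sum by (auto dest!: subsetD[OF keys_sum] split: if_splits)
  then show ?thesis using set_drop_nth[of i l] by (auto simp: length_drop_nth)
qed

text \<open>The labels of a small simplex may repeat, but labels in the same block must agree; this is the only
condition under which orienting labels commutes with boundaries.\<close>
lemma boundary_chain_approx:
  assumes K: "set l \<in> K" "\<And>A B. A \<in> K \<Longrightarrow> B \<subseteq> A \<Longrightarrow> B \<in> K"
    and small: "\<And>\<sigma>. l \<noteq> [] \<Longrightarrow> \<sigma> \<in> Poly_Mapping.keys (sd_power N (length l - 1) (frag_of (affine_simplex l)))
       \<Longrightarrow> inj_on snd (set (vertex_labels lab (length l - 1) \<sigma>))"
  shows "boundary\<^sub>S (chain_approx lab N l) = frag_extend (chain_approx lab N) (list_boundary l)"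
proof (cases l)
  case Nil
  then show ?thesis by (simp add: chain_approx_def set_boundary_def)
next
  case (Cons a l')
  have sing: "singular_chain (length l - 1) (realization K) (frag_of (affine_simplex l))"
    using singular_simplex_affine_simplex[of l K] K Cons by (simp add: singular_chain_of)
  show ?thesis
  proof (cases l')
    case Nil
    then have l: "l = [a]" by (simp add: Cons)
    have "chain_approx lab N l = orient (vertex_labels lab 0 (affine_simplex l))"
      using sing by (simp add: chain_approx_def l sd_power_zero label_chain_def)
    moreover obtain w where "vertex_labels lab 0 (affine_simplex l) = [w]"
      by (simp add: vertex_labels_def)
    ultimately have "boundary\<^sub>S (chain_approx lab N l) = frag_of {}"
      using boundary_orient[of "[w]"] by (simp add: additive_zero[OF additive_induced])
    then show ?thesis
      by (simp add: l chain_approx_def additive_zero[OF additive_induced])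
  next
    case (Cons a' l'')
    define q where "q = length l - 1"
    have q: "length l = Suc q" "1 \<le> q" using \<open>l = a # l'\<close> Cons by (auto simp: q_def)
    have "boundary\<^sub>S (chain_approx lab N l)
        = label_chain lab (q - 1) (chain_boundary q (sd_power N q (frag_of (affine_simplex l))))"
      using boundary_label_chain[OF q(2), of "sd_power N q (frag_of (affine_simplex l))" lab] small q
      by (auto simp: chain_approx_def)
    also have "chain_boundary q (sd_power N q (frag_of (affine_simplex l)))
        = sd_power N (q - 1) (induced affine_simplex (list_boundary l))"
      using sing q by (simp add: chain_boundary_sd_power chain_boundary_affine_simplex)
    also have "label_chain lab (q - 1) \<dots> = frag_extend (chain_approx lab N) (list_boundary l)"
      by (rule label_chain_approx) (use q keys_list_boundary in force)
    finally show ?thesis .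
  qed
qed

lemma chain_approx_map:
  assumes K: "set l \<in> K" "\<And>A B. A \<in> K \<Longrightarrow> B \<subseteq> A \<Longrightarrow> B \<in> K"
    and c: "inj c" "\<And>w. snd (c w) = snd w"
    and T: "\<And>x. l \<noteq> [] \<Longrightarrow> x \<in> standard_simplex (length l - 1) \<Longrightarrow>
              affine_simplex (map b l) x = T (affine_simplex l x)"
    and lab: "\<And>x. x \<in> topspace (realization K) \<Longrightarrow> lab (T x) = c (lab x)"
  shows "chain_approx lab N (map b l) = induced (image c) (chain_approx lab N l)"
proof (cases "l = []")
  case False
  let ?q = "length l - 1"
  have sing: "singular_chain ?q (realization K) (frag_of (affine_simplex l))"
    using singular_simplex_affine_simplex[of l K] K False by (simp add: singular_chain_of)
  have "affine_simplex (map b l) = simplex_map ?q T (affine_simplex l)"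
  proof
    fix x
    show "affine_simplex (map b l) x = simplex_map ?q T (affine_simplex l) x"
      using T[OF False, of x]
      by (cases "x \<in> standard_simplex ?q")
         (simp_all add: simplex_map_def, simp add: affine_simplex_def oriented_simplex_def)
  qed
  then have "frag_of (affine_simplex (map b l)) = chain_map ?q T (frag_of (affine_simplex l))"
    by (simp only: chain_map_of)
  then have "chain_approx lab N (map b l)
      = label_chain lab ?q (sd_power N ?q (chain_map ?q T (frag_of (affine_simplex l))))"
    using False by (simp only: chain_approx_def length_map map_is_Nil_conv if_False)
  also have "\<dots> = label_chain lab ?q (chain_map ?q T (sd_power N ?q (frag_of (affine_simplex l))))"
    by (simp only: sd_power_chain_map[OF sing])
  also have "\<dots> = induced (image c) (chain_approx lab N l)"
    using False
    by (simp only: chain_approx_def if_False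
        label_chain_map[where lab = lab and T = T and b = c, OF singular_chain_sd_power[OF sing] c lab])
  finally show ?thesis .
qed (simp add: chain_approx_def)

text \<open>The labelling \<open>lab\<close> stands for the equivariant map to a complex with \<open>n\<close> blocks and vertex set \<open>W\<close>.
After enough subdivisions all simplices are small for the finitely many ordered simplices in question,
and the family from \<open>resolution_in_joins\<close> is carried to a family of oriented chains.  In degree \<open>n\<close>
and above it vanishes because \<open>n + 1\<close> labels cannot lie in different blocks.\<close>
lemma no_equivariant_map_to_small_join:
  fixes b :: "'g \<Rightarrow> 'v \<Rightarrow> 'v" and c :: "'g \<Rightarrow> 'a \<times> nat \<Rightarrow> 'a \<times> nat" and lab :: "('v \<Rightarrow> real) \<Rightarrow> 'a \<times> nat"
  assumes prime: "prime p"
    and K: "finite K" "\<And>A. A \<in> K \<Longrightarrow> finite A" "\<And>A B. A \<in> K \<Longrightarrow> B \<subseteq> A \<Longrightarrow> B \<in> K"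
    and b: "\<And>g v. g \<in> set gs \<Longrightarrow> (b g ^^ p) v = v"
      "\<And>g h v. g \<in> set gs \<Longrightarrow> h \<in> set gs \<Longrightarrow> b h (b g v) = b g (b h v)"
      "\<And>g A. g \<in> set gs \<Longrightarrow> A \<in> K \<Longrightarrow> b g ` A \<in> K"
    and T: "\<And>g l x. g \<in> set gs \<Longrightarrow> set l \<in> K \<Longrightarrow> l \<noteq> [] \<Longrightarrow> x \<in> standard_simplex (length l - 1) \<Longrightarrow>
              affine_simplex (map (b g) l) x = T g (affine_simplex l x)"
    and c: "\<And>g w. g \<in> set gs \<Longrightarrow> (c g ^^ p) w = w" "\<And>g w. g \<in> set gs \<Longrightarrow> snd (c g w) = snd w"
      "\<And>g h w. g \<in> set gs \<Longrightarrow> h \<in> set gs \<Longrightarrow> c h (c g w) = c g (c h w)"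
      "\<And>g w. g \<in> set gs \<Longrightarrow> w \<in> W \<Longrightarrow> c g w \<in> W"
      "\<And>w. w \<in> W \<Longrightarrow> \<exists>g\<in>set gs. c g w \<noteq> w"
    and W: "snd ` W \<subseteq> {1..n}"
    and lab: "\<And>x. x \<in> topspace (realization K) \<Longrightarrow> lab x \<in> W"
      "\<And>g x. g \<in> set gs \<Longrightarrow> x \<in> topspace (realization K) \<Longrightarrow> lab (T g x) = c g (lab x)"
      "\<And>x. x \<in> topspace (realization K) \<Longrightarrow> \<exists>U. openin (realization K) U \<and> x \<in> U \<and> inj_on snd (lab ` U)"
    and L: "[] \<in> L 0" "\<And>k l. k \<le> n \<Longrightarrow> l \<in> L k \<Longrightarrow> a k # l \<in> L (Suc k)"
      "\<And>k l g. g \<in> set gs \<Longrightarrow> l \<in> L k \<Longrightarrow> map (b g) l \<in> L k"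
      "\<And>k l. l \<in> L k \<Longrightarrow> length l = k \<and> set l \<in> K"
  shows False
proof -
  define \<L> where "\<L> = {l. length l \<le> Suc n \<and> set l \<in> K}"
  have fin: "finite \<L>"
  proof (rule finite_subset)
    show "\<L> \<subseteq> {l. set l \<subseteq> \<Union>K \<and> length l \<le> Suc n}" by (auto simp: \<L>_def)
    show "finite {l. set l \<subseteq> \<Union>K \<and> length l \<le> Suc n}"
      by (rule finite_lists_length_le) (use K in auto)
  qed
  \<comment> \<open>Simplices that are small for this cover have consistent labels.\<close>
  define C where "C = {U. openin (realization K) U \<and> inj_on snd (lab ` U)}"
  have small_ex: "\<exists>N. \<forall>N'\<ge>N. \<forall>\<sigma>\<in>Poly_Mapping.keys (sd_power N' (length l - 1) (frag_of (affine_simplex l))).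
      inj_on snd (set (vertex_labels lab (length l - 1) \<sigma>))" if "l \<in> \<L>" "l \<noteq> []" for l
  proof -
    let ?q = "length l - 1"
    have "singular_chain ?q (realization K) (frag_of (affine_simplex l))"
      using singular_simplex_affine_simplex[of l K] K that by (simp add: singular_chain_of \<L>_def)
    moreover have "openin (realization K) U" if "U \<in> C" for U using that by (simp add: C_def)
    moreover have "topspace (realization K) \<subseteq> \<Union>C" using lab(3) by (fastforce simp: C_def)
    ultimately obtain N where N: "\<And>N' \<sigma>. N \<le> N' \<Longrightarrow> \<sigma> \<in> Poly_Mapping.keys (sd_power N' ?q (frag_of (affine_simplex l)))
        \<Longrightarrow> \<exists>V\<in>C. \<sigma> \<in> standard_simplex ?q \<rightarrow> V"
      using sufficient_iterated_singular_subdivision_exists[of C "realization K" ?q] by metis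
    have "inj_on snd (set (vertex_labels lab ?q \<sigma>))"
      if \<sigma>: "N \<le> N'" "\<sigma> \<in> Poly_Mapping.keys (sd_power N' ?q (frag_of (affine_simplex l)))" for N' \<sigma>
    proof -
      obtain V where V: "V \<in> C" "\<sigma> \<in> standard_simplex ?q \<rightarrow> V" using N[OF \<sigma>] by blast
      then have "set (vertex_labels lab ?q \<sigma>) \<subseteq> lab ` V"
        by (auto simp: vertex_labels_def Pi_iff simp del: upt_Suc)
      then show ?thesis using V(1) by (auto simp: C_def intro: inj_on_subset)
    qed
    then show ?thesis by blast
  qed
  obtain N0 where N0: "\<And>l. l \<in> \<L> \<Longrightarrow> l \<noteq> [] \<Longrightarrow>
      \<forall>N'\<ge>N0 l. \<forall>\<sigma>\<in>Poly_Mapping.keys (sd_power N' (length l - 1) (frag_of (affine_simplex l))).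
        inj_on snd (set (vertex_labels lab (length l - 1) \<sigma>))"
    using small_ex by metis
  define N where "N = Max (insert 0 (N0 ` \<L>))"
  have small: "inj_on snd (set (vertex_labels lab (length l - 1) \<sigma>))"
    if "l \<in> \<L>" "l \<noteq> []" "\<sigma> \<in> Poly_Mapping.keys (sd_power N (length l - 1) (frag_of (affine_simplex l)))" for l \<sigma>
  proof -
    have "N0 l \<le> N" unfolding N_def by (rule Max_ge) (use that fin in auto)
    then show ?thesis using N0[OF that(1,2)] that(3) by blast
  qed
  define Y where "Y = {S. S \<subseteq> W \<and> inj_on snd S}"
  have approx_Y: "chain_on Y (chain_approx lab N l)" if "l \<in> \<L>" for l
  proof (cases "l = []")
    case False
    let ?q = "length l - 1"
    have sing: "singular_chain ?q (realization K) (sd_power N ?q (frag_of (affine_simplex l)))"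
      using singular_simplex_affine_simplex[of l K] K that False
      by (intro singular_chain_sd_power) (simp add: singular_chain_of \<L>_def)
    have "chain_on Y (orient (vertex_labels lab ?q \<sigma>))"
      if \<sigma>: "\<sigma> \<in> Poly_Mapping.keys (sd_power N ?q (frag_of (affine_simplex l)))" for \<sigma>
    proof (rule chain_on_mono[OF chain_on_orient])
      have "singular_simplex ?q (realization K) \<sigma>" using sing \<sigma> by (auto simp: singular_chain_def)
      then have "\<sigma> (\<lambda>j. if j = i then 1 else 0) \<in> topspace (realization K)" if "i \<le> ?q" for i
        using that by (auto simp: singular_simplex_def continuous_map_def)
      then have "set (vertex_labels lab ?q \<sigma>) \<subseteq> W"
        using lab(1) by (auto simp: vertex_labels_def simp del: upt_Suc)
      then show "{set (vertex_labels lab ?q \<sigma>)} \<subseteq> Y"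
        using small[OF \<open>l \<in> \<L>\<close> False \<sigma>] by (simp add: Y_def)
    qed
    then have "chain_on Y (label_chain lab ?q (sd_power N ?q (frag_of (affine_simplex l))))"
      unfolding label_chain_def
      by (rule chain_on_frag_extend[where Y = "Poly_Mapping.keys (sd_power N ?q (frag_of (affine_simplex l)))", rotated])
         (simp_all add: chain_on_def)
    then show ?thesis using False by (simp add: chain_approx_def)
  qed (simp add: chain_approx_def Y_def)
  have approx_zero: "chain_approx lab N l = 0" if l: "l \<in> \<L>" "length l = Suc n" for l
  proof -
    have "orient (vertex_labels lab n \<sigma>) = 0"
      if \<sigma>: "\<sigma> \<in> Poly_Mapping.keys (sd_power N n (frag_of (affine_simplex l)))" for \<sigma>
    proof (rule orient_not_distinct, rule notI)
      assume dist: "distinct (vertex_labels lab n \<sigma>)"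
      let ?S = "set (vertex_labels lab n \<sigma>)"
      have sing: "singular_chain n (realization K) (sd_power N n (frag_of (affine_simplex l)))"
        using singular_simplex_affine_simplex[of l K] K l
        by (intro singular_chain_sd_power) (cases l; simp add: singular_chain_of \<L>_def)
      have "singular_simplex n (realization K) \<sigma>" using sing \<sigma> by (auto simp: singular_chain_def)
      then have "\<sigma> (\<lambda>j. if j = i then 1 else 0) \<in> topspace (realization K)" if "i \<le> n" for i
        using that by (auto simp: singular_simplex_def continuous_map_def)
      then have "?S \<subseteq> W"
        using lab(1) by (auto simp: vertex_labels_def simp del: upt_Suc)
      then have "snd ` ?S \<subseteq> {1..n}" using W by auto
      then have "card (snd ` ?S) \<le> n" using card_mono[of "{1..n}" "snd ` ?S"] by simp
      moreover have "inj_on snd ?S" using small[of l \<sigma>] l \<sigma> by (cases l) auto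
      moreover have "card ?S = Suc n" using distinct_card[OF dist] by simp
      ultimately show False by (simp add: card_image)
    qed
    then show ?thesis using l by (auto simp: chain_approx_def label_chain_def intro!: frag_extend_eq_0)
  qed
  let ?ds = "map b gs" and ?cs = "map c gs"
  have bs: "\<forall>d\<in>set ?ds. (\<forall>x. (d ^^ p) x = x) \<and> (\<forall>d'\<in>set ?ds. \<forall>x. d' (d x) = d (d' x))"
    using b by auto
  obtain F where F: "\<And>\<alpha>. chain_on (L (Suc (sum_list \<alpha>))) (F \<alpha>)" "\<And>\<alpha>. Suc n \<le> sum_list \<alpha> \<Longrightarrow> F \<alpha> = 0"
    "\<And>\<alpha>. length \<alpha> = length ?ds \<Longrightarrow> sum_list \<alpha> < Suc n \<Longrightarrow>
       total_boundary p boundary\<^sub>L (map (\<lambda>b. induced (map b)) ?ds) F \<alpha> = origin_family (frag_of []) \<alpha>"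
  proof (rule resolution_in_joins[OF bs, of L "Suc n" a])
    show "map d l \<in> L k" if "d \<in> set ?ds" "l \<in> L k" for k l d using that L(3) by auto
  qed (use L in auto)
  have injc: "inj (c g)" if "g \<in> set gs" for g
  proof (rule injI)
    fix x y assume "c g x = c g y"
    moreover have "p = Suc (p - 1)" using prime_gt_0_nat[OF prime] by simp
    ultimately have "(c g ^^ p) x = (c g ^^ p) y" by (metis comp_apply funpow_Suc_right)
    then show "x = y" by (simp only: c(1)[OF that])
  qed
  have FL: "chain_on \<L> (F \<alpha>)" for \<alpha>
  proof (cases "sum_list \<alpha> \<le> n")
    case True
    then show ?thesis by (intro chain_on_mono[OF F(1)]) (use L(4) in \<open>force simp: \<L>_def\<close>)
  qed (simp add: F(2))
  define F' where "F' \<alpha> = frag_extend (chain_approx lab N) (F \<alpha>)" for \<alpha>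
  have F'n: "F' \<alpha> = 0" if "n \<le> sum_list \<alpha>" for \<alpha>
  proof (cases "sum_list \<alpha> = n")
    case True
    have "l \<in> \<L> \<and> length l = Suc n" if "l \<in> Poly_Mapping.keys (F \<alpha>)" for l
      using that FL[of \<alpha>] F(1)[of \<alpha>] L(4) True by (auto simp: chain_on_def)
    then show ?thesis unfolding F'_def by (intro frag_extend_eq_0) (use approx_zero in blast)
  qed (use that F(2) in \<open>simp add: F'_def\<close>)
  let ?ts' = "map (\<lambda>b. induced (image b)) ?cs"
  have add: "\<forall>t\<in>set ?ts'. Modules.additive t" by auto
  have total: "total_boundary p boundary\<^sub>S ?ts' F' \<alpha> = origin_family (frag_of {}) \<alpha>" if len: "length \<alpha> = length ?cs" for \<alpha>
  proof (cases "sum_list \<alpha> < Suc n")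
    case True
    let ?f = "frag_extend (chain_approx lab N)"
    have "total_boundary p boundary\<^sub>S ?ts' F' \<alpha> = ?f (total_boundary p boundary\<^sub>L (map (\<lambda>b. induced (map b)) ?ds) F \<alpha>)"
      unfolding F'_def
    proof (rule total_boundary_chain_map[where P = "chain_on \<L>"])
      show "?f (boundary\<^sub>L d) = boundary\<^sub>S (?f d)" if "chain_on \<L> d" for d
      proof (rule additive_eqI[of "\<lambda>d. ?f (boundary\<^sub>L d)" "\<lambda>d. boundary\<^sub>S (?f d)"])
        fix l assume "l \<in> Poly_Mapping.keys d"
        then have "l \<in> \<L>" using that by (auto simp: chain_on_def)
        then have "boundary\<^sub>S (chain_approx lab N l) = ?f (list_boundary l)"
          using boundary_chain_approx[of l K N lab] K(3) small by (auto simp: \<L>_def)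
        then show "?f (boundary\<^sub>L (frag_of l)) = boundary\<^sub>S (?f (frag_of l))" by simp
      qed (auto simp: Modules.additive_def frag_extend_add)
      have "chain_on \<L> (induced (map (b g)) d) \<and> ?f (induced (map (b g)) d) = induced (image (c g)) (?f d)"
        if g: "g \<in> set gs" and d: "chain_on \<L> d" for g d
      proof
        show "chain_on \<L> (induced (map (b g)) d)"
          unfolding induced_def by (rule chain_on_frag_extend[OF d]) (use b(3)[OF g] in \<open>auto simp: \<L>_def\<close>)
        show "?f (induced (map (b g)) d) = induced (image (c g)) (?f d)"
        proof (rule additive_eqI[of "\<lambda>d. ?f (induced (map (b g)) d)" "\<lambda>d. induced (image (c g)) (?f d)"])
          fix l assume "l \<in> Poly_Mapping.keys d"
          then have "l \<in> \<L>" using d by (auto simp: chain_on_def)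
          then have "chain_approx lab N (map (b g) l) = induced (image (c g)) (chain_approx lab N l)"
            using K(3) injc[OF g] c(2)[OF g] T[OF g] lab(2)[OF g]
            by (intro chain_approx_map[where K = K and T = "T g"]) (auto simp: \<L>_def)
          then show "?f (induced (map (b g)) (frag_of l)) = induced (image (c g)) (?f (frag_of l))" by simp
        qed (auto simp: Modules.additive_def frag_extend_add additive.add[OF additive_induced])
      qed
      then show "list_all2 (\<lambda>t t'. \<forall>d. chain_on \<L> d \<longrightarrow> chain_on \<L> (t d) \<and> ?f (t d) = t' (?f d))
          (map (\<lambda>b. induced (map b)) ?ds) ?ts'"
        by (auto simp: list_all2_map1 list_all2_map2 intro!: list.rel_refl_strong)
    qed (auto simp: FL)
    also have "\<dots> = ?f (origin_family (frag_of []) \<alpha>)" using F(3)[of \<alpha>] len True by simp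
    also have "\<dots> = origin_family (frag_of {}) \<alpha>" by (simp add: origin_family_def chain_approx_def)
    finally show ?thesis .
  next
    case False
    have "sum_list \<alpha> = 0" if "set \<alpha> \<subseteq> {0}" using that by (auto simp: sum_list_eq_0_iff)
    with False have "\<not> set \<alpha> \<subseteq> {0}" by (metis zero_less_Suc)
    moreover have "total_boundary p boundary\<^sub>S ?ts' F' \<alpha> = 0"
      by (rule total_boundary_vanish) (use False F'n in auto)
    ultimately show ?thesis by (simp add: origin_family_def)
  qed
  have "\<exists>\<alpha>. length \<alpha> = length ?cs \<and>
      \<not> divisible p (total_boundary p boundary\<^sub>S ?ts' F' \<alpha> - origin_family (frag_of {}) \<alpha>)"
  proof (rule no_bounded_resolution[OF prime, of ?cs Y])
    show "S = {}" if S: "S \<in> Y" and fixed: "\<And>d. d \<in> set ?cs \<Longrightarrow> d ` S = S" for S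
    proof (rule ccontr)
      assume "S \<noteq> {}"
      then obtain w where w: "w \<in> S" "w \<in> W" using S by (auto simp: Y_def)
      then obtain g where g: "g \<in> set gs" "c g w \<noteq> w" using c(5) by blast
      then have "c g w \<in> S" using fixed[of "c g"] w by auto
      then show False using S w c(2)[OF g(1), of w] g(2) by (auto simp: Y_def dest: inj_onD)
    qed
    show "d ` S \<in> Y" if "d \<in> set ?cs" "S \<in> Y" for d S
    proof -
      obtain g where g: "g \<in> set gs" "d = c g" using \<open>d \<in> set ?cs\<close> by auto
      then show ?thesis
        using that(2) c(4)[OF g(1)] inj_on_snd_image[of "c g" S, OF c(2)[OF g(1)] injc[OF g(1)]]
        by (auto simp: Y_def)
    qed
    show "\<forall>d\<in>set ?cs. (\<forall>x. (d ^^ p) x = x) \<and> (\<forall>x. snd (d x) = snd x)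
        \<and> (\<forall>d'\<in>set ?cs. \<forall>x. d' (d x) = d (d' x))"
      using c(1-3) by auto
    show "chain_on Y (F' \<alpha>)" for \<alpha>
      unfolding F'_def by (rule chain_on_frag_extend[OF FL approx_Y])
    show "F' \<alpha> = 0" if "n \<le> sum_list \<alpha>" for \<alpha> by (rule F'n[OF that])
  qed (auto simp: Y_def intro: inj_on_subset)
  then show False using total by auto
qed

section \<open>Sums over hyperplanes\<close>

definition residues_mod :: "nat \<Rightarrow> int set" where
  "residues_mod p = {0..<int p}"

definition coeff_vectors :: "nat \<Rightarrow> nat \<Rightarrow> (nat \<Rightarrow> int) set" where
  "coeff_vectors p k = PiE {..<k} (\<lambda>_. residues_mod p)"

definition pairing :: "nat \<Rightarrow> nat \<Rightarrow> (nat \<Rightarrow> int) \<Rightarrow> (nat \<Rightarrow> int) \<Rightarrow> int" where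
  "pairing p k \<mu> \<nu> = (\<Sum>s<k. \<mu> s * \<nu> s) mod int p"

definition hyperplane_sum :: "nat \<Rightarrow> nat \<Rightarrow> (nat \<Rightarrow> int) \<Rightarrow> ((nat \<Rightarrow> int) \<Rightarrow> real) \<Rightarrow> int \<Rightarrow> real" where
  "hyperplane_sum p k \<mu> t a = (\<Sum>\<nu> | \<nu> \<in> coeff_vectors p k \<and> pairing p k \<mu> \<nu> = a. t \<nu>)"

definition nonzero_vectors :: "nat \<Rightarrow> nat \<Rightarrow> (nat \<Rightarrow> int) set" where
  "nonzero_vectors p k = {\<mu>\<in>coeff_vectors p k. \<exists>s<k. \<mu> s \<noteq> 0}"

lemma finite_residues_mod [simp]: "finite (residues_mod p)" "card (residues_mod p) = p"
  by (simp_all add: residues_mod_def)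

lemma finite_coeff_vectors [simp]: "finite (coeff_vectors p k)"
  by (simp add: coeff_vectors_def finite_PiE)

lemma card_coeff_vectors: "card (coeff_vectors p k) = p ^ k"
  by (simp add: coeff_vectors_def card_PiE)

lemma card_nonzero_vectors: "0 < p \<Longrightarrow> card (nonzero_vectors p k) = p ^ k - 1"
proof -
  assume "0 < p"
  define z where "z = (\<lambda>s\<in>{..<k}. 0 :: int)"
  have "z \<in> coeff_vectors p k" using \<open>0 < p\<close> by (auto simp: z_def coeff_vectors_def residues_mod_def)
  moreover have "nonzero_vectors p k = coeff_vectors p k - {z}"
    by (auto simp: nonzero_vectors_def z_def coeff_vectors_def PiE_iff extensional_def fun_eq_iff)
  ultimately show ?thesis by (simp add: card_coeff_vectors)
qed

lemma pairing_in: "0 < p \<Longrightarrow> pairing p k \<mu> \<nu> \<in> residues_mod p"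
  by (simp add: pairing_def residues_mod_def)

lemma unique_root:
  assumes "prime p" "\<not> int p dvd d"
  shows "\<exists>!x. x \<in> residues_mod p \<and> (x * d + e) mod int p = 0"
proof -
  have p0: "0 < int p" using assms(1) prime_gt_0_nat by simp
  have "coprime d (int p)"
    using assms by (metis coprime_commute prime_imp_coprime prime_nat_int_transfer)
  then obtain i where i: "[d * i = 1] (mod int p)"
    using cong_solve_coprime_int by blast
  show ?thesis
  proof (intro ex1I[of _ "(- e * i) mod int p"] conjI)
    show "(- e * i) mod int p \<in> residues_mod p" using p0 by (simp add: residues_mod_def)
    have "[(- e * i) mod int p * d + e = - e * i * d + e] (mod int p)"
      by (intro cong_add cong_mult cong_refl) (simp add: cong_def)
    also have "- e * i * d = - e * (d * i)" by (simp add: ac_simps)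
    also have "[- e * (d * i) + e = - e * 1 + e] (mod int p)"
      using i by (intro cong_add cong_mult cong_refl)
    finally show "((- e * i) mod int p * d + e) mod int p = 0" by (simp add: cong_def)
    fix x assume x: "x \<in> residues_mod p \<and> (x * d + e) mod int p = 0"
    have "[x = x * (d * i)] (mod int p)"
      using cong_mult[OF cong_refl[of x] cong_sym[OF i]] by simp
    also have "x * (d * i) = (x * d + e) * i + (- e * i)" by (simp add: algebra_simps)
    also have "[(x * d + e) * i + (- e * i) = 0 * i + (- e * i)] (mod int p)"
      using x by (intro cong_add cong_mult cong_refl) (simp add: cong_def)
    finally have "[x = - e * i] (mod int p)" by simp
    then show "x = (- e * i) mod int p" using x by (simp add: cong_def residues_mod_def)
  qed
qed

text \<open>The coordinate \<open>\<mu> s\<close> is determined by the others because \<open>d s\<close> is invertible modulo \<open>p\<close>.\<close>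
lemma card_annihilator:
  assumes "prime p" "s < k" "\<not> int p dvd d s"
  shows "card {\<mu>\<in>coeff_vectors p k. (\<Sum>s<k. \<mu> s * d s) mod int p = 0} = p ^ (k - 1)"
proof -
  let ?I = "{..<k} - {s}"
  have split: "(\<Sum>i<k. \<mu> i * d i) = \<mu> s * d s + (\<Sum>i\<in>?I. \<mu> i * d i)" for \<mu>
    using assms(2) by (simp add: sum.remove)
  have "bij_betw (\<lambda>\<mu>. restrict \<mu> ?I) {\<mu>\<in>coeff_vectors p k. (\<Sum>s<k. \<mu> s * d s) mod int p = 0}
          (PiE ?I (\<lambda>_. residues_mod p))"
    unfolding bij_betw_def
  proof (intro conjI equalityI)
    show "inj_on (\<lambda>\<mu>. restrict \<mu> ?I) {\<mu>\<in>coeff_vectors p k. (\<Sum>s<k. \<mu> s * d s) mod int p = 0}"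
    proof (rule inj_onI)
      fix \<mu> \<nu> assume "\<mu> \<in> {\<mu>\<in>coeff_vectors p k. (\<Sum>s<k. \<mu> s * d s) mod int p = 0}"
        "\<nu> \<in> {\<mu>\<in>coeff_vectors p k. (\<Sum>s<k. \<mu> s * d s) mod int p = 0}"
        and eq: "restrict \<mu> ?I = restrict \<nu> ?I"
      then have m: "\<mu> \<in> coeff_vectors p k" "\<nu> \<in> coeff_vectors p k"
        and 0: "(\<Sum>s<k. \<mu> s * d s) mod int p = 0" "(\<Sum>s<k. \<nu> s * d s) mod int p = 0"
        by auto
      have I: "\<mu> i = \<nu> i" if "i \<in> ?I" for i using eq that by (metis restrict_apply')
      then have "(\<Sum>i\<in>?I. \<mu> i * d i) = (\<Sum>i\<in>?I. \<nu> i * d i)" by (intro sum.cong) auto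
      moreover have "\<mu> s \<in> residues_mod p" "\<nu> s \<in> residues_mod p"
        using m assms(2) by (auto simp: coeff_vectors_def)
      ultimately have "\<mu> s = \<nu> s" using 0 unique_root[OF assms(1,3)] unfolding split by metis
      then show "\<mu> = \<nu>" using I m by (intro PiE_ext) (auto simp: coeff_vectors_def)
    qed
    show "(\<lambda>\<mu>. restrict \<mu> ?I) ` {\<mu>\<in>coeff_vectors p k. (\<Sum>s<k. \<mu> s * d s) mod int p = 0}
        \<subseteq> PiE ?I (\<lambda>_. residues_mod p)"
      by (intro image_subsetI) (auto simp: coeff_vectors_def PiE_iff)
    show "PiE ?I (\<lambda>_. residues_mod p)
        \<subseteq> (\<lambda>\<mu>. restrict \<mu> ?I) ` {\<mu>\<in>coeff_vectors p k. (\<Sum>s<k. \<mu> s * d s) mod int p = 0}"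
    proof
      fix \<nu> assume \<nu>: "\<nu> \<in> PiE ?I (\<lambda>_. residues_mod p)"
      obtain x where x: "x \<in> residues_mod p" "(x * d s + (\<Sum>i\<in>?I. \<nu> i * d i)) mod int p = 0"
        using ex1_implies_ex[OF unique_root[OF assms(1,3), of "\<Sum>i\<in>?I. \<nu> i * d i"]] by auto
      have "(\<Sum>i\<in>?I. (\<nu>(s := x)) i * d i) = (\<Sum>i\<in>?I. \<nu> i * d i)" by (intro sum.cong) auto
      then have "\<nu>(s := x) \<in> {\<mu>\<in>coeff_vectors p k. (\<Sum>s<k. \<mu> s * d s) mod int p = 0}"
        using x \<nu> assms(2) unfolding split by (auto simp: coeff_vectors_def PiE_iff extensional_def)
      moreover have "\<nu> = restrict (\<nu>(s := x)) ?I"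
        using \<nu> by (auto simp: fun_eq_iff PiE_iff extensional_def)
      ultimately show "\<nu> \<in> (\<lambda>\<mu>. restrict \<mu> ?I) ` {\<mu>\<in>coeff_vectors p k. (\<Sum>s<k. \<mu> s * d s) mod int p = 0}"
        by (intro image_eqI[where x = "\<nu>(s := x)"])
    qed
  qed
  then have "card {\<mu>\<in>coeff_vectors p k. (\<Sum>s<k. \<mu> s * d s) mod int p = 0} = card (PiE ?I (\<lambda>_. residues_mod p))"
    by (rule bij_betw_same_card)
  then show ?thesis using assms(2) by (simp add: card_PiE)
qed

text \<open>Summing over all forms \<open>\<mu>\<close> the sum of \<open>t\<close> over the hyperplane of \<open>\<mu>\<close> through \<open>\<nu>\<close> counts \<open>t \<nu>\<close>
\<open>p ^ k\<close> times and every other value \<open>p ^ (k - 1)\<close> times.  If the individual sums do not depend on the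
choice of the parallel hyperplane, the total does not depend on \<open>\<nu>\<close>, and so neither does \<open>t \<nu>\<close>.\<close>
lemma hyperplane_sums_injective:
  assumes "prime p" "1 \<le> k"
    and const: "\<And>\<mu> a b. \<mu> \<in> nonzero_vectors p k \<Longrightarrow> a \<in> residues_mod p \<Longrightarrow> b \<in> residues_mod p \<Longrightarrow>
            hyperplane_sum p k \<mu> t a = hyperplane_sum p k \<mu> t b"
    and "\<nu> \<in> coeff_vectors p k" "\<nu>' \<in> coeff_vectors p k"
  shows "t \<nu> = t \<nu>'"
proof -
  let ?V = "coeff_vectors p k"
  have p: "0 < p" "1 < p" using assms(1) prime_gt_0_nat prime_gt_1_nat by auto
  define R where "R \<nu> = (\<Sum>\<mu>\<in>?V. hyperplane_sum p k \<mu> t (pairing p k \<mu> \<nu>))" for \<nu>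
  have Rconst: "R \<nu> = R \<nu>'" for \<nu> \<nu>'
    unfolding R_def
  proof (rule sum.cong)
    fix \<mu> assume \<mu>: "\<mu> \<in> ?V"
    show "hyperplane_sum p k \<mu> t (pairing p k \<mu> \<nu>) = hyperplane_sum p k \<mu> t (pairing p k \<mu> \<nu>')"
    proof (cases "\<mu> \<in> nonzero_vectors p k")
      case True
      then show ?thesis by (intro const pairing_in p)
    next
      case False
      then have "\<mu> s = 0" if "s < k" for s using \<mu> that by (auto simp: nonzero_vectors_def)
      then show ?thesis by (simp add: pairing_def)
    qed
  qed simp
  have count: "card {\<mu>\<in>?V. pairing p k \<mu> \<nu>' = pairing p k \<mu> \<nu>} = (if \<nu>' = \<nu> then p ^ k else p ^ (k - 1))"
    if "\<nu> \<in> ?V" "\<nu>' \<in> ?V" for \<nu> \<nu>'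
  proof (cases "\<nu>' = \<nu>")
    case False
    have "\<nu>' = \<nu>" if "\<forall>s<k. \<nu>' s = \<nu> s"
      using \<open>\<nu> \<in> ?V\<close> \<open>\<nu>' \<in> ?V\<close> that unfolding coeff_vectors_def by (intro PiE_ext) auto
    with False obtain s where s: "s < k" "\<nu>' s \<noteq> \<nu> s" by blast
    have r: "0 \<le> \<nu> s" "\<nu> s < int p" "0 \<le> \<nu>' s" "\<nu>' s < int p"
      using that s(1) by (auto simp: coeff_vectors_def residues_mod_def PiE_iff)
    have ndvd: "\<not> int p dvd (\<nu>' s - \<nu> s)"
    proof
      assume "int p dvd (\<nu>' s - \<nu> s)"
      then have "\<nu>' s mod int p = \<nu> s mod int p" by (simp add: mod_eq_dvd_iff)
      then show False using r s(2) by simp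
    qed
    have "pairing p k \<mu> \<nu>' = pairing p k \<mu> \<nu> \<longleftrightarrow> (\<Sum>s<k. \<mu> s * (\<nu>' s - \<nu> s)) mod int p = 0" for \<mu>
      by (simp add: pairing_def mod_eq_dvd_iff mod_eq_0_iff_dvd right_diff_distrib sum_subtractf)
    then show ?thesis using card_annihilator[OF assms(1) s(1), of "\<lambda>s. \<nu>' s - \<nu> s"] ndvd False by simp
  qed (simp add: card_coeff_vectors)
  have R: "R \<nu> = (real (p ^ k) - real (p ^ (k - 1))) * t \<nu> + real (p ^ (k - 1)) * (\<Sum>\<nu>'\<in>?V. t \<nu>')"
    if \<nu>: "\<nu> \<in> ?V" for \<nu>
  proof -
    have "R \<nu> = (\<Sum>\<mu>\<in>?V. \<Sum>\<nu>'\<in>?V. if pairing p k \<mu> \<nu>' = pairing p k \<mu> \<nu> then t \<nu>' else 0)"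
      unfolding R_def hyperplane_sum_def by (rule sum.cong) (simp_all add: sum.inter_filter)
    also have "\<dots> = (\<Sum>\<nu>'\<in>?V. \<Sum>\<mu>\<in>?V. if pairing p k \<mu> \<nu>' = pairing p k \<mu> \<nu> then t \<nu>' else 0)"
      by (rule sum.swap)
    also have "\<dots> = (\<Sum>\<nu>'\<in>?V. real (card {\<mu>\<in>?V. pairing p k \<mu> \<nu>' = pairing p k \<mu> \<nu>}) * t \<nu>')"
      by (rule sum.cong) (simp_all flip: sum.inter_filter)
    also have "\<dots> = (\<Sum>\<nu>'\<in>?V. (if \<nu>' = \<nu> then (real (p ^ k) - real (p ^ (k - 1))) * t \<nu> else 0)
        + real (p ^ (k - 1)) * t \<nu>')"
      by (rule sum.cong) (use count \<nu> in \<open>auto simp: algebra_simps\<close>)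
    also have "\<dots> = (real (p ^ k) - real (p ^ (k - 1))) * t \<nu> + real (p ^ (k - 1)) * (\<Sum>\<nu>'\<in>?V. t \<nu>')"
      using \<nu> by (simp add: sum.distrib sum_distrib_left)
    finally show ?thesis .
  qed
  have "real (p ^ k) - real (p ^ (k - 1)) \<noteq> 0"
    using p(2) assms(2) by (simp add: power_inject_exp)
  then show ?thesis using R[OF assms(4)] R[OF assms(5)] Rconst[of \<nu> \<nu>'] by simp
qed

text \<open>For a nonempty proper set \<open>A\<close> of residues, positive exactly if the values of \<open>\<tau>\<close> on \<open>A\<close> exceed all other values; for each size this happens for
at most one set \<open>A\<close>.\<close>
definition gap :: "nat \<Rightarrow> int set \<Rightarrow> (int \<Rightarrow> real) \<Rightarrow> real" where
  "gap p A \<tau> = max 0 (Min (\<tau> ` A) - Max (\<tau> ` (residues_mod p - A)))"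

text \<open>The first nonzero coordinate.  It is multiplied by \<open>x\<close> if \<open>\<mu>\<close> is, so among the \<open>p - 1\<close> multiples of a
form, which have the same hyperplanes, each size of a level set from 1 to \<open>p - 1\<close> occurs once as pivot.\<close>
definition pivot :: "(nat \<Rightarrow> int) \<Rightarrow> int" where
  "pivot \<mu> = \<mu> (LEAST s. \<mu> s \<noteq> 0)"

text \<open>Since the pivot \<open>j\<close> is invertible modulo \<open>p\<close>, sending a set with \<open>j\<close> elements to its sum divided by \<open>j\<close>
is a translation-equivariant map to the residues; these are its fibres.\<close>
definition level_sets :: "nat \<Rightarrow> (nat \<Rightarrow> int) \<Rightarrow> int \<Rightarrow> int set set" where
  "level_sets p \<mu> c = {A. A \<subseteq> residues_mod p \<and> int (card A) = pivot \<mu>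
      \<and> (\<Sum>A) mod int p = (pivot \<mu> * c) mod int p}"

text \<open>The contribution of the form \<open>\<mu>\<close> at the coset of \<open>ker \<mu>\<close> on which \<open>\<mu>\<close> takes the value \<open>c\<close>.\<close>
definition gap_block :: "nat \<Rightarrow> nat \<Rightarrow> (nat \<Rightarrow> int) \<Rightarrow> ((nat \<Rightarrow> int) \<Rightarrow> real) \<Rightarrow> int \<Rightarrow> real" where
  "gap_block p k \<mu> t c = (\<Sum>A\<in>level_sets p \<mu> c. gap p A (hyperplane_sum p k \<mu> t))"

lemma finite_level_sets [simp]: "finite (level_sets p \<mu> c)"
  by (rule finite_subset[of _ "Pow (residues_mod p)"]) (auto simp: level_sets_def)

lemma pivot_bounds:
  assumes "\<mu> \<in> nonzero_vectors p k"
  shows "0 < pivot \<mu>" "pivot \<mu> < int p"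
proof -
  obtain s where s: "s < k" "\<mu> s \<noteq> 0" using assms by (auto simp: nonzero_vectors_def)
  define s\<^sub>0 where "s\<^sub>0 = (LEAST s. \<mu> s \<noteq> 0)"
  have "\<mu> s\<^sub>0 \<noteq> 0" unfolding s\<^sub>0_def by (rule LeastI[of "\<lambda>s. \<mu> s \<noteq> 0", OF s(2)])
  moreover have "s\<^sub>0 < k"
    using Least_le[of "\<lambda>s. \<mu> s \<noteq> 0", OF s(2)] s(1) by (simp add: s\<^sub>0_def)
  moreover have "\<mu> s\<^sub>0 \<in> residues_mod p"
    using assms \<open>s\<^sub>0 < k\<close> by (auto simp: nonzero_vectors_def coeff_vectors_def)
  ultimately show "0 < pivot \<mu>" "pivot \<mu> < int p"
    by (simp_all add: pivot_def residues_mod_def flip: s\<^sub>0_def)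
qed

lemma gap_block_nonneg: "0 \<le> gap_block p k \<mu> t c"
  unfolding gap_block_def by (intro sum_nonneg) (simp add: gap_def)

lemma gap_pos_iff:
  assumes "A \<subseteq> residues_mod p" "A \<noteq> {}" "A \<noteq> residues_mod p"
  shows "gap p A \<tau> \<noteq> 0 \<longleftrightarrow> (\<forall>a\<in>A. \<forall>b\<in>residues_mod p - A. \<tau> b < \<tau> a)"
proof -
  have fin: "finite (\<tau> ` A)" "finite (\<tau> ` (residues_mod p - A))"
    using assms finite_subset[OF assms(1)] by auto
  have ne: "\<tau> ` A \<noteq> {}" "\<tau> ` (residues_mod p - A) \<noteq> {}" using assms by auto
  have "gap p A \<tau> \<noteq> 0 \<longleftrightarrow> Max (\<tau> ` (residues_mod p - A)) < Min (\<tau> ` A)"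
    by (auto simp: gap_def)
  also have "\<dots> \<longleftrightarrow> (\<forall>a\<in>A. \<forall>b\<in>residues_mod p - A. \<tau> b < \<tau> a)"
    using fin ne by (simp add: Max_less_iff Min_gr_iff)
  finally show ?thesis .
qed

lemma level_set_proper:
  assumes "\<mu> \<in> nonzero_vectors p k" "A \<in> level_sets p \<mu> c"
  shows "A \<subseteq> residues_mod p" "A \<noteq> {}" "A \<noteq> residues_mod p"
  using assms pivot_bounds[OF assms(1)] by (auto simp: level_sets_def)

text \<open>At most one set of the given size has a positive gap, so at most one point of the orbit is hit.\<close>
lemma gap_block_unique:
  assumes "prime p" "\<mu> \<in> nonzero_vectors p k" "c \<in> residues_mod p" "c' \<in> residues_mod p"
    and "gap_block p k \<mu> t c \<noteq> 0" "gap_block p k \<mu> t c' \<noteq> 0"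
  shows "c = c'"
proof -
  let ?\<tau> = "hyperplane_sum p k \<mu> t"
  obtain A where A: "A \<in> level_sets p \<mu> c" "gap p A ?\<tau> \<noteq> 0"
    using assms(5) unfolding gap_block_def by (meson sum.neutral)
  obtain A' where A': "A' \<in> level_sets p \<mu> c'" "gap p A' ?\<tau> \<noteq> 0"
    using assms(6) unfolding gap_block_def by (meson sum.neutral)
  note pA = level_set_proper[OF assms(2) A(1)] and pA' = level_set_proper[OF assms(2) A'(1)]
  have fin: "finite A" "finite A'" using pA pA' finite_subset[OF _ finite_residues_mod(1)] by auto
  have "A = A'"
  proof (rule ccontr)
    assume "A \<noteq> A'"
    have card: "card A = card A'" using A(1) A'(1) by (simp add: level_sets_def)
    then have "\<not> A \<subseteq> A'" "\<not> A' \<subseteq> A"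
      using \<open>A \<noteq> A'\<close> fin card_subset_eq[of A' A] card_subset_eq[of A A'] by auto
    then obtain a a' where aa: "a \<in> A" "a \<notin> A'" "a' \<in> A'" "a' \<notin> A" by blast
    have "?\<tau> a' < ?\<tau> a" using A(2) aa pA'(1) unfolding gap_pos_iff[OF pA] by blast
    moreover have "?\<tau> a < ?\<tau> a'" using A'(2) aa pA(1) unfolding gap_pos_iff[OF pA'] by blast
    ultimately show False by simp
  qed
  then have "(pivot \<mu> * c) mod int p = (pivot \<mu> * c') mod int p"
    using A(1) A'(1) by (simp add: level_sets_def)
  then have "int p dvd pivot \<mu> * (c - c')" by (simp add: mod_eq_dvd_iff right_diff_distrib)
  moreover have "\<not> int p dvd pivot \<mu>" using pivot_bounds[OF assms(2)] zdvd_not_zless by blast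
  moreover have "prime (int p)" using assms(1) by simp
  ultimately have "int p dvd c - c'" using prime_dvd_mult_iff by blast
  then have "c mod int p = c' mod int p" by (simp add: mod_eq_dvd_iff)
  then show ?thesis using assms(3,4) by (simp add: residues_mod_def)
qed

definition vadd :: "nat \<Rightarrow> nat \<Rightarrow> (nat \<Rightarrow> int) \<Rightarrow> (nat \<Rightarrow> int) \<Rightarrow> nat \<Rightarrow> int" where
  "vadd p k \<mu> \<nu> = (\<lambda>s\<in>{..<k}. (\<mu> s + \<nu> s) mod int p)"

lemma vadd_in: "0 < p \<Longrightarrow> vadd p k \<mu> \<nu> \<in> coeff_vectors p k"
  by (auto simp: vadd_def coeff_vectors_def residues_mod_def)

lemma pairing_vadd: "pairing p k \<mu> (vadd p k \<nu> \<nu>') = (pairing p k \<mu> \<nu> + pairing p k \<mu> \<nu>') mod int p"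
proof -
  have "[(\<Sum>s<k. \<mu> s * vadd p k \<nu> \<nu>' s) = (\<Sum>s<k. \<mu> s * (\<nu> s + \<nu>' s))] (mod int p)"
    by (intro cong_sum cong_mult cong_refl) (simp add: vadd_def cong_def)
  then show ?thesis
    by (simp add: pairing_def cong_def mod_simps distrib_left sum.distrib)
qed

lemma bij_vadd:
  assumes "0 < p" "\<nu>\<^sub>0 \<in> coeff_vectors p k"
  shows "bij_betw (vadd p k \<nu>\<^sub>0) (coeff_vectors p k) (coeff_vectors p k)"
proof -
  have "inj_on (vadd p k \<nu>\<^sub>0) (coeff_vectors p k)"
  proof (rule inj_onI)
    fix \<mu> \<nu> assume m: "\<mu> \<in> coeff_vectors p k" "\<nu> \<in> coeff_vectors p k" and eq: "vadd p k \<nu>\<^sub>0 \<mu> = vadd p k \<nu>\<^sub>0 \<nu>"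
    have "\<mu> s = \<nu> s" if s: "s < k" for s
    proof -
      have "(\<nu>\<^sub>0 s + \<mu> s) mod int p = (\<nu>\<^sub>0 s + \<nu> s) mod int p"
        using fun_cong[OF eq, of s] s by (simp add: vadd_def)
      then have "\<mu> s mod int p = \<nu> s mod int p" by (simp add: mod_eq_dvd_iff)
      then show ?thesis using m s by (auto simp: coeff_vectors_def residues_mod_def PiE_iff)
    qed
    then show "\<mu> = \<nu>" using m unfolding coeff_vectors_def by (intro PiE_ext) auto
  qed
  moreover have "vadd p k \<nu>\<^sub>0 ` coeff_vectors p k \<subseteq> coeff_vectors p k" using vadd_in[OF assms(1)] by auto
  ultimately show ?thesis
    by (simp add: bij_betw_def endo_inj_surj)
qed

lemma hyperplane_sum_shift:
  assumes "0 < p" "\<nu>\<^sub>0 \<in> coeff_vectors p k" "\<And>\<nu>. \<nu> \<in> coeff_vectors p k \<Longrightarrow> t' (vadd p k \<nu>\<^sub>0 \<nu>) = t \<nu>" "a \<in> residues_mod p"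
  shows "hyperplane_sum p k \<mu> t' a = hyperplane_sum p k \<mu> t ((a - pairing p k \<mu> \<nu>\<^sub>0) mod int p)"
  unfolding hyperplane_sum_def
proof (rule sum.reindex_bij_betw[symmetric, THEN trans])
  let ?c = "pairing p k \<mu> \<nu>\<^sub>0"
  let ?B = "{\<nu>\<in>coeff_vectors p k. pairing p k \<mu> \<nu> = (a - ?c) mod int p}"
  have eq: "(?c + pairing p k \<mu> \<nu>) mod int p = a \<longleftrightarrow> pairing p k \<mu> \<nu> = (a - ?c) mod int p" for \<nu>
  proof
    assume "(?c + pairing p k \<mu> \<nu>) mod int p = a"
    then have "(a - ?c) mod int p = ((?c + pairing p k \<mu> \<nu>) mod int p - ?c) mod int p" by simp
    also have "\<dots> = pairing p k \<mu> \<nu> mod int p" by (simp add: mod_diff_left_eq)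
    finally show "pairing p k \<mu> \<nu> = (a - ?c) mod int p" by (simp add: pairing_def)
  next
    assume "pairing p k \<mu> \<nu> = (a - ?c) mod int p"
    then show "(?c + pairing p k \<mu> \<nu>) mod int p = a"
      using assms(4) by (simp add: mod_add_right_eq residues_mod_def)
  qed
  have "vadd p k \<nu>\<^sub>0 ` ?B = {\<nu>\<in>coeff_vectors p k. pairing p k \<mu> \<nu> = a}"
  proof (intro equalityI subsetI)
    fix \<nu> assume \<nu>: "\<nu> \<in> {\<nu>\<in>coeff_vectors p k. pairing p k \<mu> \<nu> = a}"
    then have "\<nu> \<in> vadd p k \<nu>\<^sub>0 ` coeff_vectors p k" using bij_vadd[OF assms(1,2)] by (simp add: bij_betw_def)
    then obtain \<nu>' where \<nu>': "\<nu>' \<in> coeff_vectors p k" "\<nu> = vadd p k \<nu>\<^sub>0 \<nu>'" by blast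
    then have "\<nu>' \<in> ?B" using \<nu> eq[of \<nu>'] by (simp add: pairing_vadd)
    then show "\<nu> \<in> vadd p k \<nu>\<^sub>0 ` ?B" using \<nu>'(2) by blast
  next
    fix \<nu> assume "\<nu> \<in> vadd p k \<nu>\<^sub>0 ` ?B"
    then obtain \<nu>' where \<nu>': "\<nu> = vadd p k \<nu>\<^sub>0 \<nu>'" "pairing p k \<mu> \<nu>' = (a - ?c) mod int p" by blast
    have "pairing p k \<mu> \<nu> = a" using eq[of \<nu>'] \<nu>'(2) unfolding \<nu>'(1) pairing_vadd by blast
    then show "\<nu> \<in> {\<nu>\<in>coeff_vectors p k. pairing p k \<mu> \<nu> = a}"
      using \<nu>'(1) vadd_in[OF assms(1)] by simp
  qed
  then show "bij_betw (vadd p k \<nu>\<^sub>0) ?B {\<nu>\<in>coeff_vectors p k. pairing p k \<mu> \<nu> = a}"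
    using bij_vadd[OF assms(1,2)] by (auto intro: bij_betw_subset)
qed (use assms in auto)

definition translate :: "nat \<Rightarrow> int \<Rightarrow> int \<Rightarrow> int" where
  "translate p c a = (a - c) mod int p"

lemma bij_translate:
  assumes "0 < p"
  shows "bij_betw (translate p c) (residues_mod p) (residues_mod p)"
proof -
  have "inj_on (translate p c) (residues_mod p)"
  proof (rule inj_onI)
    fix a b assume ab: "a \<in> residues_mod p" "b \<in> residues_mod p" "translate p c a = translate p c b"
    then have "a mod int p = b mod int p" by (simp add: translate_def mod_eq_dvd_iff)
    then show "a = b" using ab by (simp add: residues_mod_def)
  qed
  moreover have "translate p c ` residues_mod p \<subseteq> residues_mod p"
    using assms by (auto simp: translate_def residues_mod_def)
  ultimately show ?thesis by (simp add: bij_betw_def endo_inj_surj)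
qed

lemma gap_translate:
  assumes "0 < p" "A \<subseteq> residues_mod p" "\<And>a. a \<in> residues_mod p \<Longrightarrow> \<tau>' a = \<tau> (translate p c a)"
  shows "gap p A \<tau>' = gap p (translate p c ` A) \<tau>"
proof -
  have inj: "inj_on (translate p c) (residues_mod p)" and im: "translate p c ` residues_mod p = residues_mod p"
    using bij_translate[OF assms(1)] by (auto simp: bij_betw_def)
  have "\<tau>' ` A = \<tau> ` translate p c ` A"
    unfolding image_image using assms by (intro image_cong) auto
  moreover have "residues_mod p - translate p c ` A = translate p c ` (residues_mod p - A)"
    using inj_on_image_set_diff[OF inj _ assms(2), of "residues_mod p"] im by simp
  moreover have "\<tau>' ` (residues_mod p - A) = \<tau> ` translate p c ` (residues_mod p - A)"
    unfolding image_image using assms by (intro image_cong) auto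
  ultimately show ?thesis by (simp add: gap_def)
qed

lemma sum_translate:
  assumes "0 < p" "A \<subseteq> residues_mod p"
  shows "(\<Sum>(translate p c ` A)) mod int p = (\<Sum>A - int (card A) * c) mod int p"
proof -
  have inj: "inj_on (translate p c) A"
    using bij_translate[OF assms(1)] assms(2) by (auto simp: bij_betw_def intro: inj_on_subset)
  have "(\<Sum>(translate p c ` A)) mod int p = (\<Sum>a\<in>A. (a - c) mod int p) mod int p"
    unfolding sum.reindex[OF inj] by (simp add: translate_def)
  also have "\<dots> = (\<Sum>a\<in>A. a - c) mod int p" by (rule mod_sum_eq)
  finally show ?thesis by (simp add: sum_subtractf)
qed

lemma level_sets_translate:
  assumes "0 < p"
  shows "bij_betw (image (translate p e)) (level_sets p \<mu> c) (level_sets p \<mu> (translate p e c))"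
proof -
  have bij: "bij_betw (image (translate p e)) (Pow (residues_mod p)) (Pow (residues_mod p))"
    using bij_translate[OF assms] by (rule bij_betw_Pow)
  have iff: "translate p e ` A \<in> level_sets p \<mu> (translate p e c) \<longleftrightarrow> A \<in> level_sets p \<mu> c"
    if A: "A \<subseteq> residues_mod p" for A
  proof -
    have inj: "inj_on (translate p e) A" and sub: "translate p e ` A \<subseteq> residues_mod p"
      using bij_translate[OF assms] A by (auto simp: bij_betw_def intro: inj_on_subset)
    have "(pivot \<mu> * translate p e c) mod int p = (pivot \<mu> * c - pivot \<mu> * e) mod int p"
      by (simp add: translate_def mod_mult_right_eq right_diff_distrib)
    then have 1: "int p dvd pivot \<mu> * translate p e c - (pivot \<mu> * c - pivot \<mu> * e)"
      by (simp add: mod_eq_dvd_iff)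
    have 2: "int p dvd \<Sum>(translate p e ` A) - (\<Sum>A - int (card A) * e)"
      using sum_translate[OF assms A, of e] by (simp add: mod_eq_dvd_iff)
    have "int p dvd \<Sum>(translate p e ` A) - pivot \<mu> * translate p e c \<longleftrightarrow> int p dvd \<Sum>A - pivot \<mu> * c"
      if "int (card A) = pivot \<mu>"
    proof -
      have "\<Sum>(translate p e ` A) - pivot \<mu> * translate p e c
          = (\<Sum>A - pivot \<mu> * c) + ((\<Sum>(translate p e ` A) - (\<Sum>A - int (card A) * e))
              - (pivot \<mu> * translate p e c - (pivot \<mu> * c - pivot \<mu> * e)))"
        using that by simp
      then show ?thesis using dvd_add_left_iff[OF dvd_diff[OF 2 1]] by metis
    qed
    then show ?thesis
      using A sub by (auto simp: level_sets_def card_image[OF inj] mod_eq_dvd_iff)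
  qed
  have "image (translate p e) ` level_sets p \<mu> c = level_sets p \<mu> (translate p e c)"
  proof (intro equalityI subsetI)
    fix B assume B: "B \<in> level_sets p \<mu> (translate p e c)"
    then have "B \<in> image (translate p e) ` Pow (residues_mod p)"
      using bij by (auto simp: bij_betw_def level_sets_def)
    then show "B \<in> image (translate p e) ` level_sets p \<mu> c" using B iff by auto
  qed (use iff in \<open>auto simp: level_sets_def\<close>)
  then show ?thesis
    using bij by (auto simp: level_sets_def intro!: bij_betw_subset[OF bij])
qed

lemma gap_block_shift:
  assumes "0 < p" "\<nu>\<^sub>0 \<in> coeff_vectors p k" "\<And>\<nu>. \<nu> \<in> coeff_vectors p k \<Longrightarrow> t' (vadd p k \<nu>\<^sub>0 \<nu>) = t \<nu>"
  shows "gap_block p k \<mu> t' c = gap_block p k \<mu> t (translate p (pairing p k \<mu> \<nu>\<^sub>0) c)"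
proof -
  let ?e = "pairing p k \<mu> \<nu>\<^sub>0"
  have "gap_block p k \<mu> t' c
      = (\<Sum>A\<in>level_sets p \<mu> c. gap p (translate p ?e ` A) (hyperplane_sum p k \<mu> t))"
    unfolding gap_block_def
  proof (rule sum.cong)
    fix A assume "A \<in> level_sets p \<mu> c"
    then show "gap p A (hyperplane_sum p k \<mu> t') = gap p (translate p ?e ` A) (hyperplane_sum p k \<mu> t)"
      using hyperplane_sum_shift[OF assms(1,2), of t' t] assms(1,3)
      by (intro gap_translate) (auto simp: level_sets_def translate_def)
  qed simp
  also have "\<dots> = gap_block p k \<mu> t (translate p ?e c)"
    unfolding gap_block_def by (rule sum.reindex_bij_betw[OF level_sets_translate[OF assms(1)]])
  finally show ?thesis .
qed

definition vscale :: "nat \<Rightarrow> nat \<Rightarrow> int \<Rightarrow> (nat \<Rightarrow> int) \<Rightarrow> nat \<Rightarrow> int" where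
  "vscale p k x \<mu> = (\<lambda>s\<in>{..<k}. (x * \<mu> s) mod int p)"

lemma mod_prime_mult_eq_0:
  assumes "prime p" "\<not> int p dvd x" "b \<in> residues_mod p"
  shows "(x * b) mod int p = 0 \<longleftrightarrow> b = 0"
proof -
  have "(x * b) mod int p = 0 \<longleftrightarrow> int p dvd b"
    using assms(1,2) prime_dvd_mult_iff[of "int p" x b] by (auto simp: mod_eq_0_iff_dvd)
  also have "\<dots> \<longleftrightarrow> b = 0"
    using assms(3) zdvd_not_zless[of b "int p"] by (auto simp: residues_mod_def order_less_le)
  finally show ?thesis .
qed

lemma vscale_nonzero:
  assumes "prime p" "\<not> int p dvd x" "\<mu> \<in> nonzero_vectors p k"
  shows "vscale p k x \<mu> \<in> nonzero_vectors p k" "pivot (vscale p k x \<mu>) = (x * pivot \<mu>) mod int p"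
proof -
  have p0: "0 < p" using assms(1) prime_gt_0_nat by blast
  have res: "\<mu> s \<in> residues_mod p" if "s < k" for s
    using assms(3) that by (auto simp: nonzero_vectors_def coeff_vectors_def)
  have iff: "vscale p k x \<mu> s \<noteq> 0 \<longleftrightarrow> \<mu> s \<noteq> 0" if "s < k" for s
    using mod_prime_mult_eq_0[OF assms(1,2) res[OF that]] that by (simp add: vscale_def)
  show nz: "vscale p k x \<mu> \<in> nonzero_vectors p k"
    using assms(3) iff p0 by (auto simp: nonzero_vectors_def coeff_vectors_def vscale_def residues_mod_def)
  obtain s where s: "s < k" "\<mu> s \<noteq> 0" using assms(3) by (auto simp: nonzero_vectors_def)
  define s\<^sub>0 where "s\<^sub>0 = (LEAST s. \<mu> s \<noteq> 0)"
  have s0: "\<mu> s\<^sub>0 \<noteq> 0" unfolding s\<^sub>0_def by (rule LeastI[of "\<lambda>s. \<mu> s \<noteq> 0", OF s(2)])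
  have s0k: "s\<^sub>0 < k" using Least_le[of "\<lambda>s. \<mu> s \<noteq> 0", OF s(2)] s(1) by (simp add: s\<^sub>0_def)
  have "(LEAST s. vscale p k x \<mu> s \<noteq> 0) = s\<^sub>0"
  proof (rule Least_equality)
    show "vscale p k x \<mu> s\<^sub>0 \<noteq> 0" using iff s0 s0k by simp
    show "s\<^sub>0 \<le> s'" if "vscale p k x \<mu> s' \<noteq> 0" for s'
    proof (rule ccontr)
      assume "\<not> s\<^sub>0 \<le> s'"
      then have "\<mu> s' = 0" using not_less_Least[of s' "\<lambda>s. \<mu> s \<noteq> 0"] by (auto simp: s\<^sub>0_def)
      then show False using that iff[of s'] s0k \<open>\<not> s\<^sub>0 \<le> s'\<close> by simp
    qed
  qed
  then show "pivot (vscale p k x \<mu>) = (x * pivot \<mu>) mod int p"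
    using s0k by (simp add: pivot_def vscale_def flip: s\<^sub>0_def)
qed

lemma pairing_vscale: "pairing p k (vscale p k x \<mu>) \<nu> = (x * pairing p k \<mu> \<nu>) mod int p"
proof -
  have "[(\<Sum>s<k. vscale p k x \<mu> s * \<nu> s) = (\<Sum>s<k. (x * \<mu> s) * \<nu> s)] (mod int p)"
    by (intro cong_sum cong_mult cong_refl) (simp add: vscale_def cong_def)
  then show ?thesis
    by (simp add: pairing_def cong_def mod_mult_right_eq sum_distrib_left mult.assoc)
qed

lemma hyperplane_sum_vscale:
  assumes "prime p" "\<not> int p dvd x" "a \<in> residues_mod p"
  shows "hyperplane_sum p k (vscale p k x \<mu>) t ((x * a) mod int p) = hyperplane_sum p k \<mu> t a"
proof -
  have p0: "0 < p" using assms(1) prime_gt_0_nat by blast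
  have "(x * pairing p k \<mu> \<nu>) mod int p = (x * a) mod int p \<longleftrightarrow> pairing p k \<mu> \<nu> = a" for \<nu>
  proof
    assume "(x * pairing p k \<mu> \<nu>) mod int p = (x * a) mod int p"
    then have "int p dvd x * (pairing p k \<mu> \<nu> - a)" by (simp add: mod_eq_dvd_iff right_diff_distrib)
    then have "int p dvd pairing p k \<mu> \<nu> - a"
      using assms(1,2) prime_dvd_mult_iff[of "int p"] by auto
    then have "pairing p k \<mu> \<nu> mod int p = a mod int p" by (simp add: mod_eq_dvd_iff)
    then show "pairing p k \<mu> \<nu> = a" using assms(3) by (simp add: pairing_def residues_mod_def)
  qed simp
  then show ?thesis by (simp add: hyperplane_sum_def pairing_vscale)
qed

text \<open>If the hyperplane sums of some form were not constant, the set \<open>A\<close> where they are maximal would have a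
positive gap.  A suitable multiple of the form has pivot \<open>card A\<close>, and its block sees this gap.\<close>
lemma blocks_vanish_imp_constant:
  assumes "prime p" "1 \<le> k"
    and zero: "\<And>\<mu> c. \<mu> \<in> nonzero_vectors p k \<Longrightarrow> c \<in> residues_mod p \<Longrightarrow> gap_block p k \<mu> t c = 0"
    and "\<nu> \<in> coeff_vectors p k" "\<nu>' \<in> coeff_vectors p k"
  shows "t \<nu> = t \<nu>'"
proof (rule hyperplane_sums_injective[OF assms(1,2) _ assms(4,5)])
  have p0: "0 < p" using assms(1) prime_gt_0_nat by blast
  have gap0: "gap p A (hyperplane_sum p k \<mu> t) = 0"
    if \<mu>: "\<mu> \<in> nonzero_vectors p k" and A: "A \<subseteq> residues_mod p" "int (card A) = pivot \<mu>" for \<mu> A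
  proof -
    have "\<not> int p dvd pivot \<mu>" using pivot_bounds[OF \<mu>] zdvd_not_zless by blast
    then obtain c where c: "c \<in> residues_mod p" "(c * pivot \<mu> + - \<Sum>A) mod int p = 0"
      using ex1_implies_ex[OF unique_root[OF assms(1), of "pivot \<mu>" "- \<Sum>A"]] by auto
    then have "(pivot \<mu> * c) mod int p = (\<Sum>A) mod int p"
      by (simp add: mod_eq_dvd_iff mod_eq_0_iff_dvd mult.commute)
    then have "A \<in> level_sets p \<mu> c" using A by (simp add: level_sets_def)
    moreover have "\<forall>A\<in>level_sets p \<mu> c. gap p A (hyperplane_sum p k \<mu> t) = 0"
      using zero[OF \<mu> c(1)] unfolding gap_block_def
      by (subst (asm) sum_nonneg_eq_0_iff) (auto simp: gap_def)
    ultimately show ?thesis by blast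
  qed
  fix \<mu> a b assume \<mu>: "\<mu> \<in> nonzero_vectors p k" and ab: "a \<in> residues_mod p" "b \<in> residues_mod p"
  let ?\<tau> = "hyperplane_sum p k \<mu> t"
  show "?\<tau> a = ?\<tau> b"
  proof (rule ccontr)
    assume ne: "?\<tau> a \<noteq> ?\<tau> b"
    define M where "M = Max (?\<tau> ` residues_mod p)"
    define A where "A = {a\<in>residues_mod p. ?\<tau> a = M}"
    have le: "?\<tau> x \<le> M" if "x \<in> residues_mod p" for x
      unfolding M_def using that by (intro Max_ge) auto
    have "M \<in> ?\<tau> ` residues_mod p" unfolding M_def using ab by (intro Max_in) auto
    then have A: "A \<subseteq> residues_mod p" "A \<noteq> {}" by (auto simp: A_def)
    have "A \<noteq> residues_mod p"
    proof
      assume "A = residues_mod p"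
      then have "?\<tau> a = M" "?\<tau> b = M" using ab unfolding A_def by blast+
      then show False using ne by simp
    qed
    note A = A this
    define j where "j = int (card A)"
    have j: "0 < j" "j < int p"
      using A psubset_card_mono[of "residues_mod p" A] finite_subset[OF A(1)]
      by (auto simp: j_def card_gt_0_iff)
    \<comment> \<open>The multiple \<open>x \<mu>\<close> has pivot \<open>j = card A\<close>, and multiplication by \<open>x\<close> carries the level set
      \<open>A\<close> of the sums of \<open>\<mu>\<close> to that of the sums of \<open>x \<mu>\<close>.\<close>
    have "\<not> int p dvd pivot \<mu>" using pivot_bounds[OF \<mu>] zdvd_not_zless by blast
    then obtain x where x: "x \<in> residues_mod p" "(x * pivot \<mu> + - j) mod int p = 0"
      using ex1_implies_ex[OF unique_root[OF assms(1), of "pivot \<mu>" "- j"]] by auto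
    then have xj: "(x * pivot \<mu>) mod int p = j"
      using j by (simp add: mod_eq_0_iff_dvd flip: mod_eq_dvd_iff)
    have nx: "\<not> int p dvd x"
    proof
      assume "int p dvd x"
      then have "(x * pivot \<mu>) mod int p = 0" by simp
      then show False using xj j by simp
    qed
    let ?m = "\<lambda>a. (x * a) mod int p" and ?\<mu>' = "vscale p k x \<mu>"
    note \<mu>' = vscale_nonzero[OF assms(1) nx \<mu>]
    have inj: "inj_on ?m (residues_mod p)"
    proof (rule inj_onI)
      fix a b assume ab: "a \<in> residues_mod p" "b \<in> residues_mod p" "?m a = ?m b"
      then have "int p dvd x * (a - b)" by (simp add: mod_eq_dvd_iff right_diff_distrib)
      then have "int p dvd a - b" using assms(1) nx prime_dvd_mult_iff[of "int p"] by auto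
      then have "a mod int p = b mod int p" by (simp add: mod_eq_dvd_iff)
      then show "a = b" using ab by (simp add: residues_mod_def)
    qed
    have sub: "?m ` residues_mod p \<subseteq> residues_mod p" using p0 by (auto simp: residues_mod_def)
    then have im: "?m ` residues_mod p = residues_mod p"
      using inj by (intro endo_inj_surj) auto
    have mA: "?m ` A \<subseteq> residues_mod p" "?m ` A \<noteq> {}" "?m ` A \<noteq> residues_mod p"
      using A sub im inj inj_on_image_eq_iff[OF inj, of A "residues_mod p"] by auto
    have "int (card (?m ` A)) = pivot ?\<mu>'"
      using card_image[OF inj_on_subset[OF inj A(1)]] \<mu>'(2) xj by (simp add: j_def)
    then have "gap p (?m ` A) (hyperplane_sum p k ?\<mu>' t) = 0"
      by (rule gap0[OF \<mu>'(1) mA(1)])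
    moreover have "gap p (?m ` A) (hyperplane_sum p k ?\<mu>' t) \<noteq> 0"
      unfolding gap_pos_iff[OF mA]
    proof (intro ballI)
      fix a' b' assume a': "a' \<in> ?m ` A" and b': "b' \<in> residues_mod p - ?m ` A"
      obtain a where a: "a \<in> A" "a' = ?m a" using a' by blast
      have "b' \<in> ?m ` residues_mod p" using b' im by simp
      then obtain b where b: "b \<in> residues_mod p" "b' = ?m b" by blast
      then have "b \<notin> A" using b' by auto
      then have "?\<tau> b < ?\<tau> a" using a(1) b(1) le[of b] by (auto simp: A_def)
      then show "hyperplane_sum p k ?\<mu>' t b' < hyperplane_sum p k ?\<mu>' t a'"
        using a b A(1) hyperplane_sum_vscale[OF assms(1) nx] by auto
    qed
    ultimately show False by simp
  qed
qed

lemma continuous_map_Max: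
  fixes f :: "'i \<Rightarrow> 'x \<Rightarrow> real"
  assumes "finite I" "I \<noteq> {}" "\<And>i. i \<in> I \<Longrightarrow> continuous_map X euclideanreal (f i)"
  shows "continuous_map X euclideanreal (\<lambda>x. Max ((\<lambda>i. f i x) ` I))"
  using assms
proof (induction I rule: finite_ne_induct)
  case (insert i I)
  then have "continuous_map X euclideanreal (\<lambda>x. max (f i x) (Max ((\<lambda>i. f i x) ` I)))"
    by (intro continuous_map_real_max) auto
  then show ?case using insert by simp
qed simp

lemma continuous_map_Min:
  fixes f :: "'i \<Rightarrow> 'x \<Rightarrow> real"
  assumes "finite I" "I \<noteq> {}" "\<And>i. i \<in> I \<Longrightarrow> continuous_map X euclideanreal (f i)"
  shows "continuous_map X euclideanreal (\<lambda>x. Min ((\<lambda>i. f i x) ` I))"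
  using assms
proof (induction I rule: finite_ne_induct)
  case (insert i I)
  then have "continuous_map X euclideanreal (\<lambda>x. min (f i x) (Min ((\<lambda>i. f i x) ` I)))"
    by (intro continuous_map_real_min) auto
  then show ?case using insert by simp
qed simp

lemma continuous_map_gap_block:
  assumes "\<mu> \<in> nonzero_vectors p k" "\<And>\<nu>. \<nu> \<in> coeff_vectors p k \<Longrightarrow> continuous_map X euclideanreal (\<lambda>x. t x \<nu>)"
  shows "continuous_map X euclideanreal (\<lambda>x. gap_block p k \<mu> (t x) c)"
  unfolding gap_block_def
proof (rule continuous_map_sum)
  fix A assume "A \<in> level_sets p \<mu> c"
  note A = level_set_proper[OF assms(1) this]
  have "continuous_map X euclideanreal (\<lambda>x. hyperplane_sum p k \<mu> (t x) a)" for a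
    unfolding hyperplane_sum_def by (intro continuous_map_sum) (use assms(2) in auto)
  then show "continuous_map X euclideanreal (\<lambda>x. gap p A (hyperplane_sum p k \<mu> (t x)))"
    unfolding gap_def using A finite_subset[OF A(1)]
    by (intro continuous_map_real_max continuous_map_diff continuous_map_Min continuous_map_Max) auto
qed simp

section \<open>Equivariant maps into joins of orbits\<close>

lemma lcosets_closed:
  assumes "group G" "subgroup H G" "g \<in> carrier G" "C \<in> lcosets\<^bsub>G\<^esub> H"
  shows "g <#\<^bsub>G\<^esub> C \<in> lcosets\<^bsub>G\<^esub> H"
proof -
  interpret group G by fact
  obtain a where a: "a \<in> carrier G" "C = a <#\<^bsub>G\<^esub> H" using assms(4) by (auto simp: LCOSETS_def)
  then have "g <#\<^bsub>G\<^esub> C = (g \<otimes>\<^bsub>G\<^esub> a) <#\<^bsub>G\<^esub> H"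
    using assms(3) subgroup.subset[OF assms(2)] by (simp add: lcos_m_assoc)
  then show ?thesis using a assms(3) by (auto simp: LCOSETS_def)
qed

lemma lcosets_subset: "group G \<Longrightarrow> subgroup H G \<Longrightarrow> C \<in> lcosets\<^bsub>G\<^esub> H \<Longrightarrow> C \<subseteq> carrier G"
  by (auto simp: LCOSETS_def dest: subgroup.elemlcos_carrier)

lemma orbit_vertices_translate:
  assumes "group G" "\<forall>j\<in>{1..n}. subgroup (H j) G" "g \<in> carrier G" "(C, j) \<in> orbit_vertices G n H"
  shows "(g <#\<^bsub>G\<^esub> C, j) \<in> orbit_vertices G n H"
  using assms lcosets_closed[OF assms(1) _ assms(3), of "H j" C] by (auto simp: orbit_vertices_def)

lemma translate_inv:
  assumes "group G" "g \<in> carrier G" "C \<subseteq> carrier G"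
  shows "g <#\<^bsub>G\<^esub> (inv\<^bsub>G\<^esub> g <#\<^bsub>G\<^esub> C) = C" "inv\<^bsub>G\<^esub> g <#\<^bsub>G\<^esub> (g <#\<^bsub>G\<^esub> C) = C"
proof -
  interpret group G by fact
  show "g <#\<^bsub>G\<^esub> (inv\<^bsub>G\<^esub> g <#\<^bsub>G\<^esub> C) = C" "inv\<^bsub>G\<^esub> g <#\<^bsub>G\<^esub> (g <#\<^bsub>G\<^esub> C) = C"
    using assms by (simp_all add: lcos_m_assoc lcos_mult_one)
qed

lemma orbit_vertices_subset:
  assumes "group G" "\<forall>j\<in>{1..n}. subgroup (H j) G" "(C, j) \<in> orbit_vertices G n H"
  shows "C \<subseteq> carrier G" "j \<in> {1..n}"
  using assms lcosets_subset[OF assms(1), of "H j" C] by (auto simp: orbit_vertices_def)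

lemma bij_orbit_vertices:
  assumes "group G" "\<forall>j\<in>{1..n}. subgroup (H j) G" "g \<in> carrier G"
  shows "bij_betw (\<lambda>(C, j). (g <#\<^bsub>G\<^esub> C, j)) (orbit_vertices G n H) (orbit_vertices G n H)"
proof (rule bij_betw_byWitness[where f' = "\<lambda>(C, j). (inv\<^bsub>G\<^esub> g <#\<^bsub>G\<^esub> C, j)"])
  have inv: "inv\<^bsub>G\<^esub> g \<in> carrier G" using assms(1,3) by (simp add: group.inv_closed)
  show "(\<lambda>(C, j). (g <#\<^bsub>G\<^esub> C, j)) ` orbit_vertices G n H \<subseteq> orbit_vertices G n H"
    using orbit_vertices_translate[OF assms] by auto
  show "(\<lambda>(C, j). (inv\<^bsub>G\<^esub> g <#\<^bsub>G\<^esub> C, j)) ` orbit_vertices G n H \<subseteq> orbit_vertices G n H"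
    using orbit_vertices_translate[OF assms(1,2) inv] by auto
qed (auto dest: orbit_vertices_subset(1)[OF assms(1,2)] simp: translate_inv[OF assms(1,3)])

lemma finite_orbit_vertices: "finite (carrier G) \<Longrightarrow> finite (orbit_vertices G n H)"
  by (auto simp: orbit_vertices_def LCOSETS_def)

lemma orbit_join_action_apply:
  "orbit_join_action G n H g y (C, j)
     = (if (C, j) \<in> orbit_vertices G n H then y (inv\<^bsub>G\<^esub> g <#\<^bsub>G\<^esub> C, j) else 0)"
  by (simp add: orbit_join_action_def simplicial_action_def)

lemma continuous_map_coordinate:
  "continuous_map X (realization K) f \<Longrightarrow> continuous_map X euclideanreal (\<lambda>x. f x w)"
  unfolding realization_def continuous_map_in_subtopology continuous_map_componentwise_UNIV by blast

definition normalize :: "'v set \<Rightarrow> ('v \<Rightarrow> real) \<Rightarrow> 'v \<Rightarrow> real" where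
  "normalize W y = (\<lambda>w. y w / (\<Sum>w\<in>W. y w))"

lemma normalize_in_realization:
  assumes "finite W" "\<And>w. 0 \<le> y w" "support y \<subseteq> W" "support y \<in> K" "y \<noteq> (\<lambda>_. 0)"
  shows "0 < (\<Sum>w\<in>W. y w)" "normalize W y \<in> topspace (realization K)"
proof -
  obtain w where w: "y w \<noteq> 0" using assms(5) by auto
  then have "w \<in> W" "0 < y w" using assms(2)[of w] assms(3) by (auto simp: support_def)
  then show pos: "0 < (\<Sum>w\<in>W. y w)" using assms(1,2) by (meson sum_pos2)
  have supp: "support (normalize W y) = support y" using pos by (auto simp: support_def normalize_def)
  have "(\<Sum>w\<in>support y. normalize W y w) = (\<Sum>w\<in>W. normalize W y w)"
    by (rule sum.mono_neutral_left) (use assms in \<open>auto simp: support_def normalize_def\<close>)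
  also have "\<dots> = 1" using pos by (simp add: normalize_def flip: sum_divide_distrib)
  finally show "normalize W y \<in> topspace (realization K)"
    using assms pos supp finite_subset[OF assms(3,1)] by (simp add: realization_def) (simp add: normalize_def)
qed

lemma continuous_map_normalize:
  assumes "finite W" "\<And>w. continuous_map X euclideanreal (\<lambda>x. F x w)"
    and "\<And>x w. x \<in> topspace X \<Longrightarrow> 0 \<le> F x w"
    and "\<And>x. x \<in> topspace X \<Longrightarrow> support (F x) \<subseteq> W \<and> support (F x) \<in> K \<and> F x \<noteq> (\<lambda>_. 0)"
  shows "continuous_map X (realization K) (\<lambda>x. normalize W (F x))"
  unfolding realization_def continuous_map_in_subtopology
proof
  show "continuous_map X (powertop_real UNIV) (\<lambda>x. normalize W (F x))"
    unfolding continuous_map_componentwise_UNIV normalize_def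
  proof (intro allI continuous_map_real_divide continuous_map_sum assms)
    fix x assume "x \<in> topspace X"
    then show "(\<Sum>w\<in>W. F x w) \<noteq> 0"
      using normalize_in_realization(1)[of W "F x" K] assms by force
  qed
  show "(\<lambda>x. normalize W (F x)) \<in> topspace X \<rightarrow> {x. (\<forall>v. 0 \<le> x v) \<and> finite (support x) \<and> support x \<in> K \<and> (\<Sum>v\<in>support x. x v) = 1}"
    using normalize_in_realization(2)[of W "F _" K] assms by (fastforce simp: realization_def)
qed

text \<open>A map into the cone over a join of orbits that avoids the apex can be normalized to a map into the join.\<close>
lemma genus_le_of_cone_map:
  assumes G: "group G" "finite (carrier G)"
    and H: "\<forall>j\<in>{1..n}. subgroup (H j) G \<and> H j \<noteq> carrier G"
    and cont: "\<And>w. continuous_map X euclideanreal (\<lambda>x. F x w)"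
    and nonneg: "\<And>x w. x \<in> topspace X \<Longrightarrow> 0 \<le> F x w"
    and supp: "\<And>x. x \<in> topspace X \<Longrightarrow> support (F x) \<in> orbit_join G n H"
    and nonzero: "\<And>x. x \<in> topspace X \<Longrightarrow> F x \<noteq> (\<lambda>_. 0)"
    and equi: "\<And>g x C j. g \<in> carrier G \<Longrightarrow> x \<in> topspace X \<Longrightarrow> (C, j) \<in> orbit_vertices G n H \<Longrightarrow>
                 F (\<psi> g x) (C, j) = F x (inv\<^bsub>G\<^esub> g <#\<^bsub>G\<^esub> C, j)"
    and out: "\<And>g x w. g \<in> carrier G \<Longrightarrow> x \<in> topspace X \<Longrightarrow> w \<notin> orbit_vertices G n H \<Longrightarrow> F (\<psi> g x) w = 0"
  shows "genus G X \<psi> \<le> enat n"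
  unfolding genus_def
proof (rule Inf_lower, rule CollectI, intro exI conjI)
  let ?W = "orbit_vertices G n H" and ?f = "\<lambda>x. normalize (orbit_vertices G n H) (F x)"
  have fin: "finite ?W" using G by (simp add: finite_orbit_vertices)
  show "continuous_map X (realization (orbit_join G n H)) ?f"
    by (rule continuous_map_normalize) (use fin cont nonneg supp nonzero in \<open>auto simp: orbit_join_def\<close>)
  show "\<forall>g\<in>carrier G. \<forall>x\<in>topspace X. ?f (\<psi> g x) = orbit_join_action G n H g (?f x)"
  proof (intro ballI ext)
    fix g x w assume g: "g \<in> carrier G" and x: "x \<in> topspace X"
    have ginv: "inv\<^bsub>G\<^esub> g \<in> carrier G" using G g by (simp add: group.inv_closed)
    have H': "\<forall>j\<in>{1..n}. subgroup (H j) G" using H by blast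
    have "(\<Sum>w\<in>?W. F (\<psi> g x) w) = (\<Sum>w\<in>?W. F x ((\<lambda>(C, j). (inv\<^bsub>G\<^esub> g <#\<^bsub>G\<^esub> C, j)) w))"
      by (rule sum.cong) (use equi[OF g x] in auto)
    also have "\<dots> = (\<Sum>w\<in>?W. F x w)"
      by (rule sum.reindex_bij_betw[OF bij_orbit_vertices[OF G(1) H' ginv]])
    finally have "(\<Sum>w\<in>?W. F (\<psi> g x) w) = (\<Sum>w\<in>?W. F x w)" .
    then show "?f (\<psi> g x) w = orbit_join_action G n H g (?f x) w"
      using equi[OF g x] out[OF g x]
      by (cases w) (auto simp: orbit_join_action_apply normalize_def)
  qed
  show "enat n = enat n" "\<forall>j\<in>{1..n}. subgroup (H j) G \<and> H j \<noteq> carrier G" using H by auto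
qed

text \<open>A finite genus is attained, because the extended naturals are well-ordered.\<close>
lemma genus_witness:
  assumes "genus G X \<psi> = enat n"
  obtains H f where "\<forall>j\<in>{1..n}. subgroup (H j) G \<and> H j \<noteq> carrier G"
    and "continuous_map X (realization (orbit_join G n H)) f"
    and "\<And>g x. g \<in> carrier G \<Longrightarrow> x \<in> topspace X \<Longrightarrow> f (\<psi> g x) = orbit_join_action G n H g (f x)"
proof -
  let ?A = "{enat n | n. \<exists>H f. (\<forall>j\<in>{1..n}. subgroup (H j) G \<and> H j \<noteq> carrier G) \<and>
     continuous_map X (realization (orbit_join G n H)) f \<and>
     (\<forall>g\<in>carrier G. \<forall>x\<in>topspace X. f (\<psi> g x) = orbit_join_action G n H g (f x))}"
  have "?A \<noteq> {}"
    using assms unfolding genus_def by (metis (no_types, lifting) Inf_empty enat.distinct(1) top_enat_def)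
  then have "Inf ?A \<in> ?A" by (metis (no_types, lifting) ex_in_conv wellorder_InfI)
  then have "enat n \<in> ?A" using assms unfolding genus_def by simp
  then show thesis using that by auto
qed

lemma p_torus_coordinates:
  assumes "p_torus p k G" "0 < p"
  obtains h where "bij_betw h (carrier G) (coeff_vectors p k)"
    and "\<And>x y. x \<in> carrier G \<Longrightarrow> y \<in> carrier G \<Longrightarrow> h (x \<otimes>\<^bsub>G\<^esub> y) = vadd p k (h x) (h y)"
proof -
  obtain h where h: "h \<in> iso G (product_group {..<k} (\<lambda>_. integer_mod_group p))"
    using assms(1) by (auto simp: p_torus_def is_iso_def)
  have "carrier (product_group {..<k} (\<lambda>_. integer_mod_group p)) = coeff_vectors p k"
    using assms(2) by (simp add: coeff_vectors_def residues_mod_def carrier_integer_mod_group)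
  then show thesis
    using h that[of h] by (simp add: iso_def hom_def vadd_def)
qed

lemma p_torus_finite:
  assumes "p_torus p k G" "0 < p"
  shows "finite (carrier G)" "card (carrier G) = p ^ k"
proof -
  obtain h where "bij_betw h (carrier G) (coeff_vectors p k)"
    using p_torus_coordinates[OF assms] by metis
  then show "finite (carrier G)" "card (carrier G) = p ^ k"
    using bij_betw_finite bij_betw_same_card[of h] card_coeff_vectors finite_coeff_vectors by metis+
qed

lemma p_torus_exponent:
  assumes "p_torus p k G" "0 < p"
  shows "\<And>x. x \<in> carrier G \<Longrightarrow> x [^]\<^bsub>G\<^esub> p = \<one>\<^bsub>G\<^esub>"
    and "\<And>x y. x \<in> carrier G \<Longrightarrow> y \<in> carrier G \<Longrightarrow> x \<otimes>\<^bsub>G\<^esub> y = y \<otimes>\<^bsub>G\<^esub> x"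
proof -
  interpret group G using assms by (simp add: p_torus_def)
  obtain h where h: "bij_betw h (carrier G) (coeff_vectors p k)"
    and hom: "\<And>x y. x \<in> carrier G \<Longrightarrow> y \<in> carrier G \<Longrightarrow> h (x \<otimes>\<^bsub>G\<^esub> y) = vadd p k (h x) (h y)"
    using p_torus_coordinates[OF assms] by metis
  have inj: "x = y" if "x \<in> carrier G" "y \<in> carrier G" "h x = h y" for x y
    using h that by (auto simp: bij_betw_def dest: inj_onD)
  show "x \<otimes>\<^bsub>G\<^esub> y = y \<otimes>\<^bsub>G\<^esub> x" if "x \<in> carrier G" "y \<in> carrier G" for x y
    using that by (intro inj) (auto simp: hom vadd_def add.commute)
  have mem: "h x \<in> coeff_vectors p k" if "x \<in> carrier G" for x
    using h that by (auto simp: bij_betw_def)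
  have one: "h \<one>\<^bsub>G\<^esub> s = 0" if "s < k" for s
  proof -
    have "h \<one>\<^bsub>G\<^esub> s = (h \<one>\<^bsub>G\<^esub> s + h \<one>\<^bsub>G\<^esub> s) mod int p"
    proof -
      have "vadd p k (h \<one>\<^bsub>G\<^esub>) (h \<one>\<^bsub>G\<^esub>) s = h \<one>\<^bsub>G\<^esub> s" using hom[of "\<one>\<^bsub>G\<^esub>" "\<one>\<^bsub>G\<^esub>"] by simp
      then show ?thesis using that by (simp add: vadd_def)
    qed
    moreover have "0 \<le> h \<one>\<^bsub>G\<^esub> s" "h \<one>\<^bsub>G\<^esub> s < int p"
      using mem[of "\<one>\<^bsub>G\<^esub>"] that by (auto simp: coeff_vectors_def residues_mod_def PiE_iff)
    ultimately have "h \<one>\<^bsub>G\<^esub> s mod int p = (h \<one>\<^bsub>G\<^esub> s + h \<one>\<^bsub>G\<^esub> s) mod int p" by simp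
    then have "int p dvd h \<one>\<^bsub>G\<^esub> s" by (simp add: mod_eq_dvd_iff)
    then show ?thesis using \<open>0 \<le> h \<one>\<^bsub>G\<^esub> s\<close> \<open>h \<one>\<^bsub>G\<^esub> s < int p\<close> zdvd_not_zless[of "h \<one>\<^bsub>G\<^esub> s" "int p"] by force
  qed
  show "x [^]\<^bsub>G\<^esub> p = \<one>\<^bsub>G\<^esub>" if x: "x \<in> carrier G" for x
  proof -
    have pow: "h (x [^]\<^bsub>G\<^esub> n) s = (int n * h x s) mod int p" if s: "s < k" for n s
    proof (induction n)
      case 0
      then show ?case by (simp add: one[OF s])
    next
      case (Suc n)
      then show ?case
        using s x by (simp add: hom vadd_def mod_simps algebra_simps)
    qed
    have "h (x [^]\<^bsub>G\<^esub> p) s = h \<one>\<^bsub>G\<^esub> s" if "s < k" for s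
      using pow[OF that, of p] one[OF that] by simp
    then have "h (x [^]\<^bsub>G\<^esub> p) = h \<one>\<^bsub>G\<^esub>"
      using mem[of "x [^]\<^bsub>G\<^esub> p"] mem[of "\<one>\<^bsub>G\<^esub>"] x unfolding coeff_vectors_def by (intro PiE_ext) auto
    then show ?thesis using x by (intro inj) auto
  qed
qed

text \<open>The group has as many elements as there are points, so a free action is simply transitive.\<close>
lemma free_action_regular:
  assumes "p_torus p k G" "0 < p" "free_action G {1..r} \<phi>" "r = p ^ k"
  shows "bij_betw (\<lambda>g. \<phi> g 1) (carrier G) {1..r}"
proof -
  interpret group_action G "{1..r}" \<phi> using assms(3) by (simp add: free_action_def)
  interpret group G using assms(1) by (simp add: p_torus_def)
  have r: "1 \<in> {1..r}" using assms(2,4) by simp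
  have inj: "inj_on (\<lambda>g. \<phi> g 1) (carrier G)"
  proof (rule inj_onI)
    fix x y assume xy: "x \<in> carrier G" "y \<in> carrier G" "\<phi> x 1 = \<phi> y 1"
    have "\<phi> (inv\<^bsub>G\<^esub> x \<otimes>\<^bsub>G\<^esub> y) 1 = \<phi> (inv\<^bsub>G\<^esub> x) (\<phi> x 1)"
      using composition_rule[OF r, of "inv\<^bsub>G\<^esub> x" y] xy by simp
    also have "\<dots> = \<phi> (inv\<^bsub>G\<^esub> x \<otimes>\<^bsub>G\<^esub> x) 1" using composition_rule[OF r, of "inv\<^bsub>G\<^esub> x" x] xy by simp
    also have "\<dots> = 1" using xy fun_cong[OF id_eq_one, of 1] r by simp
    finally have "inv\<^bsub>G\<^esub> x \<otimes>\<^bsub>G\<^esub> y \<in> stabilizer G \<phi> 1" using xy by (simp add: stabilizer_def)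
    then have "inv\<^bsub>G\<^esub> x \<otimes>\<^bsub>G\<^esub> y = \<one>\<^bsub>G\<^esub>" using assms(3) r by (auto simp: free_action_def)
    then show "x = y" using xy by (metis inv_closed inv_equality inv_inv)
  qed
  have "(\<lambda>g. \<phi> g 1) ` carrier G \<subseteq> {1..r}" using element_image[OF _ r] by blast
  moreover have "card ((\<lambda>g. \<phi> g 1) ` carrier G) = card {1..r}"
    using card_image[OF inj] p_torus_finite[OF assms(1,2)] assms(4) by simp
  ultimately have "(\<lambda>g. \<phi> g 1) ` carrier G = {1..r}" by (intro card_subset_eq) auto
  then show ?thesis using inj by (simp add: bij_betw_def)
qed

text \<open>Identify the \<open>r\<close> points with the group and the group with \<open>F\<^sub>p ^ k\<close>.  The \<open>j\<close>-th nonzero form \<open>e j\<close>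
gives the index-\<open>p\<close> subgroup \<open>H j\<close>, its kernel, and the block of \<open>e j\<close> gives the coordinates of \<open>E t\<close>
at the cosets of \<open>H j\<close>.  Constant vectors are the only ones that are mapped to 0.\<close>
lemma nonconstant_vectors_to_join:
  assumes prime: "prime p" and k: "1 \<le> k" and r: "r = p ^ k"
    and torus: "p_torus p k G" and free: "free_action G {1..r} \<phi>"
  obtains H :: "nat \<Rightarrow> 'g set" and E :: "(nat \<Rightarrow> real) \<Rightarrow> 'g set \<times> nat \<Rightarrow> real"
  where "\<forall>j\<in>{1..r-1}. subgroup (H j) G \<and> H j \<noteq> carrier G"
    and "\<And>t w. 0 \<le> E t w"
    and "\<And>t. support (E t) \<in> orbit_join G (r - 1) H"
    and "\<And>t t' g C j. g \<in> carrier G \<Longrightarrow> (\<And>i. i \<in> {1..r} \<Longrightarrow> t' i = t (\<phi> (inv\<^bsub>G\<^esub> g) i)) \<Longrightarrow>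
           (C, j) \<in> orbit_vertices G (r - 1) H \<Longrightarrow> E t' (C, j) = E t (inv\<^bsub>G\<^esub> g <#\<^bsub>G\<^esub> C, j)"
    and "\<And>t i i'. E t = (\<lambda>_. 0) \<Longrightarrow> i \<in> {1..r} \<Longrightarrow> i' \<in> {1..r} \<Longrightarrow> t i = t i'"
    and "\<And>(X :: 'x topology) t w. (\<And>i. i \<in> {1..r} \<Longrightarrow> continuous_map X euclideanreal (\<lambda>x. t x i)) \<Longrightarrow>
           continuous_map X euclideanreal (\<lambda>x. E (t x) w)"
proof -
  have p0: "0 < p" using prime prime_gt_0_nat by blast
  interpret group G using torus by (simp add: p_torus_def)
  interpret group_action G "{1..r}" \<phi> using free by (simp add: free_action_def)
  let ?V = "coeff_vectors p k"
  obtain h where h: "bij_betw h (carrier G) ?V"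
    and hom: "\<And>x y. x \<in> carrier G \<Longrightarrow> y \<in> carrier G \<Longrightarrow> h (x \<otimes>\<^bsub>G\<^esub> y) = vadd p k (h x) (h y)"
    using p_torus_coordinates[OF torus p0] by metis
  have hV: "h x \<in> ?V" if "x \<in> carrier G" for x using h that by (auto simp: bij_betw_def)
  define h' where "h' = inv_into (carrier G) h"
  have h': "h' \<nu> \<in> carrier G" "h (h' \<nu>) = \<nu>" if "\<nu> \<in> ?V" for \<nu>
    using h that by (auto simp: h'_def bij_betw_def inv_into_into f_inv_into_f)
  have h'h: "h' (h x) = x" if "x \<in> carrier G" for x
    using h that by (simp add: h'_def bij_betw_def)
  note regular = free_action_regular[OF torus p0 free r]
  have one: "1 \<in> {1..r}" using p0 r by simp
  have "card {1..r-1} = card (nonzero_vectors p k)"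
    using card_nonzero_vectors[OF p0] r by simp
  moreover have "finite (nonzero_vectors p k)" by (simp add: nonzero_vectors_def)
  ultimately obtain e where e: "bij_betw e {1..r-1} (nonzero_vectors p k)"
    using finite_same_card_bij[of "{1..r-1}"] by auto
  have eV: "e j \<in> nonzero_vectors p k" if "j \<in> {1..r-1}" for j using e that by (auto simp: bij_betw_def)
  define val where "val j x = pairing p k (e j) (h x)" for j x
  have val_mult: "val j (x \<otimes>\<^bsub>G\<^esub> y) = (val j x + val j y) mod int p" if "x \<in> carrier G" "y \<in> carrier G" for j x y
    using that by (simp add: val_def hom pairing_vadd)
  have val_res: "val j x \<in> residues_mod p" for j x by (simp add: val_def pairing_in p0)
  have val_mod: "val j x mod int p = val j x" for j x
    using val_res[of j x] by (simp add: residues_mod_def)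
  have val_one: "val j \<one>\<^bsub>G\<^esub> = 0" for j
  proof -
    have "val j \<one>\<^bsub>G\<^esub> mod int p = (val j \<one>\<^bsub>G\<^esub> + val j \<one>\<^bsub>G\<^esub>) mod int p"
      using val_mult[of "\<one>\<^bsub>G\<^esub>" "\<one>\<^bsub>G\<^esub>" j] by (simp add: val_mod)
    then have "int p dvd val j \<one>\<^bsub>G\<^esub>" by (simp add: mod_eq_dvd_iff)
    then show ?thesis using val_mod[of j "\<one>\<^bsub>G\<^esub>"] by (simp add: mod_eq_0_iff_dvd)
  qed
  have val_cancel: "val j (inv\<^bsub>G\<^esub> x \<otimes>\<^bsub>G\<^esub> y) = translate p (val j x) (val j y)" if "x \<in> carrier G" "y \<in> carrier G" for j x y
  proof -
    have "val j y = (val j x + val j (inv\<^bsub>G\<^esub> x \<otimes>\<^bsub>G\<^esub> y)) mod int p"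
      using val_mult[of x "inv\<^bsub>G\<^esub> x \<otimes>\<^bsub>G\<^esub> y" j] that by (simp flip: m_assoc)
    then have "translate p (val j x) (val j y) = val j (inv\<^bsub>G\<^esub> x \<otimes>\<^bsub>G\<^esub> y) mod int p"
      by (simp add: translate_def mod_diff_left_eq)
    then show ?thesis by (simp add: val_mod)
  qed
  define H where "H j = {x \<in> carrier G. val j x = 0}" for j
  have sub: "subgroup (H j) G" for j
  proof (rule subgroupI)
    show "H j \<noteq> {}" using val_one by (auto simp: H_def)
    show "inv\<^bsub>G\<^esub> x \<in> H j" if "x \<in> H j" for x
      using that val_cancel[of x "\<one>\<^bsub>G\<^esub>" j] val_one by (simp add: H_def translate_def)
    show "x \<otimes>\<^bsub>G\<^esub> y \<in> H j" if "x \<in> H j" "y \<in> H j" for x y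
      using that by (simp add: H_def val_mult)
  qed (auto simp: H_def)
  have surj: "\<exists>x\<in>carrier G. val j x = c" if j: "j \<in> {1..r-1}" and c: "c \<in> residues_mod p" for j c
  proof -
    obtain s where s: "s < k" "e j s \<noteq> 0" using eV[OF j] by (auto simp: nonzero_vectors_def)
    have "e j s \<in> residues_mod p" using eV[OF j] s(1) by (auto simp: nonzero_vectors_def coeff_vectors_def)
    then have "\<not> int p dvd e j s"
      using s(2) zdvd_not_zless[of "e j s" "int p"] by (auto simp: residues_mod_def)
    then obtain x where x: "x \<in> residues_mod p" "(x * e j s + - c) mod int p = 0"
      using ex1_implies_ex[OF unique_root[OF prime, of "e j s" "- c"]] by auto
    define \<nu> where "\<nu> = (\<lambda>i\<in>{..<k}. if i = s then x else 0)"
    have \<nu>: "\<nu> \<in> ?V" using x(1) p0 by (auto simp: \<nu>_def coeff_vectors_def residues_mod_def)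
    have "(\<Sum>i<k. e j i * \<nu> i) = (\<Sum>i<k. if i = s then x * e j s else 0)"
      by (rule sum.cong) (auto simp: \<nu>_def)
    then have "pairing p k (e j) \<nu> = (x * e j s) mod int p" using s(1) by (simp add: pairing_def)
    also have "\<dots> = c mod int p" using x(2) by (simp add: mod_eq_0_iff_dvd mod_eq_dvd_iff)
    also have "\<dots> = c" using c by (simp add: residues_mod_def)
    finally show ?thesis using h'[OF \<nu>] by (intro bexI[of _ "h' \<nu>"]) (simp_all add: val_def)
  qed
  have proper: "H j \<noteq> carrier G" if "j \<in> {1..r-1}" for j
  proof -
    have "1 \<in> residues_mod p" using prime_gt_1_nat[OF prime] by (simp add: residues_mod_def)
    then obtain x where "x \<in> carrier G" "val j x = 1" using surj[OF \<open>j \<in> {1..r-1}\<close>] by blast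
    moreover from this have "x \<notin> H j" by (simp add: H_def)
    ultimately show ?thesis by blast
  qed
  have coset: "a <#\<^bsub>G\<^esub> H j = {x \<in> carrier G. val j x = val j a}" if a: "a \<in> carrier G" for a j
  proof (intro equalityI subsetI)
    fix x assume "x \<in> a <#\<^bsub>G\<^esub> H j"
    then show "x \<in> {x \<in> carrier G. val j x = val j a}"
      using a by (auto simp: l_coset_def H_def val_mult val_mod)
  next
    fix x assume x: "x \<in> {x \<in> carrier G. val j x = val j a}"
    then have "inv\<^bsub>G\<^esub> a \<otimes>\<^bsub>G\<^esub> x \<in> H j"
      using a val_cancel[of a x j] by (simp add: H_def translate_def)
    then have "a \<otimes>\<^bsub>G\<^esub> (inv\<^bsub>G\<^esub> a \<otimes>\<^bsub>G\<^esub> x) \<in> a <#\<^bsub>G\<^esub> H j" by (auto simp: l_coset_def)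
    then show "x \<in> a <#\<^bsub>G\<^esub> H j" using a x by (simp flip: m_assoc)
  qed
  define cval where "cval j C = val j (SOME x. x \<in> C)" for j C
  have cval: "cval j (a <#\<^bsub>G\<^esub> H j) = val j a" if a: "a \<in> carrier G" for a j
  proof -
    have "a \<in> a <#\<^bsub>G\<^esub> H j" using coset[OF a] a by simp
    then have "(SOME x. x \<in> a <#\<^bsub>G\<^esub> H j) \<in> a <#\<^bsub>G\<^esub> H j" by (rule someI)
    then show ?thesis unfolding cval_def using coset[OF a] by auto
  qed
  let ?W = "orbit_vertices G (r - 1) H"
  have W: "\<exists>a\<in>carrier G. C = a <#\<^bsub>G\<^esub> H j" "j \<in> {1..r-1}" if "(C, j) \<in> ?W" for C j
    using that by (auto simp: orbit_vertices_def LCOSETS_def)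
  define T where "T t \<nu> = t (\<phi> (h' \<nu>) 1)" for t :: "nat \<Rightarrow> real" and \<nu>
  define E where "E t w = (if w \<in> ?W then gap_block p k (e (snd w)) (T t) (cval (snd w) (fst w)) else 0)" for t w
  show thesis
  proof (rule that[of H E])
    show "\<forall>j\<in>{1..r-1}. subgroup (H j) G \<and> H j \<noteq> carrier G" using sub proper by blast
    show "0 \<le> E t w" for t w by (simp add: E_def gap_block_nonneg)
    show "support (E t) \<in> orbit_join G (r - 1) H" for t
      unfolding orbit_join_def
    proof (intro CollectI conjI inj_onI)
      show "support (E t) \<subseteq> ?W" by (auto simp: support_def E_def split: if_splits)
      fix v w assume v: "v \<in> support (E t)" and w: "w \<in> support (E t)" and eq: "snd v = snd w"
      obtain C j C' where vw: "v = (C, j)" "w = (C', j)" using eq by (cases v; cases w) auto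
      have mem: "(C, j) \<in> ?W" "(C', j) \<in> ?W"
        and nz: "gap_block p k (e j) (T t) (cval j C) \<noteq> 0" "gap_block p k (e j) (T t) (cval j C') \<noteq> 0"
        using v w by (auto simp: support_def E_def vw split: if_splits)
      obtain a a' where a: "a \<in> carrier G" "C = a <#\<^bsub>G\<^esub> H j" "a' \<in> carrier G" "C' = a' <#\<^bsub>G\<^esub> H j"
        using W(1)[OF mem(1)] W(1)[OF mem(2)] by blast
      have "cval j C = cval j C'"
        by (rule gap_block_unique[OF prime eV[OF W(2)[OF mem(1)]] _ _ nz]) (use a val_res in \<open>auto simp: cval\<close>)
      then have "val j a = val j a'" using a by (simp add: cval)
      then have "C = C'" unfolding a(2,4) coset[OF a(1)] coset[OF a(3)] by simp
      then show "v = w" by (simp add: vw)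
    qed
    show "E t' (C, j) = E t (inv\<^bsub>G\<^esub> g <#\<^bsub>G\<^esub> C, j)"
      if g: "g \<in> carrier G" and t': "\<And>i. i \<in> {1..r} \<Longrightarrow> t' i = t (\<phi> (inv\<^bsub>G\<^esub> g) i)"
        and C: "(C, j) \<in> ?W" for t t' g C j
    proof -
      obtain a where a: "a \<in> carrier G" "C = a <#\<^bsub>G\<^esub> H j" using W(1)[OF C] by blast
      have gC: "inv\<^bsub>G\<^esub> g <#\<^bsub>G\<^esub> C = (inv\<^bsub>G\<^esub> g \<otimes>\<^bsub>G\<^esub> a) <#\<^bsub>G\<^esub> H j"
        using a g subgroup.subset[OF sub] by (simp add: lcos_m_assoc)
      have mem: "(inv\<^bsub>G\<^esub> g <#\<^bsub>G\<^esub> C, j) \<in> ?W"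
        by (rule orbit_vertices_translate) (use g C sub in auto)
      have shift: "T t' (vadd p k (h g) \<nu>) = T t \<nu>" if \<nu>: "\<nu> \<in> ?V" for \<nu>
      proof -
        have x: "h' \<nu> \<in> carrier G" using h'[OF \<nu>] by simp
        have "h' (vadd p k (h g) \<nu>) = g \<otimes>\<^bsub>G\<^esub> h' \<nu>"
          using h'h[of "g \<otimes>\<^bsub>G\<^esub> h' \<nu>"] g x h'[OF \<nu>] by (simp add: hom)
        then have "T t' (vadd p k (h g) \<nu>) = t (\<phi> (inv\<^bsub>G\<^esub> g) (\<phi> (g \<otimes>\<^bsub>G\<^esub> h' \<nu>) 1))"
          using t'[OF element_image[OF m_closed[OF g x] one refl]] by (simp add: T_def)
        also have "\<phi> (inv\<^bsub>G\<^esub> g) (\<phi> (g \<otimes>\<^bsub>G\<^esub> h' \<nu>) 1) = \<phi> (inv\<^bsub>G\<^esub> g \<otimes>\<^bsub>G\<^esub> (g \<otimes>\<^bsub>G\<^esub> h' \<nu>)) 1"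
          using composition_rule[OF one, of "inv\<^bsub>G\<^esub> g" "g \<otimes>\<^bsub>G\<^esub> h' \<nu>"] g x by simp
        also have "inv\<^bsub>G\<^esub> g \<otimes>\<^bsub>G\<^esub> (g \<otimes>\<^bsub>G\<^esub> h' \<nu>) = h' \<nu>" using g x by (simp flip: m_assoc)
        finally show ?thesis by (simp add: T_def)
      qed
      have "E t' (C, j) = gap_block p k (e j) (T t') (val j a)" using C a by (simp add: E_def cval)
      also have "\<dots> = gap_block p k (e j) (T t) (translate p (pairing p k (e j) (h g)) (val j a))"
        by (rule gap_block_shift[where t = "T t", OF p0 hV[OF g]]) (rule shift)
      also have "\<dots> = E t (inv\<^bsub>G\<^esub> g <#\<^bsub>G\<^esub> C, j)"
        using mem g a val_cancel[of g a j] unfolding gC by (simp add: E_def cval val_def)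
      finally show ?thesis .
    qed
    show "t i = t i'" if E0: "E t = (\<lambda>_. 0)" and i: "i \<in> {1..r}" "i' \<in> {1..r}" for t i i'
    proof -
      obtain x x' where x: "x \<in> carrier G" "\<phi> x 1 = i" "x' \<in> carrier G" "\<phi> x' 1 = i'"
        using regular i unfolding bij_betw_def by (metis (no_types, lifting) imageE)
      have "T t (h x) = T t (h x')"
      proof (rule blocks_vanish_imp_constant[OF prime k _ hV[OF x(1)] hV[OF x(3)]])
        fix \<mu> c assume \<mu>: "\<mu> \<in> nonzero_vectors p k" and c: "c \<in> residues_mod p"
        have "\<mu> \<in> e ` {1..r-1}" using e \<mu> by (simp add: bij_betw_def)
        then obtain j where j: "j \<in> {1..r-1}" "\<mu> = e j" by blast
        obtain a where a: "a \<in> carrier G" "val j a = c" using surj[OF j(1) c] by blast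
        have "(a <#\<^bsub>G\<^esub> H j, j) \<in> ?W" using a j by (auto simp: orbit_vertices_def LCOSETS_def)
        then have "E t (a <#\<^bsub>G\<^esub> H j, j) = gap_block p k \<mu> (T t) c" using a j by (simp add: E_def cval)
        then show "gap_block p k \<mu> (T t) c = 0" using E0 by simp
      qed
      then show ?thesis using x by (simp add: T_def h'h)
    qed
    show "continuous_map X euclideanreal (\<lambda>x. E (t x) w)"
      if t: "\<And>i. i \<in> {1..r} \<Longrightarrow> continuous_map X euclideanreal (\<lambda>x. t x i)" for X :: "'x topology" and t w
    proof (cases "w \<in> ?W")
      case True
      have "continuous_map X euclideanreal (\<lambda>x. gap_block p k (e (snd w)) (T (t x)) (cval (snd w) (fst w)))"
      proof (rule continuous_map_gap_block)
        show "e (snd w) \<in> nonzero_vectors p k" using W(2)[of "fst w" "snd w"] True eV by simp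
        show "continuous_map X euclideanreal (\<lambda>x. T (t x) \<nu>)" if "\<nu> \<in> ?V" for \<nu>
          unfolding T_def by (rule t) (use element_image[OF _ one] h'[OF that] in blast)
      qed
      then show ?thesis using True by (simp add: E_def)
    qed (simp add: E_def)
  qed
qed

text \<open>The function \<open>B\<close> takes values in the cone over a join of \<open>n\<close> orbits.  Where it reaches the apex, the
vector \<open>t\<close> is nonconstant and supplies a nonzero point of the cone over \<open>r - 1\<close> further orbits.\<close>
lemma genus_le_join:
  assumes prime: "prime p" and k: "1 \<le> k" and r: "r = p ^ k"
    and torus: "p_torus p k G" and free: "free_action G {1..r} \<phi>"
    and H1: "\<forall>j\<in>{1..n}. subgroup (H1 j) G \<and> H1 j \<noteq> carrier G"
    and B: "\<And>w. continuous_map X euclideanreal (\<lambda>x. B x w)"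
      "\<And>x w. x \<in> topspace X \<Longrightarrow> 0 \<le> B x w"
      "\<And>x. x \<in> topspace X \<Longrightarrow> support (B x) \<in> orbit_join G n H1"
      "\<And>g x C j. g \<in> carrier G \<Longrightarrow> x \<in> topspace X \<Longrightarrow> (C, j) \<in> orbit_vertices G n H1 \<Longrightarrow>
         B (\<psi> g x) (C, j) = B x (inv\<^bsub>G\<^esub> g <#\<^bsub>G\<^esub> C, j)"
    and t: "\<And>i. i \<in> {1..r} \<Longrightarrow> continuous_map X euclideanreal (\<lambda>x. t x i)"
      "\<And>g x i. g \<in> carrier G \<Longrightarrow> x \<in> topspace X \<Longrightarrow> i \<in> {1..r} \<Longrightarrow> t (\<psi> g x) i = t x (\<phi> (inv\<^bsub>G\<^esub> g) i)"
    and Bt: "\<And>x. x \<in> topspace X \<Longrightarrow> B x = (\<lambda>_. 0) \<Longrightarrow> \<exists>i\<in>{1..r}. \<exists>i'\<in>{1..r}. t x i \<noteq> t x i'"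
  shows "genus G X \<psi> \<le> enat (n + (r - 1))"
proof -
  have p0: "0 < p" using prime prime_gt_0_nat by blast
  have G: "group G" "finite (carrier G)"
    using torus p_torus_finite[OF torus p0] by (auto simp: p_torus_def)
  show ?thesis
  proof (rule nonconstant_vectors_to_join[OF prime k r torus free, where ?'x = 'b])
    fix H2 :: "nat \<Rightarrow> 'a set" and E :: "(nat \<Rightarrow> real) \<Rightarrow> 'a set \<times> nat \<Rightarrow> real"
    assume H2: "\<forall>j\<in>{1..r-1}. subgroup (H2 j) G \<and> H2 j \<noteq> carrier G"
      and E: "\<And>t w. 0 \<le> E t w" "\<And>t. support (E t) \<in> orbit_join G (r - 1) H2"
      "\<And>t t' g C j. g \<in> carrier G \<Longrightarrow> (\<And>i. i \<in> {1..r} \<Longrightarrow> t' i = t (\<phi> (inv\<^bsub>G\<^esub> g) i)) \<Longrightarrow>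
           (C, j) \<in> orbit_vertices G (r - 1) H2 \<Longrightarrow> E t' (C, j) = E t (inv\<^bsub>G\<^esub> g <#\<^bsub>G\<^esub> C, j)"
      "\<And>t i i'. E t = (\<lambda>_. 0) \<Longrightarrow> i \<in> {1..r} \<Longrightarrow> i' \<in> {1..r} \<Longrightarrow> t i = t i'"
      "\<And>(X :: 'b topology) t w. (\<And>i. i \<in> {1..r} \<Longrightarrow> continuous_map X euclideanreal (\<lambda>x. t x i)) \<Longrightarrow>
           continuous_map X euclideanreal (\<lambda>x. E (t x) w)"
    define H where "H j = (if j \<le> n then H1 j else H2 (j - n))" for j
    define F where "F x w = (if w \<in> orbit_vertices G n H1 then B x w
       else if n < snd w then E (t x) (fst w, snd w - n) else 0)" for x w
    let ?W = "orbit_vertices G (n + (r - 1)) H"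
    have W1: "(C, j) \<in> orbit_vertices G n H1 \<longleftrightarrow> (C, j) \<in> ?W \<and> j \<le> n" for C j
      by (auto simp: orbit_vertices_def H_def)
    have W2: "(C, j - n) \<in> orbit_vertices G (r - 1) H2 \<longleftrightarrow> (C, j) \<in> ?W" if "n < j" for C j
      using that by (auto simp: orbit_vertices_def H_def)
    have H: "\<forall>j\<in>{1..n + (r - 1)}. subgroup (H j) G \<and> H j \<noteq> carrier G"
    proof
      fix j assume j: "j \<in> {1..n + (r - 1)}"
      show "subgroup (H j) G \<and> H j \<noteq> carrier G"
      proof (cases "j \<le> n")
        case True
        then show ?thesis using H1 j by (simp add: H_def)
      next
        case False
        then have "j - n \<in> {1..r-1}" using j by auto
        then show ?thesis using H2 False by (simp add: H_def)
      qed
    qed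
    have Eout: "E t (C, j - n) = 0" if "n < j" "(C, j) \<notin> ?W" for t C j
      using E(2)[of t] W2[OF that(1), of C] that(2) by (auto simp: orbit_join_def support_def)
    have Fout: "F x w = 0" if "w \<notin> ?W" for x w
      using that Eout[of "snd w" "fst w"] W1[of "fst w" "snd w"] by (cases w) (auto simp: F_def)
    show ?thesis
    proof (rule genus_le_of_cone_map[OF G H, where F = F])
      show "continuous_map X euclideanreal (\<lambda>x. F x w)" for w
        unfolding F_def using B(1)[of w] E(5)[of X t, OF t(1)] by simp
      show "0 \<le> F x w" if "x \<in> topspace X" for x w
        using B(2)[OF that] E(1) by (simp add: F_def)
      show "support (F x) \<in> orbit_join G (n + (r - 1)) H" if x: "x \<in> topspace X" for x
        unfolding orbit_join_def
      proof (intro CollectI conjI inj_onI)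
        show "support (F x) \<subseteq> ?W" using Fout by (auto simp: support_def)
        fix v w assume v: "v \<in> support (F x)" and w: "w \<in> support (F x)" and eq: "snd v = snd w"
        obtain C j C' where vw: "v = (C, j)" "w = (C', j)" using eq by (cases v; cases w) auto
        show "v = w"
        proof (cases "j \<le> n")
          case True
          then have "v \<in> support (B x)" "w \<in> support (B x)"
            using v w by (auto simp: support_def F_def vw split: if_splits)
          then show ?thesis using B(3)[OF x] eq by (auto simp: orbit_join_def dest: inj_onD)
        next
          case False
          then have "(C, j - n) \<in> support (E (t x))" "(C', j - n) \<in> support (E (t x))"
            using v w W1[of _ j] by (auto simp: support_def F_def vw split: if_splits)
          moreover have "inj_on snd (support (E (t x)))" using E(2)[of "t x"] by (simp add: orbit_join_def)
          ultimately have "(C, j - n) = (C', j - n)"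
            using inj_onD[of snd "support (E (t x))" "(C, j - n)" "(C', j - n)"] by simp
          then show ?thesis by (simp add: vw)
        qed
      qed
      show "F x \<noteq> (\<lambda>_. 0)" if x: "x \<in> topspace X" for x
      proof
        assume F0: "F x = (\<lambda>_. 0)"
        have "B x w = 0" for w
        proof (cases "w \<in> orbit_vertices G n H1")
          case True
          then show ?thesis using fun_cong[OF F0, of w] by (simp add: F_def)
        next
          case False
          then show ?thesis using B(3)[OF x] by (auto simp: orbit_join_def support_def)
        qed
        moreover have "E (t x) (C, j) = 0" for C j
        proof (cases "(C, j) \<in> orbit_vertices G (r - 1) H2")
          case True
          then have "0 < j" by (auto simp: orbit_vertices_def)
          then show ?thesis using fun_cong[OF F0, of "(C, j + n)"] W1[of C "j + n"] by (simp add: F_def)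
        next
          case False
          then show ?thesis using E(2)[of "t x"] by (auto simp: orbit_join_def support_def)
        qed
        ultimately show False using Bt[OF x] E(4)[of "t x"] by (metis ext surj_pair)
      qed
      show "F (\<psi> g x) (C, j) = F x (inv\<^bsub>G\<^esub> g <#\<^bsub>G\<^esub> C, j)"
        if g: "g \<in> carrier G" and x: "x \<in> topspace X" and C: "(C, j) \<in> ?W" for g x C j
      proof -
        have C': "(inv\<^bsub>G\<^esub> g <#\<^bsub>G\<^esub> C, j) \<in> ?W"
          by (rule orbit_vertices_translate) (use G g H C in \<open>auto simp: group.inv_closed\<close>)
        show ?thesis
        proof (cases "j \<le> n")
          case True
          then show ?thesis using B(4)[OF g x, of C j] W1[of _ j] C C' by (simp add: F_def)
        next
          case False
          then show ?thesis
            using E(3)[where t = "t x" and t' = "t (\<psi> g x)" and C = C and j = "j - n", OF g t(2)[OF g x]] W1[of _ j] W2[of j C] C by (simp add: F_def)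
        qed
      qed
    qed (rule Fout)
  qed
qed

section \<open>A Borsuk-Ulam theorem for p-tori\<close>

text \<open>The deleted join of the full simplex is a join of copies of \<open>[r]\<close>, one for each vertex.\<close>
lemma deleted_join_Pow:
  "deleted_join r (Pow V) = {S. S \<subseteq> V \<times> {1..r} \<and> inj_on fst S}"
proof (intro equalityI subsetI)
  fix S assume "S \<in> deleted_join r (Pow V)"
  then obtain A where A: "S = (\<Union>i\<in>{1..r}. A i \<times> {i})" "\<forall>i\<in>{1..r}. A i \<in> Pow V" "disjoint_family_on A {1..r}"
    by (auto simp: deleted_join_def)
  have "inj_on fst S"
  proof (rule inj_onI)
    fix x y assume xy: "x \<in> S" "y \<in> S" "fst x = fst y"
    then obtain i j where ij: "i \<in> {1..r}" "x \<in> A i \<times> {i}" "j \<in> {1..r}" "y \<in> A j \<times> {j}"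
      unfolding A(1) by blast
    then have "fst x \<in> A i \<inter> A j" using xy(3) by auto
    then have "i = j" using disjoint_family_onD[OF A(3) ij(1,3)] by blast
    then show "x = y" using ij xy(3) by (auto simp: prod_eq_iff)
  qed
  then show "S \<in> {S. S \<subseteq> V \<times> {1..r} \<and> inj_on fst S}" using A by auto
next
  fix S assume S: "S \<in> {S. S \<subseteq> V \<times> {1..r} \<and> inj_on fst S}"
  define A where "A i = {v. (v, i) \<in> S}" for i
  have "disjoint_family_on A {1..r}"
  proof -
    have "i = j" if "(v, i) \<in> S" "(v, j) \<in> S" for v i j
      using inj_onD[of fst S "(v, i)" "(v, j)"] S that by simp
    then show ?thesis by (auto simp: disjoint_family_on_def A_def)
  qed
  moreover have "S = (\<Union>i\<in>{1..r}. A i \<times> {i})" using S by (auto simp: A_def)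
  moreover have "\<forall>i\<in>{1..r}. A i \<in> Pow V" using S by (auto simp: A_def)
  ultimately show "S \<in> deleted_join r (Pow V)" unfolding deleted_join_def by blast
qed

lemma deleted_join_mono: "K \<subseteq> L \<Longrightarrow> deleted_join r K \<subseteq> deleted_join r L"
  unfolding deleted_join_def by blast

lemma deleted_join_action_apply:
  "deleted_join_action G r \<phi> g x (v, i) = (if i \<in> {1..r} then x (v, \<phi> (inv\<^bsub>G\<^esub> g) i) else 0)"
  by (simp add: deleted_join_action_def simplicial_action_def)

text \<open>A point of the join of \<open>n\<close> orbits has at most \<open>n\<close> nonzero coordinates, so one of them is at least
\<open>1 / n\<close>; the first block where this happens singles out a vertex.  The choice only depends on the
blocks, which the group preserves, and this makes it equivariant.\<close>
definition leading_vertex :: "nat \<Rightarrow> ('a \<times> nat \<Rightarrow> real) \<Rightarrow> 'a \<times> nat" where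
  "leading_vertex n y = (let j = (LEAST j. \<exists>C. 1 / real n \<le> y (C, j)) in (SOME C. 1 / real n \<le> y (C, j), j))"

lemma leading_vertex:
  assumes y: "y \<in> topspace (realization (orbit_join G n H))"
  shows "0 < n" "1 / real n \<le> y (leading_vertex n y)" "leading_vertex n y \<in> orbit_vertices G n H"
proof -
  have supp: "support y \<subseteq> orbit_vertices G n H" "inj_on snd (support y)" "finite (support y)"
    and sum: "(\<Sum>v\<in>support y. y v) = 1"
    using y by (auto simp: realization_def orbit_join_def)
  have "snd ` support y \<subseteq> {1..n}" using supp(1) by (auto simp: orbit_vertices_def)
  then have card: "card (support y) \<le> n"
    using card_mono[of "{1..n}" "snd ` support y"] card_image[OF supp(2)] by simp
  have ne: "support y \<noteq> {}" using sum by auto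
  then have "0 < card (support y)" using supp(3) by (simp add: card_gt_0_iff)
  then show n: "0 < n" using card by simp
  have "\<exists>v\<in>support y. 1 / real n \<le> y v"
  proof (rule ccontr)
    assume "\<not> ?thesis"
    then have lt: "y v < 1 / real n" if "v \<in> support y" for v using that by (simp add: not_le)
    have "(\<Sum>v\<in>support y. y v) < (\<Sum>v\<in>support y. 1 / real n)"
      by (rule sum_strict_mono[OF supp(3) ne lt])
    also have "\<dots> \<le> 1" using card n by simp
    finally show False using sum by simp
  qed
  then obtain v where "1 / real n \<le> y (fst v, snd v)" by auto
  then have ex: "\<exists>j C. 1 / real n \<le> y (C, j)" by blast
  define j where "j = (LEAST j. \<exists>C. 1 / real n \<le> y (C, j))"
  have "\<exists>C. 1 / real n \<le> y (C, j)" unfolding j_def using ex by (rule LeastI_ex)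
  then have "1 / real n \<le> y (SOME C. 1 / real n \<le> y (C, j), j)" by (rule someI_ex)
  then show big: "1 / real n \<le> y (leading_vertex n y)"
    by (simp add: leading_vertex_def Let_def flip: j_def)
  have "0 < 1 / real n" using n by simp
  then have "leading_vertex n y \<in> support y" using big by (auto simp: support_def)
  then show "leading_vertex n y \<in> orbit_vertices G n H" using supp by blast
qed

lemma leading_vertex_action:
  assumes G: "group G" "g \<in> carrier G" and H: "\<forall>j\<in>{1..n}. subgroup (H j) G"
    and y: "y \<in> topspace (realization (orbit_join G n H))"
  shows "leading_vertex n (orbit_join_action G n H g y)
       = (g <#\<^bsub>G\<^esub> fst (leading_vertex n y), snd (leading_vertex n y))"
proof -
  let ?W = "orbit_vertices G n H" and ?y' = "orbit_join_action G n H g y"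
  have supp: "support y \<subseteq> ?W" "inj_on snd (support y)"
    using y by (auto simp: realization_def orbit_join_def)
  have pos: "0 < 1 / real n" using leading_vertex(1)[OF y] by simp
  have y': "1 / real n \<le> ?y' (C, j) \<longleftrightarrow> (\<exists>C'. C = g <#\<^bsub>G\<^esub> C' \<and> 1 / real n \<le> y (C', j))" for C j
  proof
    assume a: "1 / real n \<le> ?y' (C, j)"
    then have "(C, j) \<in> ?W" using pos by (auto simp: orbit_join_action_apply split: if_splits)
    then have "C = g <#\<^bsub>G\<^esub> (inv\<^bsub>G\<^esub> g <#\<^bsub>G\<^esub> C)" "1 / real n \<le> y (inv\<^bsub>G\<^esub> g <#\<^bsub>G\<^esub> C, j)"
      using a orbit_vertices_subset(1)[OF G(1) H] translate_inv[OF G]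
      by (auto simp: orbit_join_action_apply)
    then show "\<exists>C'. C = g <#\<^bsub>G\<^esub> C' \<and> 1 / real n \<le> y (C', j)" by blast
  next
    assume "\<exists>C'. C = g <#\<^bsub>G\<^esub> C' \<and> 1 / real n \<le> y (C', j)"
    then obtain C' where C': "C = g <#\<^bsub>G\<^esub> C'" "1 / real n \<le> y (C', j)" by blast
    then have "(C', j) \<in> ?W" using pos supp(1) by (auto simp: support_def)
    then show "1 / real n \<le> ?y' (C, j)"
      using C' orbit_vertices_translate[OF G(1) H G(2)] orbit_vertices_subset(1)[OF G(1) H] translate_inv[OF G]
      by (auto simp: orbit_join_action_apply)
  qed
  define j where "j = (LEAST j. \<exists>C. 1 / real n \<le> y (C, j))"
  have j': "(LEAST j. \<exists>C. 1 / real n \<le> ?y' (C, j)) = j" unfolding y' j_def by metis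
  have lv: "leading_vertex n y = (SOME C. 1 / real n \<le> y (C, j), j)"
    by (simp add: leading_vertex_def Let_def j_def)
  define C where "C = fst (leading_vertex n y)"
  have Cj: "leading_vertex n y = (C, j)" by (simp add: C_def lv)
  have big: "1 / real n \<le> y (C, j)" using leading_vertex(2)[OF y] by (simp add: Cj)
  have uniq: "C' = C" if "1 / real n \<le> y (C', j)" for C'
  proof -
    have "(C, j) \<in> support y" "(C', j) \<in> support y" using that big pos by (auto simp: support_def)
    then show ?thesis using inj_onD[OF supp(2), of "(C', j)" "(C, j)"] by simp
  qed
  have "(SOME C'. 1 / real n \<le> ?y' (C', j)) = g <#\<^bsub>G\<^esub> C"
  proof (rule some_equality)
    show "1 / real n \<le> ?y' (g <#\<^bsub>G\<^esub> C, j)" using big y' by blast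
    show "C' = g <#\<^bsub>G\<^esub> C" if "1 / real n \<le> ?y' (C', j)" for C' using that y' uniq by blast
  qed
  then have "leading_vertex n ?y' = (g <#\<^bsub>G\<^esub> C, j)"
    by (simp only: leading_vertex_def Let_def j')
  then show ?thesis by (simp add: Cj)
qed

lemma orbit_vertices_moved:
  assumes "group G" "\<forall>j\<in>{1..n}. subgroup (H j) G \<and> H j \<noteq> carrier G" "(C, j) \<in> orbit_vertices G n H"
  shows "\<exists>g\<in>carrier G. g <#\<^bsub>G\<^esub> C \<noteq> C"
proof -
  interpret group G by fact
  obtain a where a: "a \<in> carrier G" "C = a <#\<^bsub>G\<^esub> H j" and j: "j \<in> {1..n}"
    using assms(3) by (auto simp: orbit_vertices_def LCOSETS_def)
  have H: "subgroup (H j) G" "H j \<noteq> carrier G" using assms(2) j by auto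
  obtain x where x: "x \<in> carrier G" "x \<notin> H j" using H subgroup.subset[OF H(1)] by blast
  let ?g = "a \<otimes>\<^bsub>G\<^esub> x \<otimes>\<^bsub>G\<^esub> inv\<^bsub>G\<^esub> a"
  have "?g \<otimes>\<^bsub>G\<^esub> a \<in> ?g <#\<^bsub>G\<^esub> C"
    using lcos_self[OF a(1) H(1)] unfolding a(2)[symmetric] by (unfold l_coset_def[of G ?g]) blast
  moreover have "?g \<otimes>\<^bsub>G\<^esub> a = a \<otimes>\<^bsub>G\<^esub> x" using a x by (simp add: m_assoc)
  moreover have "a \<otimes>\<^bsub>G\<^esub> x \<notin> C"
  proof
    assume "a \<otimes>\<^bsub>G\<^esub> x \<in> C"
    then obtain y where "y \<in> H j" "a \<otimes>\<^bsub>G\<^esub> x = a \<otimes>\<^bsub>G\<^esub> y" using a(2) by (auto simp: l_coset_def)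
    then show False using a x subgroup.mem_carrier[OF H(1)] by auto
  qed
  ultimately have "?g <#\<^bsub>G\<^esub> C \<noteq> C" by metis
  moreover have "?g \<in> carrier G" using a x by simp
  ultimately show ?thesis by blast
qed

text \<open>All elements of the group serve as generators: they commute, have order dividing \<open>p\<close>, and together
move every coset of a proper subgroup.  The leading vertex of \<open>f x\<close> labels \<open>x\<close>.  Labels near a point
are consistent: a coordinate that is at least \<open>1 / n\<close> at one point stays positive at points with
nearby images, and a point has only one positive coordinate in each block.  The apexes of the cones are
the points 1 of the successive copies of \<open>[r]\<close>.\<close>
theorem no_map_from_join_of_free_orbits:
  assumes prime: "prime p" and torus: "p_torus p k G"
    and act: "group_action G {1..r} \<phi>" and r: "1 \<le> r"
    and H: "\<forall>j\<in>{1..n}. subgroup (H j) G \<and> H j \<noteq> carrier G"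
    and f: "continuous_map (realization (deleted_join r (Pow {1..m}))) (realization (orbit_join G n H)) f"
    and equi: "\<And>g x. g \<in> carrier G \<Longrightarrow> x \<in> topspace (realization (deleted_join r (Pow {1..m}))) \<Longrightarrow>
       f (deleted_join_action G r \<phi> g x) = orbit_join_action G n H g (f x)"
  shows "m \<le> n"
proof (rule ccontr)
  assume "\<not> m \<le> n"
  then have nm: "n < m" by simp
  have p0: "0 < p" using prime prime_gt_0_nat by blast
  interpret group G using torus by (simp add: p_torus_def)
  interpret act: group_action G "{1..r}" \<phi> by fact
  have G: "group G" "finite (carrier G)"
    using torus p_torus_finite[OF torus p0] by (auto simp: p_torus_def)
  have H': "\<forall>j\<in>{1..n}. subgroup (H j) G" using H by blast
  let ?K = "deleted_join r (Pow {1..m})" and ?W = "orbit_vertices G n H"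
  let ?X = "realization ?K"
  obtain gs where gs: "set gs = carrier G" using finite_list[OF G(2)] by blast
  define b where "b g w = (if snd w \<in> {1..r} then (fst w, \<phi> g (snd w)) else w)" for g and w :: "nat \<times> nat"
  define c where "c g w = (if w \<in> ?W then (g <#\<^bsub>G\<^esub> fst w, snd w) else w)" for g and w :: "'a set \<times> nat"
  define \<L> where "\<L> l = {xs. l \<le> m \<and> map fst xs = rev [1..<Suc l] \<and> snd ` set xs \<subseteq> {1..r}}" for l :: nat
  have \<phi>: "\<phi> g i \<in> {1..r}" if "g \<in> carrier G" "i \<in> {1..r}" for g i
    using act.element_image[OF that] by simp
  have \<phi>1: "\<phi> \<one>\<^bsub>G\<^esub> i = i" if "i \<in> {1..r}" for i
    using fun_cong[OF act.id_eq_one, of i] that by simp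
  have \<phi>m: "\<phi> (g \<otimes>\<^bsub>G\<^esub> h) i = \<phi> g (\<phi> h i)" if "i \<in> {1..r}" "g \<in> carrier G" "h \<in> carrier G" for g h i
    by (rule act.composition_rule[OF that])
  have WC: "fst w \<subseteq> carrier G" if "w \<in> ?W" for w
    using orbit_vertices_subset(1)[OF G(1) H', of "fst w" "snd w"] that by simp
  have Wg: "(g <#\<^bsub>G\<^esub> fst w, snd w) \<in> ?W" if "w \<in> ?W" "g \<in> carrier G" for g w
    using orbit_vertices_translate[OF G(1) H' that(2), of "fst w" "snd w"] that(1) by simp
  have bpow: "(b g ^^ i) w = (if snd w \<in> {1..r} then (fst w, \<phi> (g [^]\<^bsub>G\<^esub> i) (snd w)) else w)"
    if g: "g \<in> carrier G" for g i w
  proof (induction i)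
    case (Suc i)
    have "g [^]\<^bsub>G\<^esub> Suc i = g \<otimes>\<^bsub>G\<^esub> (g [^]\<^bsub>G\<^esub> i)" using g by (rule nat_pow_Suc2)
    then show ?case using Suc \<phi>[of "g [^]\<^bsub>G\<^esub> i" "snd w"] \<phi>m[of "snd w" g "g [^]\<^bsub>G\<^esub> i"] g
      by (simp add: b_def)
  qed (simp add: \<phi>1)
  have cpow: "(c g ^^ i) w = (if w \<in> ?W then ((g [^]\<^bsub>G\<^esub> i) <#\<^bsub>G\<^esub> fst w, snd w) else w)"
    if g: "g \<in> carrier G" for g i w
  proof (induction i)
    case 0
    then show ?case using WC[of w] by (simp add: lcos_mult_one)
  next
    case (Suc i)
    have "g [^]\<^bsub>G\<^esub> Suc i = g \<otimes>\<^bsub>G\<^esub> (g [^]\<^bsub>G\<^esub> i)" using g by (rule nat_pow_Suc2)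
    then show ?case using Suc Wg[of w "g [^]\<^bsub>G\<^esub> i"] WC[of w] g
      by (simp add: c_def lcos_m_assoc)
  qed
  have comm: "g \<otimes>\<^bsub>G\<^esub> h = h \<otimes>\<^bsub>G\<^esub> g" if "g \<in> carrier G" "h \<in> carrier G" for g h
    using p_torus_exponent(2)[OF torus p0 that] .
  show False
  proof (rule no_equivariant_map_to_small_join[OF prime, where K = ?K and gs = gs and b = b and c = c
        and T = "\<lambda>g. deleted_join_action G r \<phi> g" and W = ?W and n = n
        and lab = "\<lambda>x. leading_vertex n (f x)" and L = \<L> and a = "\<lambda>l. (Suc l, 1)"])
    show "finite ?K"
      by (rule finite_subset[of _ "Pow ({1..m} \<times> {1..r})"]) (auto simp: deleted_join_Pow)
    show "finite A" if "A \<in> ?K" for A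
      by (rule finite_subset[of _ "{1..m} \<times> {1..r}"]) (use that in \<open>auto simp: deleted_join_Pow\<close>)
    show "B \<in> ?K" if "A \<in> ?K" "B \<subseteq> A" for A B
      using that by (auto simp: deleted_join_Pow intro: inj_on_subset)
    show "(b g ^^ p) v = v" if "g \<in> set gs" for g v
      using that gs p_torus_exponent(1)[OF torus p0] by (simp add: bpow \<phi>1)
    show "b h (b g v) = b g (b h v)" if "g \<in> set gs" "h \<in> set gs" for g h v
    proof (cases "snd v \<in> {1..r}")
      case True
      have gh: "g \<in> carrier G" "h \<in> carrier G" using that gs by auto
      show ?thesis
        using True \<phi>[OF gh(1) True] \<phi>[OF gh(2) True] \<phi>m[OF True gh] \<phi>m[OF True gh(2,1)] comm[OF gh]
        by (simp add: b_def)
    next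
      case False
      then have "b x v = v" for x by (simp only: b_def if_False)
      then show ?thesis by simp
    qed
    show "b g ` A \<in> ?K" if g: "g \<in> set gs" and A: "A \<in> ?K" for g A
    proof -
      have gG: "g \<in> carrier G" using g gs by simp
      have sub: "A \<subseteq> {1..m} \<times> {1..r}" and inj: "inj_on fst A" using A by (auto simp: deleted_join_Pow)
      have "b g ` A \<subseteq> {1..m} \<times> {1..r}"
      proof
        fix w assume "w \<in> b g ` A"
        then obtain v where v: "v \<in> A" "w = b g v" by blast
        then have "fst v \<in> {1..m}" "snd v \<in> {1..r}" using sub by auto
        then show "w \<in> {1..m} \<times> {1..r}" using v(2) \<phi>[OF gG, of "snd v"] by (simp add: b_def)
      qed
      moreover have "inj_on fst (b g ` A)"
      proof (rule inj_onI)
        fix x y assume xy: "x \<in> b g ` A" "y \<in> b g ` A" "fst x = fst y"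
        obtain v w where vw: "v \<in> A" "w \<in> A" "x = b g v" "y = b g w" using xy(1,2) by blast
        have "fst (b g w) = fst w" for w by (simp add: b_def)
        then have "fst v = fst w" using xy(3) unfolding vw(3,4) by metis
        then show "x = y" using inj_onD[OF inj, of v w] vw by simp
      qed
      ultimately show ?thesis by (simp add: deleted_join_Pow)
    qed
    show "affine_simplex (map (b g) l) x = deleted_join_action G r \<phi> g (affine_simplex l x)"
      if g: "g \<in> set gs" and l: "set l \<in> ?K" "l \<noteq> []" and x: "x \<in> standard_simplex (length l - 1)" for g l x
    proof
      fix w :: "nat \<times> nat"
      obtain v i where w: "w = (v, i)" by (cases w)
      have gG: "g \<in> carrier G" using g gs by simp
      have eq: "w = b g (l ! j) \<longleftrightarrow> i \<in> {1..r} \<and> (v, \<phi> (inv\<^bsub>G\<^esub> g) i) = l ! j" if j: "j \<le> length l - 1" for j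
      proof -
        have "l ! j \<in> set l" using j l(2) by (cases l) (auto simp: nth_Cons' intro!: nth_mem)
        then have s: "snd (l ! j) \<in> {1..r}" using l(1) by (auto simp: deleted_join_Pow)
        have b: "b g (l ! j) = (fst (l ! j), \<phi> g (snd (l ! j)))" using s by (simp add: b_def)
        have 1: "\<phi> (inv\<^bsub>G\<^esub> g) (\<phi> g (snd (l ! j))) = snd (l ! j)"
          using \<phi>m[OF s, of "inv\<^bsub>G\<^esub> g" g] gG \<phi>1[OF s] by simp
        have 2: "\<phi> g (\<phi> (inv\<^bsub>G\<^esub> g) i) = i" if "i \<in> {1..r}"
          using \<phi>m[OF that, of g "inv\<^bsub>G\<^esub> g"] gG \<phi>1[OF that] by simp
        show ?thesis
          unfolding b w using 1 2 \<phi>[OF gG s] by (metis fst_conv prod.collapse snd_conv)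
      qed
      show "affine_simplex (map (b g) l) x w = deleted_join_action G r \<phi> g (affine_simplex l x) w"
      proof -
        have "affine_simplex (map (b g) l) x w = (\<Sum>j\<le>length l - 1. (if w = b g (l ! j) then 1 else 0) * x j)"
        proof -
          have "j < length l" if "j \<le> length l - 1" for j using that l(2) by (cases l) auto
          then show ?thesis using x by (simp add: affine_simplex_def oriented_simplex_def)
        qed
        also have "\<dots> = (\<Sum>j\<le>length l - 1. (if i \<in> {1..r} \<and> (v, \<phi> (inv\<^bsub>G\<^esub> g) i) = l ! j then 1 else 0) * x j)"
          by (rule sum.cong) (use eq in auto)
        also have "\<dots> = deleted_join_action G r \<phi> g (affine_simplex l x) w"
          using x by (cases "i \<in> {1..r}")
            (auto simp: w deleted_join_action_apply affine_simplex_def oriented_simplex_def intro!: sum.neutral)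
        finally show ?thesis .
      qed
    qed
    show "(c g ^^ p) w = w" if "g \<in> set gs" for g w
      using that gs p_torus_exponent(1)[OF torus p0] WC[of w] by (simp add: cpow lcos_mult_one)
    show "snd (c g w) = snd w" for g w by (simp add: c_def)
    show "c h (c g w) = c g (c h w)" if "g \<in> set gs" "h \<in> set gs" for g h w
    proof (cases "w \<in> ?W")
      case True
      have gh: "g \<in> carrier G" "h \<in> carrier G" using that gs by auto
      show ?thesis
        using True Wg[OF True gh(1)] Wg[OF True gh(2)] WC[OF True] gh comm[OF gh]
        by (simp add: c_def lcos_m_assoc)
    qed (simp add: c_def)
    show "c g w \<in> ?W" if "g \<in> set gs" "w \<in> ?W" for g w
      using Wg[OF that(2)] that gs by (simp add: c_def)
    show "\<exists>g\<in>set gs. c g w \<noteq> w" if w: "w \<in> ?W" for w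
    proof -
      obtain g where "g \<in> carrier G" "g <#\<^bsub>G\<^esub> fst w \<noteq> fst w"
        using orbit_vertices_moved[OF G(1) H, of "fst w" "snd w"] w by auto
      then show ?thesis using w gs by (intro bexI[of _ g]) (auto simp: c_def prod_eq_iff)
    qed
    show "snd ` ?W \<subseteq> {1..n}" by (auto simp: orbit_vertices_def)
    have fx: "f x \<in> topspace (realization (orbit_join G n H))" if "x \<in> topspace ?X" for x
      using f that by (auto simp: continuous_map_def)
    show "leading_vertex n (f x) \<in> ?W" if "x \<in> topspace ?X" for x
      by (rule leading_vertex(3)[OF fx[OF that]])
    show "leading_vertex n (f (deleted_join_action G r \<phi> g x)) = c g (leading_vertex n (f x))"
      if g: "g \<in> set gs" and x: "x \<in> topspace ?X" for g x
    proof -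
      have gG: "g \<in> carrier G" using g gs by simp
      show ?thesis
        using leading_vertex_action[OF G(1) gG H' fx[OF x]] leading_vertex(3)[OF fx[OF x]]
        unfolding equi[OF gG x] by (simp add: c_def)
    qed
    show "\<exists>U. openin ?X U \<and> x \<in> U \<and> inj_on snd ((\<lambda>x. leading_vertex n (f x)) ` U)"
      if x: "x \<in> topspace ?X" for x
    proof -
      let ?\<epsilon> = "1 / (2 * real n)"
      define U where "U = topspace ?X \<inter> (\<Inter>w\<in>?W. {x' \<in> topspace ?X. f x' w \<in> ball (f x w) ?\<epsilon>})"
      have n: "0 < n" by (rule leading_vertex(1)[OF fx[OF x]])
      have "openin ?X U"
      proof (cases "?W = {}")
        case False
        have "openin ?X (\<Inter>w\<in>?W. {x' \<in> topspace ?X. f x' w \<in> ball (f x w) ?\<epsilon>})"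
        proof (rule openin_INT2)
          show "openin ?X {x' \<in> topspace ?X. f x' w \<in> ball (f x w) ?\<epsilon>}" for w
            by (rule openin_continuous_map_preimage[OF continuous_map_coordinate[OF f]]) simp
        qed (use False finite_orbit_vertices[OF G(2)] in auto)
        then show ?thesis unfolding U_def by blast
      qed (simp add: U_def)
      moreover have "x \<in> U" using x n by (simp add: U_def)
      moreover have "inj_on snd ((\<lambda>x. leading_vertex n (f x)) ` U)"
      proof (rule inj_onI)
        fix v w assume v: "v \<in> (\<lambda>x. leading_vertex n (f x)) ` U" and w: "w \<in> (\<lambda>x. leading_vertex n (f x)) ` U"
          and eq: "snd v = snd w"
        obtain y where y: "y \<in> U" "v = leading_vertex n (f y)" using v by blast
        obtain z where z: "z \<in> U" "w = leading_vertex n (f z)" using w by blast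
        have top: "y \<in> topspace ?X" "z \<in> topspace ?X" using y z by (auto simp: U_def)
        have vW: "v \<in> ?W" "1 / real n \<le> f y v" using leading_vertex(2,3)[OF fx[OF top(1)]] y by auto
        have wW: "w \<in> ?W" "1 / real n \<le> f z w" using leading_vertex(2,3)[OF fx[OF top(2)]] z by auto
        have "\<bar>f x v - f y v\<bar> < ?\<epsilon>" "\<bar>f x v - f z v\<bar> < ?\<epsilon>"
          using y(1) z(1) vW(1) by (auto simp: U_def dist_real_def)
        moreover have "1 / real n = ?\<epsilon> + ?\<epsilon>" by (simp add: field_simps)
        ultimately have "0 < f z v" using vW(2) by linarith
        moreover have "0 < f z w" using wW(2) n by (meson divide_pos_pos less_le_trans of_nat_0_less_iff zero_less_one)
        moreover have "inj_on snd (support (f z))" using fx[OF top(2)] by (auto simp: realization_def orbit_join_def)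
        ultimately show "v = w" using eq by (auto simp: support_def dest: inj_onD)
      qed
      ultimately show ?thesis by blast
    qed
    show "[] \<in> \<L> 0" by (simp add: \<L>_def)
    show "(Suc l, 1) # xs \<in> \<L> (Suc l)" if "l \<le> n" "xs \<in> \<L> l" for l xs
      using that nm r by (auto simp: \<L>_def)
    show "map (b g) xs \<in> \<L> l" if g: "g \<in> set gs" and xs: "xs \<in> \<L> l" for l xs g
    proof -
      have "map fst (map (b g) xs) = map fst xs" by (simp add: b_def)
      moreover have "snd ` set (map (b g) xs) \<subseteq> {1..r}"
      proof
        fix i assume "i \<in> snd ` set (map (b g) xs)"
        then obtain w where w: "w \<in> set xs" "i = snd (b g w)" by auto
        then have "snd w \<in> {1..r}" using xs by (auto simp: \<L>_def)
        then show "i \<in> {1..r}" using w(2) \<phi>[of g "snd w"] g gs by (simp add: b_def)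
      qed
      ultimately show ?thesis
        using xs unfolding \<L>_def mem_Collect_eq by metis
    qed
    show "length xs = l \<and> set xs \<in> ?K" if "xs \<in> \<L> l" for l xs
    proof
      have fsts: "map fst xs = rev [1..<Suc l]" and l: "l \<le> m" and snds: "snd ` set xs \<subseteq> {1..r}"
        using that by (auto simp: \<L>_def)
      show "length xs = l" using arg_cong[OF fsts, of length] by simp
      have "distinct (map fst xs)" unfolding fsts by simp
      then have "inj_on fst (set xs)" by (simp add: distinct_map)
      moreover have "fst ` set xs = {1..<Suc l}"
        using arg_cong[OF fsts, of set] by (simp del: upt_Suc)
      then have "fst ` set xs \<subseteq> {1..m}" using l by auto
      ultimately show "set xs \<in> ?K" using snds by (force simp: deleted_join_Pow)
    qed
  qed
qed

section \<open>The two inequalities\<close>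

text \<open>The factor \<open>a\<close> forces the product to 0 where the bounded function \<open>g\<close> ceases to be continuous.\<close>
lemma continuous_on_scaled:
  fixes a g :: "'x::topological_space \<Rightarrow> real"
  assumes a: "continuous_on S a" "\<And>x. x \<in> S \<Longrightarrow> 0 \<le> a x"
    and g: "continuous_on {x\<in>S. 0 < a x} g" "\<And>x. x \<in> S \<Longrightarrow> 0 < a x \<Longrightarrow> \<bar>g x\<bar> \<le> 1"
  shows "continuous_on S (\<lambda>x. a x * g x)"
  unfolding continuous_on_def
proof
  fix x assume x: "x \<in> S"
  show "((\<lambda>x. a x * g x) \<longlongrightarrow> a x * g x) (at x within S)"
  proof (cases "a x = 0")
    case True
    have lim: "(a \<longlongrightarrow> 0) (at x within S)"
      using a(1) x True by (auto simp: continuous_on_def)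
    have "((\<lambda>x. a x * g x) \<longlongrightarrow> 0) (at x within S)"
    proof (rule Lim_null_comparison[OF _ lim])
      have "norm (a y * g y) \<le> a y" if "y \<in> S" for y
        using a(2)[OF that] g(2)[OF that] by (cases "a y = 0") (auto simp: abs_mult mult_left_le)
      then show "\<forall>\<^sub>F y in at x within S. norm (a y * g y) \<le> a y"
        by (auto simp: eventually_at_filter)
    qed
    then show ?thesis using True by simp
  next
    case False
    then have pos: "0 < a x" using a(2)[OF x] by simp
    have "\<forall>B. open B \<longrightarrow> (\<exists>U. open U \<and> U \<inter> S = a -` B \<inter> S)"
      using a(1) by (simp only: continuous_on_open_invariant)
    from this[rule_format, OF open_greaterThan[of 0]]
    obtain U where U: "open U" "U \<inter> S = a -` {0<..} \<inter> S" by blast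
    have "x \<in> U" using U(2) x pos by auto
    have "at x within S = at x within {y\<in>S. 0 < a y}"
      by (rule at_within_nhd[OF \<open>x \<in> U\<close> U(1)]) (use U(2) in auto)
    moreover have "continuous_on {y\<in>S. 0 < a y} (\<lambda>x. a x * g x)"
      by (intro continuous_on_mult g(1) continuous_on_subset[OF a(1)]) auto
    ultimately show ?thesis
      using x pos by (auto simp: continuous_on_def)
  qed
qed

definition realization_points :: "'v set set \<Rightarrow> ('v \<Rightarrow> real) set" where
  "realization_points K = {x. (\<forall>v. 0 \<le> x v) \<and> finite (support x) \<and> support x \<in> K \<and> (\<Sum>v\<in>support x. x v) = 1}"

lemma realization_top_of_set: "realization K = top_of_set (realization_points K)"
  by (simp add: realization_def realization_points_def euclidean_product_topology)

lemma topspace_realization [simp]: "topspace (realization K) = realization_points K"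
  by (simp add: realization_top_of_set)

lemma realization_coordinate_le_1:
  assumes "x \<in> realization_points K"
  shows "0 \<le> x v" "x v \<le> 1"
proof -
  show "0 \<le> x v" using assms by (simp add: realization_points_def)
  have "x v \<le> (\<Sum>v\<in>support x. x v)" if "v \<in> support x"
    using that assms by (intro member_le_sum) (auto simp: realization_points_def)
  then show "x v \<le> 1" using assms by (cases "v \<in> support x") (auto simp: realization_points_def support_def)
qed

lemma sum_realization:
  assumes "x \<in> realization_points K" "support x \<subseteq> V" "finite V"
  shows "(\<Sum>v\<in>V. x v) = 1"
proof -
  have "(\<Sum>v\<in>support x. x v) = (\<Sum>v\<in>V. x v)"
    by (rule sum.mono_neutral_left) (use assms in \<open>auto simp: support_def\<close>)
  then show ?thesis using assms(1) by (simp add: realization_points_def)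
qed

text \<open>In terms of \<open>genus_le_join\<close>: \<open>t\<close> is the vector of the weights of the \<open>r\<close> parts of a point, \<open>a\<close> is the
smallest weight, and \<open>\<rho>\<close> rescales the parts to a point of the deleted product where \<open>a\<close> is positive.\<close>
lemma genus_deleted_join_le:
  fixes K :: "nat set set"
  assumes prime: "prime p" and k: "1 \<le> k" and r: "r = p ^ k"
    and K: "complex_within {1..m} K"
    and torus: "p_torus p k G" and free: "free_action G {1..r} \<phi>"
    and gen: "genus G (deleted_product r K) (deleted_product_action G r \<phi>) = enat n"
  shows "genus G (realization (deleted_join r K)) (deleted_join_action G r \<phi>) \<le> enat (n + (r - 1))"
proof -
  let ?J = "deleted_join r K" and ?P = "deleted_product r K"
  let ?X = "realization ?J" and ?\<psi> = "deleted_join_action G r \<phi>"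
  let ?S = "realization_points ?J"
  have p0: "0 < p" using prime prime_gt_0_nat by blast
  then have r0: "1 \<le> r" using r by simp
  interpret group G using torus by (simp add: p_torus_def)
  interpret act: group_action G "{1..r}" \<phi> using free by (simp add: free_action_def)
  obtain H f where H: "\<forall>j\<in>{1..n}. subgroup (H j) G \<and> H j \<noteq> carrier G"
    and f: "continuous_map ?P (realization (orbit_join G n H)) f"
    and equi: "\<And>g x. g \<in> carrier G \<Longrightarrow> x \<in> topspace ?P \<Longrightarrow>
        f (deleted_product_action G r \<phi> g x) = orbit_join_action G n H g (f x)"
    using genus_witness[OF gen] by metis
  have K': "deleted_join r K \<subseteq> deleted_join r (Pow {1..m})"
    using K by (intro deleted_join_mono) (simp add: complex_within_def)
  have supp: "support x \<subseteq> {1..m} \<times> {1..r}" "inj_on fst (support x)" if "x \<in> ?S" for x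
    using that K' by (auto simp: realization_points_def deleted_join_Pow)
  define t where "t x i = (\<Sum>v\<in>{1..m}. x (v, i))" for x :: "nat \<times> nat \<Rightarrow> real" and i
  define a where "a x = Min ((\<lambda>i. t x i) ` {1..r})" for x
  define \<rho> where "\<rho> x = (\<lambda>i\<in>{1..r}. \<lambda>v. x (v, i) / t x i)" for x :: "nat \<times> nat \<Rightarrow> real"
  define B where "B x w = a x * f (\<rho> x) w" for x w
  have t0: "0 \<le> t x i" if "x \<in> ?S" for x i
    unfolding t_def by (intro sum_nonneg) (use realization_coordinate_le_1[OF that] in auto)
  have a0: "0 \<le> a x" if "x \<in> ?S" for x
    unfolding a_def using t0[OF that] r0 by (subst Min_ge_iff) auto
  have at: "a x \<le> t x i" if "i \<in> {1..r}" for x i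
    unfolding a_def using that by (intro Min_le) auto
  have \<rho>_in: "\<rho> x \<in> topspace ?P" if x: "x \<in> ?S" and pos: "0 < a x" for x
  proof -
    have tpos: "0 < t x i" if "i \<in> {1..r}" for i using at[OF that] pos by (meson less_le_trans)
    obtain A where A: "support x = (\<Union>i\<in>{1..r}. A i \<times> {i})" "\<forall>i\<in>{1..r}. A i \<in> K" "disjoint_family_on A {1..r}"
      using x by (auto simp: realization_points_def deleted_join_def)
    have sA: "support (\<rho> x i) = A i" if i: "i \<in> {1..r}" for i
    proof -
      have "support (\<rho> x i) = {v. (v, i) \<in> support x}"
        using i tpos[OF i] by (auto simp: support_def \<rho>_def)
      also have "\<dots> = A i" unfolding A(1) using i by auto
      finally show ?thesis .
    qed
    have Am: "A i \<subseteq> {1..m}" if "i \<in> {1..r}" for i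
    proof -
      have "A i \<in> K" using A(2) that by blast
      then show ?thesis using K unfolding complex_within_def by blast
    qed
    have "\<rho> x i \<in> realization_points K" if i: "i \<in> {1..r}" for i
    proof -
      have "(\<Sum>v\<in>A i. \<rho> x i v) = (\<Sum>v\<in>{1..m}. \<rho> x i v)"
        by (rule sum.mono_neutral_left) (use Am[OF i] sA[OF i] in \<open>auto simp: support_def\<close>)
      also have "\<dots> = 1" using i tpos[OF i] by (simp add: \<rho>_def t_def flip: sum_divide_distrib)
      finally show ?thesis
        using A(2) i tpos[OF i] finite_subset[OF Am[OF i]] realization_coordinate_le_1(1)[OF x]
        unfolding realization_points_def by (simp add: sA[OF i]) (simp add: \<rho>_def)
    qed
    moreover have "disjoint_family_on (\<lambda>i. support (\<rho> x i)) {1..r}"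
      using A(3) sA by (simp add: disjoint_family_on_def)
    ultimately show ?thesis by (auto simp: deleted_product_def \<rho>_def)
  qed
  have cont_x: "continuous_map ?X euclideanreal (\<lambda>x. x w)" for w
    using continuous_map_coordinate[of ?X ?J id] by simp
  have cont_t: "continuous_map ?X euclideanreal (\<lambda>x. t x i)" for i
    unfolding t_def by (intro continuous_map_sum cont_x) auto
  have cont_a: "continuous_map ?X euclideanreal a"
    unfolding a_def using cont_t r0 by (intro continuous_map_Min) auto
  have cont_\<rho>: "continuous_map (top_of_set {x\<in>?S. 0 < a x}) ?P \<rho>"
  proof -
    let ?X' = "top_of_set {x\<in>?S. 0 < a x}"
    have sub: "continuous_map ?X' euclideanreal h" if "continuous_map ?X euclideanreal h" for h
      using that by (auto simp: realization_top_of_set intro: continuous_on_subset)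
    have "continuous_map ?X' (realization K) (\<lambda>x. \<rho> x i)" if i: "i \<in> {1..r}" for i
      unfolding realization_def continuous_map_in_subtopology continuous_map_componentwise_UNIV
    proof (intro conjI allI)
      fix v
      have "continuous_map ?X' euclideanreal (\<lambda>x. x (v, i) / t x i)"
      proof (intro continuous_map_real_divide sub cont_x cont_t)
        show "t x i \<noteq> 0" if "x \<in> topspace ?X'" for x using that at[OF i, of x] by auto
      qed
      then show "continuous_map ?X' euclideanreal (\<lambda>x. \<rho> x i v)" using i by (simp add: \<rho>_def)
    next
      show "(\<lambda>x. \<rho> x i) \<in> topspace ?X' \<rightarrow> {x. (\<forall>v. 0 \<le> x v) \<and> finite (support x) \<and> support x \<in> K \<and> (\<Sum>v\<in>support x. x v) = 1}"
        using \<rho>_in i by (fastforce simp: deleted_product_def realization_points_def PiE_iff)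
    qed
    then have "continuous_map ?X' (product_topology (\<lambda>_. realization K) {1..r}) \<rho>"
      unfolding continuous_map_componentwise by (auto simp: \<rho>_def)
    then show ?thesis
      using \<rho>_in unfolding deleted_product_def continuous_map_in_subtopology by auto
  qed
  have f_in: "f (\<rho> x) \<in> realization_points (orbit_join G n H)" if "x \<in> ?S" "0 < a x" for x
    using f \<rho>_in[OF that] by (auto simp: continuous_map_def)
  show ?thesis
  proof (rule genus_le_join[OF prime k r torus free H, where B = B and t = t])
    show "continuous_map ?X euclideanreal (\<lambda>x. B x w)" for w
    proof -
      have "continuous_map (top_of_set {x\<in>?S. 0 < a x}) euclideanreal (\<lambda>x. f (\<rho> x) w)"
        using continuous_map_coordinate[OF continuous_map_compose[OF cont_\<rho> f]] by (simp add: comp_def)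
      then have "continuous_on ?S (\<lambda>x. a x * f (\<rho> x) w)"
        using cont_a a0 realization_coordinate_le_1[OF f_in]
        by (intro continuous_on_scaled) (auto simp: realization_top_of_set)
      then show ?thesis by (simp add: B_def realization_top_of_set)
    qed
    show "0 \<le> B x w" if "x \<in> topspace ?X" for x w
    proof (cases "a x = 0")
      case False
      then have "0 < a x" using a0[of x] that by simp
      then show ?thesis using realization_coordinate_le_1(1)[OF f_in] that by (simp add: B_def)
    qed (simp add: B_def)
    show "support (B x) \<in> orbit_join G n H" if x: "x \<in> topspace ?X" for x
    proof (cases "a x = 0")
      case True
      then show ?thesis by (simp add: B_def support_def orbit_join_def)
    next
      case False
      then have "0 < a x" using a0[of x] x by simp
      then have "support (f (\<rho> x)) \<in> orbit_join G n H"
        using f_in[of x] x by (simp add: realization_points_def)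
      moreover have "support (B x) = support (f (\<rho> x))" using False by (simp add: B_def support_def)
      ultimately show ?thesis by simp
    qed
    have tg: "t (?\<psi> g x) i = t x (\<phi> (inv\<^bsub>G\<^esub> g) i)" if "i \<in> {1..r}" for g x i
      using that by (simp add: t_def deleted_join_action_apply)
    then show "t (?\<psi> g x) i = t x (\<phi> (inv\<^bsub>G\<^esub> g) i)" if "i \<in> {1..r}" for g x i using that .
    show "B (?\<psi> g x) (C, j) = B x (inv\<^bsub>G\<^esub> g <#\<^bsub>G\<^esub> C, j)"
      if g: "g \<in> carrier G" and x: "x \<in> topspace ?X" and C: "(C, j) \<in> orbit_vertices G n H" for g x C j
    proof -
      have "(\<lambda>i. t (?\<psi> g x) i) ` {1..r} = (\<lambda>i. t x i) ` \<phi> (inv\<^bsub>G\<^esub> g) ` {1..r}"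
        unfolding image_image using tg by (intro image_cong) auto
      then have a: "a (?\<psi> g x) = a x" using act.surj_prop[of "inv\<^bsub>G\<^esub> g"] g by (simp add: a_def)
      have \<phi>: "\<phi> (inv\<^bsub>G\<^esub> g) i \<in> {1..r}" if "i \<in> {1..r}" for i
        using act.element_image[OF _ that refl, of "inv\<^bsub>G\<^esub> g"] g by simp
      have \<rho>: "\<rho> (?\<psi> g x) = deleted_product_action G r \<phi> g (\<rho> x)"
      proof
        fix i
        show "\<rho> (?\<psi> g x) i = deleted_product_action G r \<phi> g (\<rho> x) i"
          using tg[of i g x] \<phi>[of i]
          by (cases "i \<in> {1..r}") (auto simp: \<rho>_def deleted_product_action_def deleted_join_action_apply)
      qed
      show ?thesis
      proof (cases "a x = 0")
        case False
        then have "0 < a x" using a0[of x] x by simp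
        then have "f (\<rho> (?\<psi> g x)) = orbit_join_action G n H g (f (\<rho> x))"
          unfolding \<rho> using equi[OF g \<rho>_in] x by simp
        then show ?thesis using a C by (simp add: B_def orbit_join_action_apply)
      qed (simp add: B_def a)
    qed
    show "\<exists>i\<in>{1..r}. \<exists>i'\<in>{1..r}. t x i \<noteq> t x i'" if x: "x \<in> topspace ?X" and B0: "B x = (\<lambda>_. 0)" for x
    proof (rule ccontr)
      assume const: "\<not> ?thesis"
      have "a x = 0"
      proof (rule ccontr)
        assume "a x \<noteq> 0"
        then have "0 < a x" using a0[of x] x by simp
        then have "f (\<rho> x) \<in> realization_points (orbit_join G n H)" using f_in x by simp
        moreover have "f (\<rho> x) w = 0" for w using fun_cong[OF B0, of w] \<open>a x \<noteq> 0\<close> by (simp add: B_def)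
        ultimately show False by (simp add: realization_points_def support_def)
      qed
      moreover have "a x \<in> (\<lambda>i. t x i) ` {1..r}" unfolding a_def using r0 by (intro Min_in) auto
      ultimately obtain i where "i \<in> {1..r}" "t x i = 0" by auto
      then have "t x i' = 0" if "i' \<in> {1..r}" for i' using const that by metis
      then have "(\<Sum>i\<in>{1..r}. t x i) = 0" by simp
      moreover have "(\<Sum>i\<in>{1..r}. t x i) = (\<Sum>w\<in>{1..m} \<times> {1..r}. x w)"
        unfolding t_def by (subst sum.swap) (simp add: sum.cartesian_product)
      moreover have "\<dots> = 1" by (rule sum_realization) (use x supp(1)[of x] in auto)
      ultimately show False by simp
    qed
  qed (rule cont_t)
qed

text \<open>In terms of \<open>genus_le_join\<close>: \<open>s x i\<close> is the least height at which the \<open>i\<close>-th part of \<open>x\<close> can be cut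
off so that the rest has its support in \<open>K\<close>.  It is a minimum over the faces of \<open>K\<close> of maxima of
coordinates, hence continuous.  The truncation \<open>\<rho>\<close> has total mass \<open>a\<close>.\<close>
lemma genus_deleted_join_ge:
  assumes prime: "prime p" and k: "1 \<le> k" and r: "r = p ^ k"
    and K: "complex_within {1..m} K" and unav: "unavoidable r m K"
    and torus: "p_torus p k G" and free: "free_action G {1..r} \<phi>"
    and gen: "genus G (realization (deleted_join r K)) (deleted_join_action G r \<phi>) = enat n"
  shows "m \<le> n + (r - 1)"
proof -
  let ?J = "deleted_join r K" and ?L = "deleted_join r (Pow {1..m})"
  let ?X = "realization ?L" and ?\<psi> = "deleted_join_action G r \<phi>"
  let ?S = "realization_points ?L"
  have p0: "0 < p" using prime prime_gt_0_nat by blast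
  then have r0: "1 \<le> r" using r by simp
  interpret group G using torus by (simp add: p_torus_def)
  interpret act: group_action G "{1..r}" \<phi> using free by (simp add: free_action_def)
  obtain H f where H: "\<forall>j\<in>{1..n}. subgroup (H j) G \<and> H j \<noteq> carrier G"
    and f: "continuous_map (realization ?J) (realization (orbit_join G n H)) f"
    and equi: "\<And>g x. g \<in> carrier G \<Longrightarrow> x \<in> topspace (realization ?J) \<Longrightarrow>
        f (?\<psi> g x) = orbit_join_action G n H g (f x)"
    using genus_witness[OF gen] by metis
  have K_sub: "F \<subseteq> {1..m}" if "F \<in> K" for F using K that by (auto simp: complex_within_def)
  have K_down: "B \<in> K" if "A \<in> K" "B \<subseteq> A" for A B using K that by (auto simp: complex_within_def)
  have K_empty: "{} \<in> K" using K by (simp add: complex_within_def)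
  have K_fin: "finite K" by (rule finite_subset[of _ "Pow {1..m}"]) (use K_sub in auto)
  have supp: "support x \<subseteq> {1..m} \<times> {1..r}" "inj_on fst (support x)" if "x \<in> ?S" for x
    using that by (auto simp: realization_points_def deleted_join_Pow)
  \<comment> \<open>The index 0 is not a vertex, and coordinates there are 0: it keeps the maxima below over
    nonempty sets and nonnegative.\<close>
  define V where "V F = {0..m} - F" for F :: "nat set"
  have V: "finite (V F)" "F \<in> K \<Longrightarrow> 0 \<in> V F" for F using K_sub[of F] by (auto simp: V_def)
  define s where "s x i = Min ((\<lambda>F. Max ((\<lambda>v. x (v, i)) ` V F)) ` K)" for x :: "nat \<times> nat \<Rightarrow> real" and i
  define \<rho> where "\<rho> x = (\<lambda>(v, i). if i \<in> {1..r} then max 0 (x (v, i) - s x i) else 0)" for x :: "nat \<times> nat \<Rightarrow> real"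
  let ?V = "{1..m} \<times> {1..r}"
  define a where "a x = (\<Sum>w\<in>?V. \<rho> x w)" for x
  define B where "B x w = a x * f (normalize ?V (\<rho> x)) w" for x w
  have x0: "x (0, i) = 0" if "x \<in> ?S" for x i
    using supp(1)[OF that] by (auto simp: support_def)
  have s_le: "s x i \<le> Max ((\<lambda>v. x (v, i)) ` V F)" if "F \<in> K" for x i F
    unfolding s_def using K_fin that by (intro Min_le) auto
  have s_attained: "\<exists>F\<in>K. s x i = Max ((\<lambda>v. x (v, i)) ` V F)" for x i
  proof -
    have "s x i \<in> (\<lambda>F. Max ((\<lambda>v. x (v, i)) ` V F)) ` K"
      unfolding s_def using K_fin K_empty by (intro Min_in) auto
    then show ?thesis by blast
  qed
  have Max_ge_0: "0 \<le> Max ((\<lambda>v. x (v, i)) ` V F)" if "x \<in> ?S" "F \<in> K" for x i F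
    using x0[OF that(1), of i] V(1)[of F] V(2)[OF that(2)] by (intro Max_ge) (auto intro!: image_eqI[of _ _ 0])
  have s0: "0 \<le> s x i" if "x \<in> ?S" for x i
    using s_attained[of x i] Max_ge_0[OF that] by metis
  have s_zero: "s x i = 0" if x: "x \<in> ?S" and F: "{v. (v, i) \<in> support x} \<in> K" for x i
  proof -
    let ?F = "{v. (v, i) \<in> support x}"
    have "Max ((\<lambda>v. x (v, i)) ` V ?F) \<le> 0"
      using V(1)[of ?F] V(2)[OF F] by (subst Max_le_iff) (auto simp: V_def support_def)
    then show ?thesis using s_le[OF F, of x i] s0[OF x, of i] by simp
  qed
  have level: "{v. s x i < x (v, i)} \<in> K" if x: "x \<in> ?S" for x i
  proof -
    obtain F where F: "F \<in> K" "s x i = Max ((\<lambda>v. x (v, i)) ` V F)" using s_attained by blast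
    have "{v. s x i < x (v, i)} \<subseteq> F"
    proof
      fix v assume v: "v \<in> {v. s x i < x (v, i)}"
      then have "0 < x (v, i)" using s0[OF x, of i] by simp
      then have "(v, i) \<in> support x" by (simp add: support_def)
      then have "v \<in> {1..m}" using supp(1)[OF x] by blast
      have "\<not> x (v, i) \<le> Max ((\<lambda>v. x (v, i)) ` V F)" using v F(2) by simp
      then have "v \<notin> V F" using V(1) by (metis (no_types, lifting) Max_ge finite_imageI imageI)
      then show "v \<in> F" using \<open>v \<in> {1..m}\<close> by (auto simp: V_def)
    qed
    then show ?thesis using K_down[OF F(1)] by blast
  qed
  have \<rho>0: "0 \<le> \<rho> x w" for x w by (simp add: \<rho>_def split: prod.split)
  have a0: "0 \<le> a x" for x unfolding a_def by (intro sum_nonneg \<rho>0)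
  have supp\<rho>: "support (\<rho> x) = (\<Union>i\<in>{1..r}. {v. s x i < x (v, i)} \<times> {i})" for x
    by (auto simp: support_def \<rho>_def split: if_splits)
  have \<rho>_join: "support (\<rho> x) \<in> ?J" if x: "x \<in> ?S" for x
    unfolding supp\<rho> deleted_join_def
  proof (intro CollectI exI[of _ "\<lambda>i. {v. s x i < x (v, i)}"] conjI ballI refl)
    show "disjoint_family_on (\<lambda>i. {v. s x i < x (v, i)}) {1..r}"
    proof (unfold disjoint_family_on_def, intro ballI impI, rule ccontr)
      fix i j assume ij: "i \<noteq> j" and "{v. s x i < x (v, i)} \<inter> {v. s x j < x (v, j)} \<noteq> {}"
      then obtain v where "s x i < x (v, i)" "s x j < x (v, j)" by blast
      then have "(v, i) \<in> support x" "(v, j) \<in> support x"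
        using s0[OF x, of i] s0[OF x, of j] by (auto simp: support_def)
      then show False using inj_onD[OF supp(2)[OF x], of "(v, i)" "(v, j)"] ij by simp
    qed
  qed (rule level[OF x])
  have supp\<rho>V: "support (\<rho> x) \<subseteq> ?V" if x: "x \<in> ?S" for x
  proof
    fix w assume "w \<in> support (\<rho> x)"
    then have "snd w \<in> {1..r}" "s x (snd w) < x w" unfolding supp\<rho> by auto
    then have "w \<in> support x" using s0[OF x, of "snd w"] by (auto simp: support_def)
    then show "w \<in> ?V" using supp(1)[OF x] by blast
  qed
  have \<rho>_nz: "\<rho> x \<noteq> (\<lambda>_. 0)" if "0 < a x" for x using that by (auto simp: a_def)
  have norm_in: "normalize ?V (\<rho> x) \<in> realization_points ?J" if "x \<in> ?S" "0 < a x" for x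
    using normalize_in_realization(2)[of ?V "\<rho> x" ?J] \<rho>0 supp\<rho>V \<rho>_join \<rho>_nz that by simp
  have cont_x: "continuous_map ?X euclideanreal (\<lambda>x. x w)" for w
    using continuous_map_coordinate[of ?X ?L id] by simp
  have cont_s: "continuous_map ?X euclideanreal (\<lambda>x. s x i)" for i
    unfolding s_def using K_fin K_empty V
    by (intro continuous_map_Min continuous_map_Max cont_x) auto
  have cont_\<rho>: "continuous_map ?X euclideanreal (\<lambda>x. \<rho> x w)" for w
  proof -
    obtain v i where w: "w = (v, i)" by (cases w)
    show ?thesis
    proof (cases "i \<in> {1..r}")
      case True
      then have "(\<lambda>x. \<rho> x w) = (\<lambda>x. max 0 (x (v, i) - s x i))" by (simp add: \<rho>_def w)
      moreover have "continuous_map ?X euclideanreal (\<lambda>x. max 0 (x (v, i) - s x i))"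
        by (intro continuous_map_real_max continuous_map_diff cont_x cont_s) simp
      ultimately show ?thesis by simp
    next
      case False
      then have "(\<lambda>x. \<rho> x w) = (\<lambda>x. 0)" by (auto simp: \<rho>_def w)
      then show ?thesis by simp
    qed
  qed
  have cont_a: "continuous_map ?X euclideanreal a"
    unfolding a_def by (intro continuous_map_sum cont_\<rho>) auto
  let ?X' = "top_of_set {x\<in>?S. 0 < a x}"
  have cont_norm: "continuous_map ?X' (realization ?J) (\<lambda>x. normalize ?V (\<rho> x))"
  proof (rule continuous_map_normalize)
    show "continuous_map ?X' euclideanreal (\<lambda>x. \<rho> x w)" for w
      using cont_\<rho>[of w] by (auto simp: realization_top_of_set intro: continuous_on_subset)
  qed (use \<rho>0 supp\<rho>V \<rho>_join \<rho>_nz in auto)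
  have f_in: "f (normalize ?V (\<rho> x)) \<in> realization_points (orbit_join G n H)" if "x \<in> ?S" "0 < a x" for x
    using f norm_in[OF that] by (auto simp: continuous_map_def)
  have "genus G ?X ?\<psi> \<le> enat (n + (r - 1))"
  proof (rule genus_le_join[OF prime k r torus free H, where B = B and t = s])
    show "continuous_map ?X euclideanreal (\<lambda>x. B x w)" for w
    proof -
      have "continuous_map ?X' euclideanreal (\<lambda>x. f (normalize ?V (\<rho> x)) w)"
        using continuous_map_coordinate[OF continuous_map_compose[OF cont_norm f]] by (simp add: comp_def)
      then have "continuous_on ?S (\<lambda>x. a x * f (normalize ?V (\<rho> x)) w)"
        using cont_a a0 realization_coordinate_le_1[OF f_in]
        by (intro continuous_on_scaled) (auto simp: realization_top_of_set)
      then show ?thesis by (simp add: B_def realization_top_of_set)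
    qed
    show "0 \<le> B x w" if "x \<in> topspace ?X" for x w
    proof (cases "a x = 0")
      case False
      then have "0 < a x" using a0[of x] by simp
      then show ?thesis using realization_coordinate_le_1(1)[OF f_in] that by (simp add: B_def)
    qed (simp add: B_def)
    show "support (B x) \<in> orbit_join G n H" if x: "x \<in> topspace ?X" for x
    proof (cases "a x = 0")
      case True
      then show ?thesis by (simp add: B_def support_def orbit_join_def)
    next
      case False
      then have "0 < a x" using a0[of x] by simp
      then have "support (f (normalize ?V (\<rho> x))) \<in> orbit_join G n H"
        using f_in[of x] x by (simp add: realization_points_def)
      moreover have "support (B x) = support (f (normalize ?V (\<rho> x)))" using False by (simp add: B_def support_def)
      ultimately show ?thesis by simp
    qed
    have sg: "s (?\<psi> g x) i = s x (\<phi> (inv\<^bsub>G\<^esub> g) i)" if "i \<in> {1..r}" for g x i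
      using that by (simp add: s_def deleted_join_action_apply)
    then show "s (?\<psi> g x) i = s x (\<phi> (inv\<^bsub>G\<^esub> g) i)" if "i \<in> {1..r}" for g x i using that .
    show "B (?\<psi> g x) (C, j) = B x (inv\<^bsub>G\<^esub> g <#\<^bsub>G\<^esub> C, j)"
      if g: "g \<in> carrier G" and x: "x \<in> topspace ?X" and C: "(C, j) \<in> orbit_vertices G n H" for g x C j
    proof -
      have \<phi>: "\<phi> (inv\<^bsub>G\<^esub> g) i \<in> {1..r}" if "i \<in> {1..r}" for i
        using act.element_image[OF _ that refl, of "inv\<^bsub>G\<^esub> g"] g by simp
      have \<rho>: "\<rho> (?\<psi> g x) (v, i) = ?\<psi> g (\<rho> x) (v, i)" for v i
        using sg[of i g x] \<phi>[of i]
        by (cases "i \<in> {1..r}") (auto simp: \<rho>_def deleted_join_action_apply)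
      have bij: "bij_betw (\<phi> (inv\<^bsub>G\<^esub> g)) {1..r} {1..r}"
        using act.bij_prop0[of "inv\<^bsub>G\<^esub> g"] g by (simp add: Bij_def)
      have a: "a (?\<psi> g x) = a x"
      proof -
        have sumV: "(\<Sum>w\<in>?V. h w) = (\<Sum>v\<in>{1..m}. \<Sum>i\<in>{1..r}. h (v, i))" for h :: "nat \<times> nat \<Rightarrow> real"
          by (simp add: sum.cartesian_product)
        have "a (?\<psi> g x) = (\<Sum>v\<in>{1..m}. \<Sum>i\<in>{1..r}. \<rho> x (v, \<phi> (inv\<^bsub>G\<^esub> g) i))"
          unfolding a_def sumV by (simp add: \<rho> deleted_join_action_apply)
        also have "\<dots> = (\<Sum>v\<in>{1..m}. \<Sum>i\<in>{1..r}. \<rho> x (v, i))"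
          by (simp only: sum.reindex_bij_betw[OF bij, of "\<lambda>i. \<rho> x (v, i)" for v])
        finally show ?thesis unfolding a_def sumV .
      qed
      have norm: "normalize ?V (\<rho> (?\<psi> g x)) = ?\<psi> g (normalize ?V (\<rho> x))"
      proof
        fix w
        show "normalize ?V (\<rho> (?\<psi> g x)) w = ?\<psi> g (normalize ?V (\<rho> x)) w"
          using a \<rho>[of "fst w" "snd w"]
          by (cases w) (simp add: normalize_def a_def deleted_join_action_apply)
      qed
      show ?thesis
      proof (cases "a x = 0")
        case False
        then have "0 < a x" using a0[of x] by simp
        then have "f (normalize ?V (\<rho> (?\<psi> g x))) = orbit_join_action G n H g (f (normalize ?V (\<rho> x)))"
          unfolding norm using equi[OF g] norm_in[of x] x by simp
        then show ?thesis using a C by (simp add: B_def orbit_join_action_apply)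
      qed (simp add: B_def a)
    qed
    show "\<exists>i\<in>{1..r}. \<exists>i'\<in>{1..r}. s x i \<noteq> s x i'" if x: "x \<in> topspace ?X" and B0: "B x = (\<lambda>_. 0)" for x
    proof (rule ccontr)
      assume const: "\<not> ?thesis"
      have xS: "x \<in> ?S" using x by simp
      have "a x = 0"
      proof (rule ccontr)
        assume "a x \<noteq> 0"
        then have "0 < a x" using a0[of x] by simp
        then have "f (normalize ?V (\<rho> x)) \<in> realization_points (orbit_join G n H)" using f_in xS by simp
        moreover have "f (normalize ?V (\<rho> x)) w = 0" for w
          using fun_cong[OF B0, of w] \<open>a x \<noteq> 0\<close> by (simp add: B_def)
        ultimately show False by (simp add: realization_points_def support_def)
      qed
      then have \<rho>z: "\<rho> x w = 0" if "w \<in> ?V" for w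
        using that \<rho>0 by (cases w) (simp add: a_def sum_nonneg_eq_0_iff)
      define A where "A i = {v. (v, i) \<in> support x}" for i
      have "\<exists>i\<in>{1..r}. A i \<in> K"
      proof (cases "\<exists>i\<in>{1..r}. A i = {}")
        case True
        then show ?thesis using K_empty by metis
      next
        case False
        have "A i \<subseteq> {1..m}" for i using supp(1)[OF xS] by (auto simp: A_def)
        moreover have "disjoint_family_on A {1..r}"
        proof -
          have "i = j" if "(v, i) \<in> support x" "(v, j) \<in> support x" for v i j
            using inj_onD[OF supp(2)[OF xS], of "(v, i)" "(v, j)"] that by simp
          then show ?thesis by (auto simp: disjoint_family_on_def A_def)
        qed
        ultimately show ?thesis using unav False unfolding unavoidable_def by blast
      qed
      then obtain i where "i \<in> {1..r}" "s x i = 0" using s_zero[OF xS] unfolding A_def by blast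
      then have sz: "s x i' = 0" if "i' \<in> {1..r}" for i' using const that by metis
      have "x w = 0" if w: "w \<in> ?V" for w
      proof -
        have "snd w \<in> {1..r}" using w by auto
        then have "max 0 (x w - s x (snd w)) = 0" using \<rho>z[OF w] by (cases w) (simp add: \<rho>_def)
        then show ?thesis
          using sz[OF \<open>snd w \<in> {1..r}\<close>] realization_coordinate_le_1(1)[OF xS, of w] by simp
      qed
      then have "(\<Sum>w\<in>?V. x w) = 0" by simp
      moreover have "(\<Sum>w\<in>?V. x w) = 1" by (rule sum_realization[OF xS supp(1)[OF xS]]) simp
      ultimately show False by simp
    qed
  qed (rule cont_s)
  then obtain N where N: "genus G ?X ?\<psi> = enat N" "N \<le> n + (r - 1)"
    by (metis enat_ile enat_ord_simps(1))
  obtain H' f' where "\<forall>j\<in>{1..N}. subgroup (H' j) G \<and> H' j \<noteq> carrier G"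
    "continuous_map ?X (realization (orbit_join G N H')) f'"
    "\<And>g x. g \<in> carrier G \<Longrightarrow> x \<in> topspace ?X \<Longrightarrow> f' (?\<psi> g x) = orbit_join_action G N H' g (f' x)"
    using genus_witness[OF N(1)] by metis
  then have "m \<le> N"
    using no_map_from_join_of_free_orbits[OF prime torus act.group_action_axioms r0] by blast
  then show ?thesis using N(2) by simp
qed

theorem theorem3p18:
  fixes p k r m :: nat
    and K :: "nat set set"
    and G :: "'g monoid"
    and \<phi> :: "'g \<Rightarrow> nat \<Rightarrow> nat"
  assumes "prime p" and "k \<ge> 1" and "r = p ^ k"
    and "complex_within {1..m} K" and "unavoidable r m K"
    and "p_torus p k G" and "free_action G {1..r} \<phi>"
  shows "equivariant_index G (deleted_product r K) (deleted_product_action G r \<phi>)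
       \<ge> equivariant_index G (realization (deleted_join r K)) (deleted_join_action G r \<phi>)
          - ereal (real r) + 1
     \<and> equivariant_index G (realization (deleted_join r K)) (deleted_join_action G r \<phi>)
          - ereal (real r) + 1
       \<ge> ereal (real m - 2 * real r + 1)"
proof -
  let ?P = "genus G (deleted_product r K) (deleted_product_action G r \<phi>)"
  let ?J = "genus G (realization (deleted_join r K)) (deleted_join_action G r \<phi>)"
  have "1 \<le> r" using prime_gt_0_nat[OF assms(1)] assms(3) by (simp add: Suc_le_eq)
  have "equivariant_index G (deleted_product r K) (deleted_product_action G r \<phi>)
       \<ge> equivariant_index G (realization (deleted_join r K)) (deleted_join_action G r \<phi>) - ereal (real r) + 1"
  proof (cases ?P)
    case (enat n)
    then have "?J \<le> enat (n + (r - 1))" by (rule genus_deleted_join_le[OF assms(1-4,6,7)])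
    then obtain n' where "?J = enat n'" "n' \<le> n + (r - 1)"
      by (metis enat_ile enat_ord_simps(1))
    then show ?thesis using enat \<open>1 \<le> r\<close> by (simp add: equivariant_index_def one_ereal_def of_nat_diff)
  qed (simp add: equivariant_index_def)
  moreover have "equivariant_index G (realization (deleted_join r K)) (deleted_join_action G r \<phi>) - ereal (real r) + 1
       \<ge> ereal (real m - 2 * real r + 1)"
  proof (cases ?J)
    case (enat n)
    then have "m \<le> n + (r - 1)" by (rule genus_deleted_join_ge[OF assms])
    then have "real m \<le> real n + (real r - 1)" using \<open>1 \<le> r\<close> by linarith
    then show ?thesis using enat by (simp add: equivariant_index_def one_ereal_def)
  qed (simp add: equivariant_index_def)
  ultimately show ?thesis by blast
qed

end
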